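(* Consider the aggregative game, with agents $i\in\mathcal I=\{1,\dots,N\}$ and affine aggregation, described in the context, and suppose that: (1) for each $i\in\mathcal I$, $\Omega_i\subseteq\mathbb R^{n_i}$ is closed and convex; $g_i:\mathbb R^{n_i}\to\mathbb R^m$ is componentwise convex and twice continuously differentiable; the set $\mathcal X=\Omega\cap\{x\in\mathbb R^n\mid g(x)\le \mathbf 0_m\}$ satisfies Slater's constraint qualification; $J_i$ is continuously differentiable and $J_i(\cdot,x_{-i})$ is convex for every $x_{-i}$; (2) the pseudo-gradient $F$ is $\mu$-strongly monotone for some $\mu>0$; (3) the communication graph $\mathcal G(\mathcal I,\mathcal E)$ is undirected and connected; (4) the mapping $\tilde{\boldsymbol F}$ is $\tilde\theta$-Lipschitz continuous for some $\tilde\theta>0$. Let $\gamma_i>0$ for all $i\in\mathcal I$, and consider the projected dynamical system in the variables $\mathrm{col}(x,\boldsymbol\varsigma,\boldsymbol k,\boldsymbol z,\boldsymbol\lambda)\in\mathbb R^n\times\mathbb R^{N\bar n}\times\mathbb R^N\times\mathbb R^{Nm}\times\mathbb R^{Nm}$: $$\begin{aligned} \dot x&=\Pi_\Omega\big(x,\,-\tilde{\boldsymbol F}(x,\boldsymbol\sigma)-\mathbb G(x)^\top\boldsymbol\lambda-B^\top\boldsymbol L_{\bar n}K\boldsymbol\rho\big),\\ \dot{\boldsymbol\varsigma}&=-\boldsymbol L_{\bar n}K\boldsymbol\rho,\qquad\boldsymbol\sigma=\boldsymbol\psi(x)+\boldsymbol\varsigma,\\ \dot{\boldsymbol k}&=D(\boldsymbol\rho)^\top(\Gamma\otimes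 I_{\bar n})\boldsymbol\rho,\qquad\boldsymbol\rho=\boldsymbol L_{\bar n}\boldsymbol\sigma,\\ \dot{\boldsymbol z}&=\boldsymbol L_m\boldsymbol\lambda,\\ \dot{\boldsymbol\lambda}&=\Pi_{\mathbb R^{Nm}_{\ge0}}\big(\boldsymbol\lambda,\,\boldsymbol g(x)-\boldsymbol z-\boldsymbol L_m\boldsymbol\lambda\big). \end{aligned}$$ Then, for any initial condition in $S=\Omega\times\boldsymbol E_{\bar n}^\perp\times\mathbb R^N\times\boldsymbol E_m^\perp\times\mathbb R^{mN}_{\ge0}$, the system has a unique Carathéodory solution (on $[0,\infty)$), which belongs to $S$ for all $t\ge0$. The solution converges to an equilibrium $\mathrm{col}(\bar x,\bar{\boldsymbol\varsigma},\bar{\boldsymbol k},\bar{\boldsymbol z},\bar{\boldsymbol\lambda})$ with $\boldsymbol\psi(\bar x)+\bar{\boldsymbol\varsigma}=\mathbf 1_N\otimes\psi(\bar x)$, $\bar{\boldsymbol\lambda}=\mathbf 1_N\otimes\lambda^*$, where $(\bar x,\lambda^* )$ satisfies the KKT conditions $$\mathbf 0_n\in F(\bar x)+\tfrac{\partial}{\partial x}g(\bar x)^\top\lambda^*+\mathrm N_\Omega(\bar x),\qquad \mathbf 0_m\in -g(\bar x)+\mathrm N_{\mathbb R^m_{\ge0}}(\lambda^* );$$ hence $\bar x$ is the variational generalized Nash equilibrium (v-GNE) of the game.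
   Context: Game. Agent $i$ chooses $x_i\in\Omega_i\subseteq\mathbb R^{n_i}$; $n=\sum_i n_i$, $x=\mathrm{col}((x_i)_{i\in\mathcal I})$ (stacking), $x_{-i}=\mathrm{col}((x_j)_{j\ne i})$, $\Omega=\times_i\Omega_i\subseteq\mathbb R^n$. Agent $i$ has cost $J_i(x_i,x_{-i})\in\mathbb R$. The coupling constraints are $g(x):=\sum_{i}g_i(x_i)\le\mathbf 0_m$, with $g_i:\mathbb R^{n_i}\to\mathbb R^m$, and $\mathcal X=\Omega\cap\{x\mid g(x)\le\mathbf 0_m\}$. A generalized Nash equilibrium (GNE) is $x^*$ such that, for all $i$, $x_i^*\in\operatorname{argmin}_{y_i}J_i(y_i,x_{-i}^* )$ subject to $(y_i,x_{-i}^* )\in\mathcal X$. A v-GNE is a GNE whose individual KKT systems hold with equal dual variables for all agents, i.e. a point for which there is $\lambda^*$ such that the KKT conditions displayed in the claim hold. Aggregative structure (affine aggregation): $J_i(x_i,x_{-i})=f_i(x_i,\psi(x))$ with $f_i:\mathbb R^{n_i}\times\mathbb R^{\bar n}\to\mathbb R$ (differentiable), $\psi(x):=\frac1N\sum_i\psi_i(x_i)$, $\psi_i(x_i)=B_ix_i+d_i$, $B_i\in\mathbb R^{\bar n\times n_i}$, $d_i\in\mathbb R^{\bar n}$. $\boldsymbol\psi(x):=\mathrm{col}((\psi_i(x_i))_i)\in\mathbb R^{N\bar n}$, $B:=\mathrm{diag}((B_i)_i)$ (block diagonal). Pseudo-gradient: $F(x):=\mathrm{col}((\nabla_{x_i}J_i(x_i,x_{-i}))_{i\in\mathcal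 I})$; it is $\mu$-strongly monotone if $(F(x)-F(y))^\top(x-y)\ge\mu\|x-y\|^2$ for all $x,y$. Extended pseudo-gradient: for $\boldsymbol\sigma=\mathrm{col}((\sigma^i)_i)\in\mathbb R^{N\bar n}$, $\tilde{\boldsymbol F}(x,\boldsymbol\sigma):=\mathrm{col}((\nabla_{x_i}f_i(x_i,\sigma^i))_i)$, where by convention $\nabla_{x_i}f_i(x_i,\sigma^i):=\nabla_yf_i(y,\sigma^i)|_{y=x_i}+\frac1NB_i^\top\nabla_yf_i(x_i,y)|_{y=\sigma^i}$. Graph: $W$ is the symmetric adjacency matrix of $\mathcal G$ ($[W]_{i,j}=1$ if $(i,j)\in\mathcal E$, $0$ otherwise) and $L$ its symmetric Laplacian; $\boldsymbol L_q:=L\otimes I_q$. Stacked variables: $\boldsymbol\varsigma=\mathrm{col}((\varsigma_i)_i)$ with $\varsigma_i\in\mathbb R^{\bar n}$, $\boldsymbol k=\mathrm{col}((k_i)_i)\in\mathbb R^N$, $\boldsymbol z=\mathrm{col}((z_i)_i)$, $\boldsymbol\lambda=\mathrm{col}((\lambda_i)_i)\in\mathbb R^{Nm}$, $\boldsymbol\rho=\mathrm{col}((\rho^i)_i)$ with $\rho^i\in\mathbb R^{\bar n}$. $K:=\mathrm{diag}((k_iI_{\bar n})_i)$, $D(\boldsymbol\rho):=\mathrm{diag}((\rho^i)_i)\in\mathbb R^{N\bar n\times N}$ (block diagonal), $\Gamma:=\mathrm{diag}((\gamma_i)_i)$ (so $\dot k_i=\gamma_i\|\rho^i\|^2$). $\boldsymbol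 g(x):=\mathrm{col}((g_i(x_i))_i)$, $\mathbb G(x):=\frac{\partial}{\partial x}\boldsymbol g(x)=\mathrm{diag}((\frac{\partial}{\partial x_i}g_i(x_i))_i)$. $\boldsymbol E_q^\perp:=\{\boldsymbol y\in\mathbb R^{Nq}\mid(\mathbf 1_N^\top\otimes I_q)\boldsymbol y=\mathbf 0_q\}$. Convex analysis: for closed convex $S$, $\mathrm N_S(x)=\{v\mid\sup_{z\in S}v^\top(z-x)\le0\}$ is the normal cone, $\mathrm T_S(x)=\mathrm{cl}(\bigcup_{\delta>0}\frac1\delta(S-x))$ the tangent cone, and $\Pi_S(x,v):=\mathrm{proj}_{\mathrm T_S(x)}(v)$ (Euclidean projection). A Carathéodory solution is an absolutely continuous function with the given initial value satisfying the differential equation for almost all $t\ge0$. An equilibrium is a point where the right-hand side vanishes. *)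

theory Defs
  imports "HOL-Analysis.Analysis"
begin

section \<open>Smoothness, gradients, cones\<close>

definition C1_map :: "('a::real_normed_vector \<Rightarrow> 'b::real_normed_vector) \<Rightarrow> bool" where
  "C1_map f \<longleftrightarrow>
     (\<exists>f' :: 'a \<Rightarrow> ('a \<Rightarrow>\<^sub>L 'b). (\<forall>x. (f has_derivative blinfun_apply (f' x)) (at x)) \<and> continuous_on UNIV f')"

definition C2_map :: "('a::real_normed_vector \<Rightarrow> 'b::real_normed_vector) \<Rightarrow> bool" where
  "C2_map f \<longleftrightarrow>
     (\<exists>f' :: 'a \<Rightarrow> ('a \<Rightarrow>\<^sub>L 'b). (\<forall>x. (f has_derivative blinfun_apply (f' x)) (at x)) \<and> C1_map f')"

definition gradient :: "('a::real_inner \<Rightarrow> real) \<Rightarrow> 'a \<Rightarrow> 'a" where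
  "gradient f x = (THE D. GDERIV f x :> D)"

text \<open>At points outside \<open>S\<close> the normal cone is not meaningful; statements using it carry
  the membership separately.\<close>

definition normal_cone :: "'a::real_inner set \<Rightarrow> 'a \<Rightarrow> 'a set" where
  "normal_cone S x = {v. \<forall>z\<in>S. v \<bullet> (z - x) \<le> 0}"

definition tangent_cone :: "'a::real_inner set \<Rightarrow> 'a \<Rightarrow> 'a set" where
  "tangent_cone S x = closure (\<Union>\<delta>\<in>{0<..}. (\<lambda>z. (1 / \<delta>) *\<^sub>R (z - x)) ` S)"

definition proj_dyn :: "'a::euclidean_space set \<Rightarrow> 'a \<Rightarrow> 'a \<Rightarrow> 'a" where
  "proj_dyn S x v = closest_point (tangent_cone S x) v"


section \<open>Caratheodory solutions\<close>

definition abs_continuous_on_interval ::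
    "real \<Rightarrow> real \<Rightarrow> (real \<Rightarrow> 'a::real_normed_vector) \<Rightarrow> bool" where
  "abs_continuous_on_interval a b f \<longleftrightarrow>
     (\<forall>\<epsilon>>0. \<exists>\<delta>>0. \<forall>D :: (real \<times> real) set.
        finite D \<and>
        (\<forall>(u, v)\<in>D. a \<le> u \<and> u \<le> v \<and> v \<le> b) \<and>
        pairwise (\<lambda>(u, v) (u', v'). {u<..<v} \<inter> {u'<..<v'} = {}) D \<and>
        (\<Sum>(u, v)\<in>D. v - u) < \<delta>
        \<longrightarrow> (\<Sum>(u, v)\<in>D. norm (f v - f u)) < \<epsilon>)"

text \<open>Absolute continuity on \<open>[0,\<infinity>)\<close> is meant on every compact subinterval. The values of
  \<open>s\<close> at negative times play no role.\<close>

definition caratheodory_solution ::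
    "('a::real_normed_vector \<Rightarrow> 'a) \<Rightarrow> 'a \<Rightarrow> (real \<Rightarrow> 'a) \<Rightarrow> bool" where
  "caratheodory_solution rhs s0 s \<longleftrightarrow>
     s 0 = s0 \<and>
     (\<forall>T>0. abs_continuous_on_interval 0 T s) \<and>
     (AE t in lborel. 0 \<le> t \<longrightarrow> (s has_vector_derivative rhs (s t)) (at t))"


section \<open>Communication graph\<close>

definition undirected_connected :: "('i \<times> 'i) set \<Rightarrow> bool" where
  "undirected_connected E \<longleftrightarrow> sym E \<and> (\<forall>i j. (i, j) \<in> E\<^sup>*)"

definition adjacency :: "('i \<times> 'i) set \<Rightarrow> real^'i^'i" where
  "adjacency E = (\<chi> i j. if (i, j) \<in> E then 1 else 0)"

text \<open>Self-loops cancel in the Laplacian, so irreflexivity of \<open>E\<close> is not needed.\<close>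

definition laplacian :: "('i \<times> 'i) set \<Rightarrow> real^'i^'i" where
  "laplacian E = (\<chi> i j. if i = j then \<Sum>l\<in>UNIV. adjacency E $ i $ l else 0) - adjacency E"


section \<open>Stacked vectors with blocks of equal size\<close>

text \<open>The space of stacked vectors with one block of dimension \<open>CARD('q)\<close> per agent is
  \<open>real^'q^'i\<close>; its norm is the Euclidean norm of the stacked vector.\<close>

text \<open>Action of the Kronecker product of \<open>A\<close> with the identity.\<close>

definition kron_id :: "real^'i^'i \<Rightarrow> real^'q^'i \<Rightarrow> real^'q^'i" where
  "kron_id A y = (\<chi> i. \<Sum>j\<in>UNIV. A $ i $ j *\<^sub>R y $ j)"

abbreviation lap :: "('i \<times> 'i) set \<Rightarrow> real^'q^'i \<Rightarrow> real^'q^'i" where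
  "lap E \<equiv> kron_id (laplacian E)"

text \<open>Action of the block diagonal matrix with blocks \<open>k\<^sub>i I\<close>.\<close>

definition block_scale :: "real^'i \<Rightarrow> real^'q^'i \<Rightarrow> real^'q^'i" where
  "block_scale k y = (\<chi> i. k $ i *\<^sub>R y $ i)"

text \<open>\<open>D(\<rho>)\<^sup>T y\<close>, where \<open>D(\<rho>)\<close> is block diagonal with the columns \<open>\<rho>\<^sup>i\<close> as blocks.\<close>

definition D_transpose :: "real^'q^'i \<Rightarrow> real^'q^'i \<Rightarrow> real^'i" where
  "D_transpose \<rho> y = (\<chi> i. \<rho> $ i \<bullet> y $ i)"

text \<open>Kronecker product of the all-ones vector with \<open>v\<close>.\<close>

definition replicated :: "real^'q \<Rightarrow> real^'q^'i" where
  "replicated v = (\<chi> i. v)"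

definition E_perp :: "(real^'q^'i) set" where
  "E_perp = {y. (\<Sum>i\<in>UNIV. y $ i) = 0}"


section \<open>Aggregative game\<close>

text \<open>
  Agents are the elements of \<open>'i\<close>, so \<open>N = CARD('i)\<close>. The agents' own dimensions \<open>n\<^sub>i\<close> may
  differ: the \<open>n = CARD('n)\<close> coordinates of the stacked decision \<open>x\<close> are distributed among the
  agents by the map \<open>owner\<close>, and \<open>n\<^sub>i\<close> is the number of coordinates owned by \<open>i\<close>. The space
  \<open>\<real>\<^bsup>n\<^sub>i\<^esup>\<close> is the coordinate subspace \<open>agent_space G i\<close>, i.e. a vector of agent \<open>i\<close> is padded with
  zeros. The functions \<open>loc_cost G i\<close>, \<open>loc_constr G i\<close> are functions on this subspace and are
  only ever evaluated there (through \<open>blk\<close>); likewise only the columns of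
  \<open>agg_mat G i\<close> owned by \<open>i\<close> matter.
\<close>

record ('i, 'n::finite, 'p::finite, 'm::finite) agg_game =
  owner :: "'n \<Rightarrow> 'i"
  strategies :: "'i \<Rightarrow> (real^'n) set"
  loc_cost :: "'i \<Rightarrow> real^'n \<Rightarrow> real^'p \<Rightarrow> real"
  agg_mat :: "'i \<Rightarrow> real^'n^'p"
  agg_vec :: "'i \<Rightarrow> real^'p"
  loc_constr :: "'i \<Rightarrow> real^'n \<Rightarrow> real^'m"

definition agent_space :: "('i, 'n::finite, 'p::finite, 'm::finite) agg_game \<Rightarrow> 'i \<Rightarrow> (real^'n) set" where
  "agent_space G i = {v. \<forall>k. owner G k \<noteq> i \<longrightarrow> v $ k = 0}"

text \<open>The component \<open>x\<^sub>i\<close> of \<open>x\<close>.\<close>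

definition blk :: "('i, 'n::finite, 'p::finite, 'm::finite) agg_game \<Rightarrow> 'i \<Rightarrow> real^'n \<Rightarrow> real^'n" where
  "blk G i x = (\<chi> k. if owner G k = i then x $ k else 0)"

text \<open>Stacking of one vector per agent into \<open>\<real>\<^sup>n\<close>; reads off the block owned by each agent.\<close>

definition col :: "('i, 'n::finite, 'p::finite, 'm::finite) agg_game \<Rightarrow> ('i \<Rightarrow> real^'n) \<Rightarrow> real^'n" where
  "col G v = (\<chi> k. v (owner G k) $ k)"

text \<open>The profile \<open>(y\<^sub>i, x\<^bsub>-i\<^esub>)\<close>.\<close>

definition deviate :: "('i, 'n::finite, 'p::finite, 'm::finite) agg_game \<Rightarrow> 'i \<Rightarrow> real^'n \<Rightarrow> real^'n \<Rightarrow> real^'n" where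
  "deviate G i y x = (\<chi> k. if owner G k = i then y $ k else x $ k)"

definition Omega :: "('i, 'n::finite, 'p::finite, 'm::finite) agg_game \<Rightarrow> (real^'n) set" where
  "Omega G = {x. \<forall>i. blk G i x \<in> strategies G i}"

definition constr :: "('i::finite, 'n::finite, 'p::finite, 'm::finite) agg_game \<Rightarrow> real^'n \<Rightarrow> real^'m" where
  "constr G x = (\<Sum>i\<in>UNIV. loc_constr G i (blk G i x))"

definition feasible :: "('i::finite, 'n::finite, 'p::finite, 'm::finite) agg_game \<Rightarrow> (real^'n) set" where
  "feasible G = Omega G \<inter> {x. constr G x \<le> 0}"

definition slater :: "('i::finite, 'n::finite, 'p::finite, 'm::finite) agg_game \<Rightarrow> bool" where
  "slater G \<longleftrightarrow> (\<exists>x \<in> rel_interior (Omega G). \<forall>j. constr G x $ j < 0)"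

definition agg_loc :: "('i, 'n::finite, 'p::finite, 'm::finite) agg_game \<Rightarrow> 'i \<Rightarrow> real^'n \<Rightarrow> real^'p" where
  "agg_loc G i y = agg_mat G i *v y + agg_vec G i"

definition aggregate :: "('i::finite, 'n::finite, 'p::finite, 'm::finite) agg_game \<Rightarrow> real^'n \<Rightarrow> real^'p" where
  "aggregate G x = (1 / real CARD('i)) *\<^sub>R (\<Sum>i\<in>UNIV. agg_loc G i (blk G i x))"

definition agg_stack :: "('i::finite, 'n::finite, 'p::finite, 'm::finite) agg_game \<Rightarrow> real^'n \<Rightarrow> real^'p^'i" where
  "agg_stack G x = (\<chi> i. agg_loc G i (blk G i x))"

definition cost :: "('i::finite, 'n::finite, 'p::finite, 'm::finite) agg_game \<Rightarrow> 'i \<Rightarrow> real^'n \<Rightarrow> real" where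
  "cost G i x = loc_cost G i (blk G i x) (aggregate G x)"

definition pseudo_gradient :: "('i::finite, 'n::finite, 'p::finite, 'm::finite) agg_game \<Rightarrow> real^'n \<Rightarrow> real^'n" where
  "pseudo_gradient G x = col G (\<lambda>i. gradient (\<lambda>y. cost G i (deviate G i y x)) x)"

definition ext_pseudo_gradient ::
    "('i::finite, 'n::finite, 'p::finite, 'm::finite) agg_game \<Rightarrow> real^'n \<Rightarrow> real^'p^'i \<Rightarrow> real^'n" where
  "ext_pseudo_gradient G x \<sigma> = col G (\<lambda>i.
     gradient (\<lambda>y. loc_cost G i (blk G i y) (\<sigma> $ i)) x
     + (1 / real CARD('i)) *\<^sub>R
         (transpose (agg_mat G i) *v gradient (\<lambda>w. loc_cost G i (blk G i x) w) (\<sigma> $ i)))"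

definition is_GNE :: "('i::finite, 'n::finite, 'p::finite, 'm::finite) agg_game \<Rightarrow> real^'n \<Rightarrow> bool" where
  "is_GNE G x \<longleftrightarrow>
     (\<forall>i. is_arg_min (\<lambda>y. cost G i (deviate G i y x)) (\<lambda>y. deviate G i y x \<in> feasible G) (blk G i x))"

definition KKT :: "('i::finite, 'n::finite, 'p::finite, 'm::finite) agg_game \<Rightarrow> real^'n \<Rightarrow> real^'m \<Rightarrow> bool" where
  "KKT G x \<nu> \<longleftrightarrow>
     x \<in> Omega G \<and> 0 \<le> \<nu> \<and>
     (\<exists>v \<in> normal_cone (Omega G) x.
        0 = pseudo_gradient G x + transpose (jacobian (constr G) (at x)) *v \<nu> + v) \<and>
     (\<exists>w \<in> normal_cone {l. 0 \<le> l} \<nu>. 0 = - constr G x + w)"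

definition is_vGNE :: "('i::finite, 'n::finite, 'p::finite, 'm::finite) agg_game \<Rightarrow> real^'n \<Rightarrow> bool" where
  "is_vGNE G x \<longleftrightarrow> is_GNE G x \<and> (\<exists>\<nu>. KKT G x \<nu>)"


section \<open>Projected dynamics\<close>

definition agg_transpose :: "('i, 'n::finite, 'p::finite, 'm::finite) agg_game \<Rightarrow> real^'p^'i \<Rightarrow> real^'n" where
  "agg_transpose G y = col G (\<lambda>i. transpose (agg_mat G i) *v (y $ i))"

definition constr_stack :: "('i, 'n::finite, 'p::finite, 'm::finite) agg_game \<Rightarrow> real^'n \<Rightarrow> real^'m^'i" where
  "constr_stack G x = (\<chi> i. loc_constr G i (blk G i x))"

text \<open>Transpose of the block diagonal Jacobian of \<open>constr_stack G\<close>, applied to \<open>\<nu>\<close>.\<close>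

definition constr_jac_transpose ::
    "('i, 'n::finite, 'p::finite, 'm::finite) agg_game \<Rightarrow> real^'n \<Rightarrow> real^'m^'i \<Rightarrow> real^'n" where
  "constr_jac_transpose G x \<nu> =
     col G (\<lambda>i. transpose (jacobian (\<lambda>y. loc_constr G i (blk G i y)) (at x)) *v (\<nu> $ i))"

type_synonym ('i, 'n, 'p, 'm) state =
  "(real^'n) \<times> (real^'p^'i) \<times> (real^'i) \<times> (real^'m^'i) \<times> (real^'m^'i)"

text \<open>In a state \<open>(x, \<tau>, k, z, \<nu>)\<close>, \<open>\<tau>\<close> is the offset variable (varsigma) correcting the local
  aggregation values, \<open>k\<close> the adaptive gains, \<open>\<nu>\<close> the stacked dual variables.\<close>

definition dynamics ::
    "('i::finite, 'n::finite, 'p::finite, 'm::finite) agg_game \<Rightarrow> ('i \<times> 'i) set \<Rightarrow> real^'i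
     \<Rightarrow> ('i, 'n, 'p, 'm) state \<Rightarrow> ('i, 'n, 'p, 'm) state" where
  "dynamics G E \<gamma> = (\<lambda>(x, \<tau>, k, z, \<nu>).
     let \<sigma> = agg_stack G x + \<tau>;
         \<rho> = lap E \<sigma>;
         K\<rho> = block_scale k \<rho>
     in (proj_dyn (Omega G) x
           (- ext_pseudo_gradient G x \<sigma> - constr_jac_transpose G x \<nu> - agg_transpose G (lap E K\<rho>)),
         - lap E K\<rho>,
         D_transpose \<rho> (block_scale \<gamma> \<rho>),
         lap E \<nu>,
         proj_dyn {l. 0 \<le> l} \<nu> (constr_stack G x - z - lap E \<nu>)))"

definition state_set ::
    "('i::finite, 'n::finite, 'p::finite, 'm::finite) agg_game \<Rightarrow> ('i, 'n, 'p, 'm) state set" where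
  "state_set G = Omega G \<times> E_perp \<times> UNIV \<times> E_perp \<times> {l. 0 \<le> l}"

end

theory Submission
  imports Defs "HOL-Complex_Analysis.Great_Picard"
begin

text \<open>
  A solution of the projected system is characterised by the variational inequality
  \<open>(f s - s') \<bullet> (y - s) \<le> 0\<close> for all \<open>y\<close> in the closed convex state set. Solutions are obtained as
  limits of projected Euler polygons, which are uniformly Lipschitz; the limit is differentiable almost
  everywhere and inherits the inequality from a discrete energy estimate. Uniqueness is Gronwall's
  lemma. Centred at a KKT point, a quadratic Lyapunov function decreases, which bounds the solution and
  forces every limit point to have the primal variable of the unique variational equilibrium, exact
  tracking of the aggregate and consensus of the duals. Testing the inequality on short and long time
  windows near a limit point shows that the limit point itself satisfies the KKT conditions; recentring
  the Lyapunov function there, and using that the gains are monotone and bounded, gives convergence.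
\<close>

section \<open>Absolutely continuous functions\<close>

text \<open>The right-hand side jumps at the boundary of the constraint sets, so neither Picard nor
  Peano applies to it. The variational inequality says that \<open>f s - s'\<close> lies in the
  normal cone at \<open>s\<close>. Its integrated form survives limits, and when two solutions are
  tested against each other the cone terms have a favourable sign, so that only the field
  \<open>f\<close> matters. That field is Lipschitz merely on bounded sets; it is cut off outside a
  ball, and the Lyapunov bound shows that the cut-off is never met. The obstacle to convergence is
  that equilibria are not isolated: multipliers, the splitting \<open>z\<close> of the constraint
  and above all the gains need not be unique. A Lyapunov function of decreasing type is available
  only with artificial gains in its centre, so it need not vanish at any limit of the solution.
  Passing to the limit gains changes one block of the centre and destroys monotonicity, but not the
  existence of a limit.\<close>

lemma ac_nonincreasing:
  fixes f :: "real \<Rightarrow> real"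
  assumes ac: "abs_continuous_on_interval a b f" and ab: "a \<le> b"
    and der: "AE t in lborel. a < t \<and> t < b \<longrightarrow> (\<exists>d\<le>0. (f has_real_derivative d) (at t))"
  shows "f b \<le> f a"
proof -
  \<comment> \<open>Henstock's argument: on a fine tagged division, intervals tagged at a good point
    contribute at most \<open>e\<close> times their length, while those tagged in the null set lie
    in an open set of small measure, where absolute continuity bounds the sum of their increments by
    \<open>e\<close>.\<close>
  have key: "f b - f a \<le> e * (b - a) + e" if e: "e > 0" for e
  proof -
    obtain d where d: "d > 0" and D: "\<And>D. \<lbrakk>finite D; \<And>u v. (u, v) \<in> D \<Longrightarrow> a \<le> u \<and> u \<le> v \<and> v \<le> b;
        pairwise (\<lambda>(u, v) (u', v'). {u<..<v} \<inter> {u'<..<v'} = {}) D; (\<Sum>(u, v)\<in>D. v - u) < d\<rbrakk>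
        \<Longrightarrow> (\<Sum>(u, v)\<in>D. norm (f v - f u)) < e"
      using ac[unfolded abs_continuous_on_interval_def, rule_format, OF e] by (elim exE conjE) (rule that, assumption, blast)
    obtain N0 where N0: "N0 \<in> null_sets lborel"
        "{t \<in> space lborel. \<not> (a < t \<and> t < b \<longrightarrow> (\<exists>d\<le>0. (f has_real_derivative d) (at t)))} \<subseteq> N0"
      using der unfolding eventually_ae_filter by (elim bexE)
    \<comment> \<open>The endpoints join the null set because a derivative is assumed only in the
      open interval.\<close>
    define N where "N = N0 \<union> {a, b}"
    have N: "N \<in> null_sets lborel"
      unfolding N_def by (rule null_sets.Un[OF N0(1)], rule finite_imp_null_set_lborel) simp
    obtain U where U: "open U" "N \<subseteq> U" "emeasure lborel U < ennreal d"
    proof -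
      obtain U where U: "open U" "N \<subseteq> U" "emeasure lborel (U - N) < ennreal d"
        using outer_regular_lborel[of N d] N d by (metis null_setsD2 sets_lborel)
      have "emeasure lborel U = emeasure lborel (U - N)"
        using emeasure_Diff_null_set[OF N, of U] U(1) by simp
      then show ?thesis using that U by simp
    qed
    have good: "\<exists>r>0. \<forall>u v. u \<le> t \<and> t \<le> v \<and> u \<in> ball t r \<and> v \<in> ball t r \<longrightarrow> f v - f u \<le> e * (v - u)"
      if t: "t \<notin> N" "t \<in> {a..b}" for t
    proof -
      have "a < t \<and> t < b" using t by (auto simp: N_def)
      then obtain c where c: "c \<le> 0" "(f has_real_derivative c) (at t)"
        using subsetD[OF N0(2), of t] t(1) unfolding N_def by auto
      then obtain r where r: "r > 0"
          "\<And>y. norm (y - t) < r \<Longrightarrow> norm (f y - f t - c * (y - t)) \<le> e * norm (y - t)"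
        using e unfolding has_field_derivative_def has_derivative_at_alt by (auto simp: mult.commute)
      show ?thesis
      proof (intro exI[of _ r] conjI allI impI r)
        fix u v assume uv: "u \<le> t \<and> t \<le> v \<and> u \<in> ball t r \<and> v \<in> ball t r"
        have "f v - f t - c * (v - t) \<le> e * (v - t)"
          using r(2)[of v] uv by (auto simp: dist_real_def abs_le_iff)
        moreover have "- (f u - f t - c * (u - t)) \<le> e * (t - u)"
          using r(2)[of u] uv by (auto simp: dist_real_def abs_le_iff)
        moreover have "c * (v - t) \<le> 0" "c * (t - u) \<le> 0"
          using c uv by (auto simp: mult_nonpos_nonneg)
        ultimately show "f v - f u \<le> e * (v - u)" by (simp add: algebra_simps)
      qed
    qed
    then have "\<forall>t. \<exists>r. t \<notin> N \<longrightarrow> t \<in> {a..b} \<longrightarrow> r > 0 \<and> (\<forall>u v. u \<le> t \<and> t \<le> v \<and> u \<in> ball t r \<and> v \<in> ball t r \<longrightarrow> f v - f u \<le> e * (v - u))"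
      by blast
    then have "\<exists>r. \<forall>t. t \<notin> N \<longrightarrow> t \<in> {a..b} \<longrightarrow> r t > 0 \<and> (\<forall>u v. u \<le> t \<and> t \<le> v \<and> u \<in> ball t (r t) \<and> v \<in> ball t (r t) \<longrightarrow> f v - f u \<le> e * (v - u))"
      by (rule choice)
    then obtain r where r: "\<And>t. t \<notin> N \<Longrightarrow> t \<in> {a..b} \<Longrightarrow> r t > 0"
      "\<And>t u v. t \<notin> N \<Longrightarrow> t \<in> {a..b} \<Longrightarrow> u \<le> t \<Longrightarrow> t \<le> v \<Longrightarrow> u \<in> ball t (r t) \<Longrightarrow> v \<in> ball t (r t)
         \<Longrightarrow> f v - f u \<le> e * (v - u)"
      by blast
    \<comment> \<open>At null tags the gauge is all of \<open>U\<close>, which forces their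
      intervals into \<open>U\<close>.\<close>
    define g where "g t = (if t \<in> N then U else if t \<in> {a..b} then ball t (r t) else ball t 1)" for t
    have "gauge g" unfolding gauge_def g_def using U r(1) by auto
    then obtain p where p: "p tagged_division_of (cbox a b)" "g fine p"
      using fine_division_exists by blast
    have pf: "finite p" using p(1) by blast
    have K: "\<exists>u v. K = {u..v} \<and> u \<le> v \<and> a \<le> u \<and> v \<le> b \<and> t \<in> {u..v} \<and> Inf K = u \<and> Sup K = v \<and> K \<subseteq> g t"
      if tK: "(t, K) \<in> p" for t K
    proof -
      obtain u v where "K = cbox u v" using tagged_division_ofD(4)[OF p(1) tK] by blast
      moreover have "t \<in> K" "K \<subseteq> cbox a b" using tagged_division_ofD(2,3)[OF p(1) tK] by auto
      moreover have "K \<subseteq> g t" using p(2) tK by (auto simp: fine_def)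
      ultimately show ?thesis by (intro exI[of _ u] exI[of _ v]) auto
    qed
    have tele: "(\<Sum>(t,K)\<in>p. f (Sup K) - f (Inf K)) = f b - f a"
      using additive_tagged_division_1[OF ab, of p f] p(1) by (simp add: box_real)
    have len: "(\<Sum>(t,K)\<in>p. Sup K - Inf K) = b - a"
      using additive_tagged_division_1[OF ab, of p "\<lambda>x. x"] p(1) by (simp add: box_real)
    \<comment> \<open>Degenerate intervals are left out so that distinct members have distinct
      endpoint pairs, as \<open>inj\<close> requires; their increments are zero anyway.\<close>
    define p1 where "p1 = {(t,K)\<in>p. t \<in> N \<and> Inf K < Sup K}"
    have p1: "p1 \<subseteq> p" "finite p1" using pf by (auto simp: p1_def intro: finite_subset)
    define h where "h = (\<lambda>(t::real,K::real set). (Inf K, Sup K))"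
    have disj: "interior K \<inter> interior K' = {}" if "(t,K) \<in> p" "(t',K') \<in> p" "(t,K) \<noteq> (t',K')" for t K t' K'
      using tagged_division_ofD(5)[OF p(1) that] .
    have disj': "{Inf K<..<Sup K} \<inter> {Inf K'<..<Sup K'} = {}"
      if "(t,K) \<in> p" "(t',K') \<in> p" "(t,K) \<noteq> (t',K')" for t K t' K'
    proof -
      have "interior K = {Inf K<..<Sup K}" "interior K' = {Inf K'<..<Sup K'}"
        using K[OF that(1)] K[OF that(2)] interior_atLeastAtMost_real by metis+
      then show ?thesis using disj[OF that] by simp
    qed
    have inj: "inj_on h p1"
    proof (rule inj_onI)
      fix x y assume xy: "x \<in> p1" "y \<in> p1" "h x = h y"
      obtain t K t' K' where eq: "x = (t,K)" "y = (t',K')" by (cases x, cases y)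
      have "Inf K = Inf K'" "Sup K = Sup K'" "Inf K < Sup K" using xy eq by (auto simp: h_def p1_def)
      moreover have "(Inf K + Sup K)/2 \<in> {Inf K<..<Sup K}" using \<open>Inf K < Sup K\<close> by auto
      ultimately show "x = y" using disj'[of t K t' K'] xy eq p1 by (metis disjoint_iff subsetD)
    qed
    have "(\<Sum>(u, v)\<in>h ` p1. norm (f v - f u)) < e"
    proof (rule D)
      show "finite (h ` p1)" using p1 by simp
      show "a \<le> u \<and> u \<le> v \<and> v \<le> b" if uv: "(u, v) \<in> h ` p1" for u v
        using uv K p1(1) by (fastforce simp: h_def)
      show "pairwise (\<lambda>(u, v) (u', v'). {u<..<v} \<inter> {u'<..<v'} = {}) (h ` p1)"
      proof (rule pairwiseI, goal_cases)
        case (1 x y)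
        then obtain t K t' K' where A: "(t,K) \<in> p1" "(t',K') \<in> p1" "x = h (t,K)" "y = h (t',K')" "x \<noteq> y"
          by auto
        have "{Inf K<..<Sup K} \<inter> {Inf K'<..<Sup K'} = {}"
          by (rule disj'[of t K t' K']) (use A p1 in auto)
        then show ?case using A by (simp add: h_def)
      qed
      have "(\<Sum>(u, v)\<in>h ` p1. v - u) = (\<Sum>(t,K)\<in>p1. Sup K - Inf K)"
        by (subst sum.reindex[OF inj]) (auto simp: h_def case_prod_beta)
      also have "\<dots> = (\<Sum>x\<in>p1. measure lborel {Inf (snd x)<..<Sup (snd x)})"
        by (rule sum.cong) (auto simp: p1_def)
      also have "\<dots> = measure lborel (\<Union>x\<in>p1. {Inf (snd x)<..<Sup (snd x)})"
      proof (rule measure_finite_Union[symmetric])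
        show "disjoint_family_on (\<lambda>x. {Inf (snd x)<..<Sup (snd x)}) p1"
          using disj' p1(1) by (fastforce simp: disjoint_family_on_def)
        show "emeasure lborel {Inf (snd i)<..<Sup (snd i)} \<noteq> \<infinity>" if "i \<in> p1" for i
          using that by (auto simp: p1_def)
      qed (use p1 in auto)
      also have "\<dots> \<le> measure lborel U"
      proof (rule measure_mono_fmeasurable)
        show "(\<Union>x\<in>p1. {Inf (snd x)<..<Sup (snd x)}) \<subseteq> U"
        proof clarsimp
          fix y t K assume A: "(t,K) \<in> p1" "Inf K < y" "y < Sup K"
          then have "y \<in> g t" using K[of t K] p1 by force
          then show "y \<in> U" using A by (auto simp: g_def p1_def)
        qed
        show "U \<in> fmeasurable lborel"
          using U(1,3) by (auto simp: fmeasurable_def intro: order_less_trans)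
        show "(\<Union>x\<in>p1. {Inf (snd x)<..<Sup (snd x)}) \<in> sets lborel"
          using p1(2) by (intro sets.finite_UN) auto
      qed
      also have "\<dots> < d"
      proof -
        have "emeasure lborel U = ennreal (measure lborel U)"
          using U(3) by (intro emeasure_eq_ennreal_measure) auto
        then show ?thesis using U(3) d by (simp add: ennreal_less_iff)
      qed
      finally show "(\<Sum>(u, v)\<in>h ` p1. v - u) < d" .
    qed
    moreover have "(\<Sum>(u, v)\<in>h ` p1. norm (f v - f u)) = (\<Sum>(t,K)\<in>p1. norm (f (Sup K) - f (Inf K)))"
      by (subst sum.reindex[OF inj]) (auto simp: h_def case_prod_beta)
    ultimately have s1: "(\<Sum>(t,K)\<in>p1. norm (f (Sup K) - f (Inf K))) < e" by simp
    have "f b - f a = (\<Sum>(t,K)\<in>p1. f (Sup K) - f (Inf K)) + (\<Sum>(t,K)\<in>p - p1. f (Sup K) - f (Inf K))"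
      using tele sum.subset_diff[OF p1(1) pf, of "\<lambda>(t,K). f (Sup K) - f (Inf K)"] by simp
    also have "(\<Sum>(t,K)\<in>p1. f (Sup K) - f (Inf K)) \<le> (\<Sum>(t,K)\<in>p1. norm (f (Sup K) - f (Inf K)))"
      by (rule sum_mono) auto
    also have "(\<Sum>(t,K)\<in>p - p1. f (Sup K) - f (Inf K)) \<le> (\<Sum>(t,K)\<in>p - p1. e * (Sup K - Inf K))"
    proof (rule sum_mono, clarify)
      fix t K assume A: "(t,K) \<in> p" "(t,K) \<notin> p1"
      from K[OF A(1)] obtain u v where uv: "K = {u..v}" "u \<le> v" "a \<le> u" "v \<le> b" "t \<in> {u..v}"
        "Inf K = u" "Sup K = v" "K \<subseteq> g t" by blast
      show "f (Sup K) - f (Inf K) \<le> e * (Sup K - Inf K)"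
      proof (cases "u = v")
        case False
        then have "t \<notin> N" using A uv by (auto simp: p1_def)
        moreover have "t \<in> {a..b}" using uv by auto
        ultimately have "K \<subseteq> ball t (r t)" using uv(8) by (simp add: g_def)
        moreover have "u \<in> K" "v \<in> K" using uv by auto
        ultimately have "u \<in> ball t (r t)" "v \<in> ball t (r t)" by blast+
        then show ?thesis using r(2)[of t u v] \<open>t \<notin> N\<close> \<open>t \<in> {a..b}\<close> uv by auto
      qed (use uv in auto)
    qed
    also have "\<dots> \<le> (\<Sum>(t,K)\<in>p. e * (Sup K - Inf K))"
    proof (rule sum_mono2[OF pf])
      show "0 \<le> (case x of (t, K) \<Rightarrow> e * (Sup K - Inf K))" if "x \<in> p - (p - p1)" for x
      proof (cases x)
        case (Pair t K)
        then show ?thesis using K[of t K] that e by auto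
      qed
    qed auto
    also have "\<dots> = e * (b - a)" using len by (simp add: sum_distrib_left[symmetric] case_prod_beta)
    finally show ?thesis using s1 by linarith
  qed
  show ?thesis
  proof (rule ccontr)
    assume "\<not> ?thesis"
    then have pos: "f b - f a > 0" by simp
    \<comment> \<open>With this \<open>e\<close> the bound \<open>e * (b - a) + e\<close> is exactly
      half of the increment; the summand 1 covers the case \<open>a = b\<close>.\<close>
    define e where "e = (f b - f a) / (2 * (b - a + 1))"
    have "e > 0" using pos ab by (simp add: e_def)
    moreover have "e * (b - a) + e = (f b - f a)/2"
      using ab by (simp add: e_def field_simps add_divide_distrib[symmetric])
    ultimately have "f b - f a \<le> (f b - f a) / 2" using key[of e] by simp
    then show False using pos by simp
  qed
qed

lemma ac_continuous_on:
  assumes "abs_continuous_on_interval a b f"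
  shows "continuous_on {a..b} f"
proof -
  have *: "\<exists>d>0. \<forall>u v. a \<le> u \<and> u \<le> v \<and> v \<le> b \<and> v - u < d \<longrightarrow> norm (f v - f u) < e" if e: "e > 0" for e
  proof -
    obtain d where "d > 0" and D: "\<forall>D :: (real \<times> real) set. finite D \<and> (\<forall>(u, v)\<in>D. a \<le> u \<and> u \<le> v \<and> v \<le> b) \<and>
        pairwise (\<lambda>(u, v) (u', v'). {u<..<v} \<inter> {u'<..<v'} = {}) D \<and> (\<Sum>(u, v)\<in>D. v - u) < d
        \<longrightarrow> (\<Sum>(u, v)\<in>D. norm (f v - f u)) < e"
      using assms[unfolded abs_continuous_on_interval_def, rule_format, OF e] by blast
    then show ?thesis
      by (intro exI[of _ d] conjI allI impI) (auto dest!: spec[of _ "{(_, _)}"])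
  qed
  show ?thesis
    unfolding continuous_on_iff
  proof (intro ballI allI impI)
    fix x e assume x: "x \<in> {a..b}" and e: "(0::real) < e"
    obtain d where d: "d > 0" "\<And>u v. a \<le> u \<and> u \<le> v \<and> v \<le> b \<and> v - u < d \<Longrightarrow> norm (f v - f u) < e"
      using *[OF e] by blast
    show "\<exists>d>0. \<forall>x'\<in>{a..b}. dist x' x < d \<longrightarrow> dist (f x') (f x) < e"
    proof (intro exI[of _ d] conjI ballI impI d(1))
      fix y assume y: "y \<in> {a..b}" "dist y x < d"
      show "dist (f y) (f x) < e"
      proof (cases "x \<le> y")
        case True
        then show ?thesis using d(2)[of x y] x y by (auto simp: dist_norm)
      next
        case False
        then show ?thesis using d(2)[of y x] x y by (auto simp: dist_norm norm_minus_commute)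
      qed
    qed
  qed
qed

text \<open>Two majorants and a smaller interval are allowed at once, so that restriction, pairing
  and domination are all instances.\<close>

lemma ac_transfer:
  fixes f :: "real \<Rightarrow> 'a::real_normed_vector" and g :: "real \<Rightarrow> 'b::real_normed_vector"
    and h :: "real \<Rightarrow> 'c::real_normed_vector"
  assumes f: "abs_continuous_on_interval a b f" and g: "abs_continuous_on_interval a b g"
    and sub: "a \<le> c" "d \<le> b" and L: "L > 0"
    and dom: "\<And>u v. c \<le> u \<Longrightarrow> u \<le> v \<Longrightarrow> v \<le> d \<Longrightarrow> norm (h v - h u) \<le> L * (norm (f v - f u) + norm (g v - g u))"
  shows "abs_continuous_on_interval c d h"
  unfolding abs_continuous_on_interval_def
proof (intro allI impI)
  fix e :: real assume "e > 0"
  then have e: "e / (2 * L) > 0" using L by simp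
  let ?P = "\<lambda>a b r D. finite D \<and> (\<forall>(u, v)\<in>D. a \<le> u \<and> u \<le> v \<and> v \<le> b) \<and>
        pairwise (\<lambda>(u, v) (u', v'). {u<..<v} \<inter> {u'<..<v'} = {}) D \<and> (\<Sum>(u, v)\<in>D. v - u) < (r::real)"
  obtain r1 where r1: "r1 > 0" "\<forall>D. ?P a b r1 D \<longrightarrow> (\<Sum>(u, v)\<in>D. norm (f v - f u)) < e / (2 * L)"
    using f[unfolded abs_continuous_on_interval_def, rule_format, OF e] by auto
  obtain r2 where r2: "r2 > 0" "\<forall>D. ?P a b r2 D \<longrightarrow> (\<Sum>(u, v)\<in>D. norm (g v - g u)) < e / (2 * L)"
    using g[unfolded abs_continuous_on_interval_def, rule_format, OF e] by auto
  show "\<exists>r>0. \<forall>D. ?P c d r D \<longrightarrow> (\<Sum>(u, v)\<in>D. norm (h v - h u)) < e"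
  proof (intro exI[of _ "min r1 r2"] conjI allI impI)
    fix D assume D: "?P c d (min r1 r2) D"
    then have D': "?P a b r1 D" "?P a b r2 D" using sub by fastforce+
    have "(\<Sum>(u, v)\<in>D. norm (h v - h u)) \<le> (\<Sum>(u, v)\<in>D. L * (norm (f v - f u) + norm (g v - g u)))"
      by (rule sum_mono) (use D dom in fastforce)
    also have "\<dots> = L * ((\<Sum>(u, v)\<in>D. norm (f v - f u)) + (\<Sum>(u, v)\<in>D. norm (g v - g u)))"
      by (simp add: sum.distrib[symmetric] sum_distrib_left case_prod_beta)
    also have "\<dots> < L * (e / (2 * L) + e / (2 * L))"
      using r1(2) r2(2) D' L by (intro mult_strict_left_mono add_strict_mono) blast+
    also have "\<dots> = e" using L by simp
    finally show "(\<Sum>(u, v)\<in>D. norm (h v - h u)) < e" .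
  qed (use r1 r2 in auto)
qed

lemma ac_subinterval:
  "abs_continuous_on_interval a b f \<Longrightarrow> a \<le> c \<Longrightarrow> d \<le> b \<Longrightarrow> abs_continuous_on_interval c d f"
  by (rule ac_transfer[where L = 1]) auto

lemma ac_Pair:
  "abs_continuous_on_interval a b f \<Longrightarrow> abs_continuous_on_interval a b g
    \<Longrightarrow> abs_continuous_on_interval a b (\<lambda>t. (f t, g t))"
  by (rule ac_transfer[where L = 1 and f = f and g = g]) (auto simp: norm_Pair_le)

lemma ac_dominated:
  assumes "abs_continuous_on_interval a b f" "L \<ge> 0"
    and dom: "\<And>u v. a \<le> u \<Longrightarrow> u \<le> v \<Longrightarrow> v \<le> b \<Longrightarrow> norm (g v - g u) \<le> L * norm (f v - f u)"
  shows "abs_continuous_on_interval a b g"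
proof (rule ac_transfer[OF assms(1) assms(1) order_refl order_refl, of "L + 1"])
  fix u v assume "a \<le> u" "u \<le> v" "v \<le> b"
  from dom[OF this] have "norm (g v - g u) \<le> L * norm (f v - f u)" .
  also have "\<dots> \<le> (L + 1) * (norm (f v - f u) + norm (f v - f u))"
    using assms(2) by (intro mult_mono) auto
  finally show "norm (g v - g u) \<le> (L + 1) * (norm (f v - f u) + norm (f v - f u))" .
qed (use assms(2) in simp)

lemma ac_lipschitz:
  assumes L: "L-lipschitz_on {a..b} f"
  shows "abs_continuous_on_interval a b f"
proof (rule ac_dominated[where f = "\<lambda>t::real. t", OF _ lipschitz_on_nonneg[OF L]])
  have "(\<Sum>(u, v)\<in>D. norm (v - u)) = (\<Sum>(u, v)\<in>D. v - u)"
    if "\<forall>(u, v)\<in>D. a \<le> u \<and> u \<le> v \<and> v \<le> b" for D :: "(real \<times> real) set"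
    by (rule sum.cong) (use that in auto)
  then show "abs_continuous_on_interval a b (\<lambda>t::real. t)" 
    unfolding abs_continuous_on_interval_def by (intro allI impI, rule_tac x = \<epsilon> in exI) auto
qed (use lipschitz_on_normD[OF L] in \<open>auto simp: real_norm_def[symmetric] simp del: real_norm_def\<close>)

section \<open>Functions that are Lipschitz on bounded sets\<close>

definition lipschitz_on_bounded :: "('a::real_normed_vector \<Rightarrow> 'b::real_normed_vector) \<Rightarrow> bool" where
  "lipschitz_on_bounded f \<longleftrightarrow> (\<forall>R. \<exists>L. L-lipschitz_on (cball 0 R) f)"

named_theorems lob_intros

lemma lob_lipschitz:
  assumes "L-lipschitz_on UNIV f" shows "lipschitz_on_bounded f"
  using assms lipschitz_on_subset unfolding lipschitz_on_bounded_def by blast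

lemma lob_const [lob_intros]: "lipschitz_on_bounded (\<lambda>x. c)"
  using lipschitz_on_constant lob_lipschitz by blast

lemma lob_ident [lob_intros]: "lipschitz_on_bounded (\<lambda>x. x)"
  using lipschitz_on_id lob_lipschitz by blast

lemma lob_bounded_image:
  assumes "lipschitz_on_bounded f" shows "\<exists>B. \<forall>x\<in>cball 0 R. norm (f x) \<le> B"
proof -
  obtain L where L: "L-lipschitz_on (cball 0 R) f" using assms by (auto simp: lipschitz_on_bounded_def)
  have "norm (f x) \<le> norm (f 0) + L * R" if "x \<in> cball 0 R" for x
  proof -
    have "R \<ge> 0" using that by (smt (verit) mem_cball zero_le_dist)
    then have "norm (f x - f 0) \<le> L * norm (x - 0)"
      using lipschitz_on_normD[OF L, of x 0] that by simp
    also have "\<dots> \<le> L * R" using that lipschitz_on_nonneg[OF L] by (intro mult_left_mono) auto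
    finally show ?thesis using norm_triangle_ineq2[of "f x" "f 0"] by linarith
  qed
  then show ?thesis by blast
qed

lemma lob_compose:
  assumes "lipschitz_on_bounded f" "lipschitz_on_bounded g"
  shows "lipschitz_on_bounded (\<lambda>x. g (f x))"
  unfolding lipschitz_on_bounded_def
proof
  fix R
  obtain B where B: "\<forall>x\<in>cball 0 R. norm (f x) \<le> B" using lob_bounded_image[OF assms(1)] by blast
  obtain L where L: "L-lipschitz_on (cball 0 R) f" using assms by (auto simp: lipschitz_on_bounded_def)
  obtain M where M: "M-lipschitz_on (cball 0 B) g" using assms by (auto simp: lipschitz_on_bounded_def)
  have "f ` cball 0 R \<subseteq> cball 0 B" using B by auto
  then show "\<exists>L. L-lipschitz_on (cball 0 R) (\<lambda>x. g (f x))"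
    using lipschitz_on_compose2[OF L lipschitz_on_subset[OF M]] by blast
qed

lemma lob_linear:
  assumes "bounded_linear h" "lipschitz_on_bounded f"
  shows "lipschitz_on_bounded (\<lambda>x. h (f x))"
proof -
  interpret bounded_linear h by fact
  obtain B where "B-lipschitz_on UNIV h" using lipschitz_boundE by blast
  then show ?thesis using lob_compose[OF assms(2) lob_lipschitz] by blast
qed

lemma lob_Pair [lob_intros]:
  "lipschitz_on_bounded f \<Longrightarrow> lipschitz_on_bounded g \<Longrightarrow> lipschitz_on_bounded (\<lambda>x. (f x, g x))"
  unfolding lipschitz_on_bounded_def using lipschitz_on_Pair by blast

lemmas lob_fst [lob_intros] = lob_linear[OF bounded_linear_fst]
lemmas lob_snd [lob_intros] = lob_linear[OF bounded_linear_snd]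

lemma lob_add [lob_intros]:
  "lipschitz_on_bounded f \<Longrightarrow> lipschitz_on_bounded g \<Longrightarrow> lipschitz_on_bounded (\<lambda>x. f x + g x)"
  unfolding lipschitz_on_bounded_def using lipschitz_on_add by blast

lemma lob_diff [lob_intros]:
  "lipschitz_on_bounded f \<Longrightarrow> lipschitz_on_bounded g \<Longrightarrow> lipschitz_on_bounded (\<lambda>x. f x - g x)"
  unfolding lipschitz_on_bounded_def using lipschitz_on_diff by blast

lemma lob_minus [lob_intros]:
  "lipschitz_on_bounded f \<Longrightarrow> lipschitz_on_bounded (\<lambda>x. - f x)"
  unfolding lipschitz_on_bounded_def by simp

lemma lob_bilinear:
  fixes f :: "'d::real_normed_vector \<Rightarrow> 'a::real_normed_vector" and g :: "'d \<Rightarrow> 'b::real_normed_vector"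
    and p :: "'a \<Rightarrow> 'b \<Rightarrow> 'c::real_normed_vector"
  assumes "bounded_bilinear p" "lipschitz_on_bounded f" "lipschitz_on_bounded g"
  shows "lipschitz_on_bounded (\<lambda>x. p (f x) (g x))"
  unfolding lipschitz_on_bounded_def
proof
  fix R
  interpret bounded_bilinear p by fact
  obtain K where K: "K \<ge> 0" "\<And>a b. norm (p a b) \<le> norm a * norm b * K" using nonneg_bounded by blast
  obtain L where L: "L-lipschitz_on (cball 0 R) f" using assms by (auto simp: lipschitz_on_bounded_def)
  obtain M where M: "M-lipschitz_on (cball 0 R) g" using assms by (auto simp: lipschitz_on_bounded_def)
  obtain A where A: "\<forall>x\<in>cball 0 R. norm (f x) \<le> A" using lob_bounded_image[OF assms(2)] by blast
  obtain B where B: "\<forall>x\<in>cball 0 R. norm (g x) \<le> B" using lob_bounded_image[OF assms(3)] by blast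
  \<comment> \<open>For \<open>R < 0\<close> the ball is empty and the bounds may be negative; the
    maximum with 0 keeps the Lipschitz constant admissible.\<close>
  define A' B' where "A' = max A 0" and "B' = max B 0"
  have "(L * B' * K + A' * M * K)-lipschitz_on (cball 0 R) (\<lambda>x. p (f x) (g x))"
  proof (rule lipschitz_onI)
    fix x y :: 'd assume xy: "x \<in> cball 0 R" "y \<in> cball 0 R"
    have 1: "norm (f x - f y) \<le> L * norm (x - y)" "norm (g x - g y) \<le> M * norm (x - y)"
      using lipschitz_on_normD[OF L] lipschitz_on_normD[OF M] xy by auto
    have "dist (p (f x) (g x)) (p (f y) (g y)) = norm (p (f x - f y) (g x) + p (f y) (g x - g y))"
      by (simp add: dist_norm diff_left diff_right)
    also have "\<dots> \<le> norm (f x - f y) * norm (g x) * K + norm (f y) * norm (g x - g y) * K"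
      by (rule norm_triangle_le, rule add_mono) (rule K)+
    also have "\<dots> \<le> (L * norm (x - y)) * B' * K + A' * (M * norm (x - y)) * K"
    proof -
      have "norm (f y) \<le> A'" "norm (g x) \<le> B'" using A B xy by (fastforce simp: A'_def B'_def)+
      then have "norm (f x - f y) * norm (g x) \<le> (L * norm (x - y)) * B'"
        "norm (f y) * norm (g x - g y) \<le> A' * (M * norm (x - y))"
        using 1 by (intro mult_mono; smt (verit) norm_ge_zero)+
      then show ?thesis using K(1) by (intro add_mono mult_right_mono)
    qed
    finally show "dist (p (f x) (g x)) (p (f y) (g y)) \<le> (L * B' * K + A' * M * K) * dist x y"
      by (simp add: dist_norm algebra_simps)
  qed (use K(1) lipschitz_on_nonneg[OF L] lipschitz_on_nonneg[OF M] in \<open>auto simp: A'_def B'_def\<close>)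
  then show "\<exists>L. L-lipschitz_on (cball 0 R) (\<lambda>x. p (f x) (g x))" by blast
qed

lemmas lob_inner [lob_intros] = lob_bilinear[OF bounded_bilinear_inner]
lemmas lob_scaleR [lob_intros] = lob_bilinear[OF bounded_bilinear_scaleR]
lemmas lob_mult [lob_intros] = lob_bilinear[OF bounded_bilinear_mult]

lemma lob_sum [lob_intros]:
  "(\<And>i. i \<in> I \<Longrightarrow> lipschitz_on_bounded (f i)) \<Longrightarrow> lipschitz_on_bounded (\<lambda>x. \<Sum>i\<in>I. f i x)"
  by (induction I rule: infinite_finite_induct) (auto intro: lob_const lob_add)

lemma lob_vec [lob_intros]:
  fixes f :: "'i::finite \<Rightarrow> 'a::real_normed_vector \<Rightarrow> 'b::real_normed_vector"
  assumes "\<And>i. lipschitz_on_bounded (f i)"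
  shows "lipschitz_on_bounded (\<lambda>x. \<chi> i. f i x)"
  unfolding lipschitz_on_bounded_def
proof
  fix R
  obtain L where L: "\<And>i. (L i)-lipschitz_on (cball 0 R) (f i)"
    using assms choice[of "\<lambda>i L. L-lipschitz_on (cball 0 R) (f i)"] unfolding lipschitz_on_bounded_def by blast
  have "(\<Sum>i\<in>UNIV. L i)-lipschitz_on (cball 0 R) (\<lambda>x. \<chi> i. f i x)"
  proof (rule lipschitz_onI)
    fix x y :: 'a assume xy: "x \<in> cball 0 R" "y \<in> cball 0 R"
    have "dist (\<chi> i::'i. f i x) (\<chi> i. f i y) \<le> (\<Sum>i\<in>UNIV. dist (f i x) (f i y))"
      by (simp add: dist_vec_def L2_set_le_sum)
    also have "\<dots> \<le> (\<Sum>i\<in>UNIV. L i * dist x y)"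
      by (rule sum_mono) (use L xy lipschitz_onD in blast)
    finally show "dist (\<chi> i::'i. f i x) (\<chi> i. f i y) \<le> (\<Sum>i\<in>UNIV. L i) * dist x y"
      by (simp add: sum_distrib_right)
  qed (use L lipschitz_on_nonneg in \<open>auto intro!: sum_nonneg\<close>)
  then show "\<exists>L. L-lipschitz_on (cball 0 R) (\<lambda>x. \<chi> i. f i x)" by blast
qed

lemma lob_component [lob_intros]:
  fixes f :: "'a::real_normed_vector \<Rightarrow> ('b::real_normed_vector)^'i::finite"
  shows "lipschitz_on_bounded f \<Longrightarrow> lipschitz_on_bounded (\<lambda>x. f x $ i)"
  by (rule lob_linear[OF bounded_linear_vec_nth])

lemma lob_continuous:
  fixes f :: "'a::real_normed_vector \<Rightarrow> 'b::real_normed_vector"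
  assumes "lipschitz_on_bounded f" shows "continuous_on UNIV f"
  unfolding continuous_on_eq_continuous_at[OF open_UNIV]
proof
  fix x :: 'a
  obtain L where "L-lipschitz_on (cball 0 (norm x + 1)) f"
    using assms unfolding lipschitz_on_bounded_def by blast
  then have "continuous_on (ball 0 (norm x + 1)) f"
    using lipschitz_on_continuous_on continuous_on_subset ball_subset_cball by blast
  then show "isCont f x" by (auto simp: continuous_on_eq_continuous_at)
qed

text \<open>A continuous curve on \<open>{a..b}\<close> is bounded, so one Lipschitz constant serves
  all of it. This is the reason for working with \<open>lipschitz_on_bounded\<close>: the class
  contains projections and the extended pseudo-gradient, which need not be C1, and is closed under
  products.\<close>

lemma ac_compose:
  assumes ac: "abs_continuous_on_interval a b f" and lob: "lipschitz_on_bounded g"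
  shows "abs_continuous_on_interval a b (\<lambda>t. g (f t))"
proof -
  have "bounded (f ` {a..b})"
    using ac_continuous_on[OF ac] compact_continuous_image compact_imp_bounded by blast
  then obtain R where "\<forall>x\<in>f ` {a..b}. norm x \<le> R" unfolding bounded_iff by blast
  then have R: "\<And>t. t \<in> {a..b} \<Longrightarrow> f t \<in> cball 0 R" by auto
  obtain L where L: "L-lipschitz_on (cball 0 R) g" using lob by (auto simp: lipschitz_on_bounded_def)
  show ?thesis
    by (rule ac_dominated[OF ac lipschitz_on_nonneg[OF L]]) (use lipschitz_on_normD[OF L] R in auto)
qed

section \<open>Differential inequalities along absolutely continuous curves\<close>

lemma ac_rate:
  fixes s :: "real \<Rightarrow> 'a::real_normed_vector" and U :: "'a \<Rightarrow> real"
  assumes ac: "abs_continuous_on_interval a b s" and ab: "a \<le> b"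
    and der: "AE t in lborel. a < t \<and> t < b \<longrightarrow> (\<exists>d. (s has_vector_derivative d) (at t) \<and> P t d)"
    and lob: "lipschitz_on_bounded U" and dU: "\<And>x. (U has_derivative U' x) (at x)"
    and le: "\<And>t d. a < t \<Longrightarrow> t < b \<Longrightarrow> (s has_vector_derivative d) (at t) \<Longrightarrow> P t d \<Longrightarrow> U' (s t) d \<le> c"
  shows "U (s b) - U (s a) \<le> c * (b - a)"
proof -
  \<comment> \<open>Subtracting \<open>c * t\<close> turns the rate bound into monotonicity. The
    predicate \<open>P\<close> lets a pointwise fact about the velocity, such as tangency or a
    variational inequality, travel with the derivative.\<close>
  have "U (s b) - c * b \<le> U (s a) - c * a"
  proof (rule ac_nonincreasing[OF _ ab, of "\<lambda>t. U (s t) - c * t"])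
    have "abs_continuous_on_interval a b (\<lambda>t::real. t)" by (rule ac_lipschitz[OF lipschitz_on_id])
    from ac_compose[OF ac_Pair[OF ac_compose[OF ac lob] this]
        lob_diff[OF lob_fst[OF lob_ident] lob_mult[OF lob_const[of c] lob_snd[OF lob_ident]]]]
    show "abs_continuous_on_interval a b (\<lambda>t. U (s t) - c * t)" by simp
    show "AE t in lborel. a < t \<and> t < b \<longrightarrow> (\<exists>d\<le>0. ((\<lambda>t. U (s t) - c * t) has_real_derivative d) (at t))"
      using der
    proof eventually_elim
      case (elim t)
      show ?case
      proof
        assume t: "a < t \<and> t < b"
        with elim obtain d where d: "(s has_vector_derivative d) (at t)" "P t d" by blast
        have "((\<lambda>t. U (s t)) has_derivative (\<lambda>h. U' (s t) (h *\<^sub>R d))) (at t)"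
          by (rule has_derivative_compose[OF d(1)[unfolded has_vector_derivative_def] dU])
        moreover have "(\<lambda>h. U' (s t) (h *\<^sub>R d)) = (\<lambda>h. U' (s t) d * h)"
          using linear_scale[OF has_derivative_linear[OF dU]] by (simp add: fun_eq_iff)
        ultimately have "((\<lambda>t. U (s t)) has_real_derivative U' (s t) d) (at t)"
          by (simp add: has_field_derivative_def)
        then have "((\<lambda>t. U (s t) - c * t) has_real_derivative U' (s t) d - c) (at t)"
          by (auto intro!: derivative_eq_intros)
        moreover have "U' (s t) d - c \<le> 0" using le d t by simp
        ultimately show "\<exists>d\<le>0. ((\<lambda>t. U (s t) - c * t) has_real_derivative d) (at t)" by blast
      qed
    qed
  qed
  then show ?thesis by (simp add: algebra_simps)
qed

text \<open>Integrating factor: \<open>exp (- c * t) * f t\<close> is nonincreasing.\<close>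

lemma gronwall_zero:
  fixes f :: "real \<Rightarrow> real"
  assumes ac: "abs_continuous_on_interval a b f" and ab: "a \<le> b"
    and der: "AE t in lborel. a < t \<and> t < b \<longrightarrow> (\<exists>d\<le>c * f t. (f has_real_derivative d) (at t))"
    and a0: "f a \<le> 0"
  shows "f b \<le> 0"
proof -
  have "exp (- c * b) * f b \<le> exp (- c * a) * f a"
  proof (rule ac_nonincreasing[OF _ ab, of "\<lambda>t. exp (- c * t) * f t"])
    have "\<exists>L. L-lipschitz_on {a..b} (\<lambda>t. exp (- c * t))"
    proof -
      have "(\<bar>c\<bar> * exp (\<bar>c\<bar> * (\<bar>a\<bar> + \<bar>b\<bar>)))-lipschitz_on {a..b} (\<lambda>t. exp (- c * t))"
      proof (rule bounded_derivative_imp_lipschitz)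
        show "((\<lambda>t. exp (- c * t)) has_derivative (\<lambda>h. (exp (- c * x) * - c) * h)) (at x within {a..b})" for x
          by (auto intro!: derivative_eq_intros)
        fix x assume x: "x \<in> {a..b}"
        have "- c * x \<le> \<bar>c\<bar> * \<bar>x\<bar>" by (metis abs_ge_minus_self abs_mult minus_mult_left)
        also have "\<dots> \<le> \<bar>c\<bar> * (\<bar>a\<bar> + \<bar>b\<bar>)" using x by (intro mult_left_mono) auto
        finally have e: "exp (- c * x) \<le> exp (\<bar>c\<bar> * (\<bar>a\<bar> + \<bar>b\<bar>))" by simp
        show "onorm (\<lambda>h. (exp (- c * x) * - c) * h) \<le> \<bar>c\<bar> * exp (\<bar>c\<bar> * (\<bar>a\<bar> + \<bar>b\<bar>))"
          by (rule onorm_le) (use mult_mono[OF e order_refl, of "\<bar>c\<bar>"] in \<open>auto simp: abs_mult mult_ac intro!: mult_left_mono\<close>)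
      qed auto
      then show ?thesis by blast
    qed
    then have 1: "abs_continuous_on_interval a b (\<lambda>t. exp (- c * t))" using ac_lipschitz by blast
    show "abs_continuous_on_interval a b (\<lambda>t. exp (- c * t) * f t)"
      using ac_compose[OF ac_Pair[OF 1 ac] lob_mult[OF lob_fst[OF lob_ident] lob_snd[OF lob_ident]]]
      by simp
    show "AE t in lborel. a < t \<and> t < b \<longrightarrow> (\<exists>d\<le>0. ((\<lambda>t. exp (- c * t) * f t) has_real_derivative d) (at t))"
      using der
    proof eventually_elim
      case (elim t)
      show ?case
      proof
        assume "a < t \<and> t < b"
        with elim obtain d where d: "d \<le> c * f t" "(f has_real_derivative d) (at t)" by blast
        have "((\<lambda>t. exp (- c * t) * f t) has_real_derivative (exp (- c * t) * (d - c * f t))) (at t)"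
          using d(2) by (auto intro!: derivative_eq_intros simp: algebra_simps)
        moreover have "exp (- c * t) * (d - c * f t) \<le> 0" using d(1) by (simp add: mult_le_0_iff)
        ultimately show "\<exists>d\<le>0. ((\<lambda>t. exp (- c * t) * f t) has_real_derivative d) (at t)" by blast
      qed
    qed
  qed
  also have "\<dots> \<le> 0" using a0 by (simp add: mult_le_0_iff)
  finally show ?thesis by (simp add: mult_le_0_iff)
qed

section \<open>Almost everywhere differentiability of Lipschitz functions\<close>

text \<open>Continuity of \<open>g\<close> excludes atoms, so endpoints carry no Stieltjes
  mass.\<close>

lemma emeasure_interval_measure_continuous:
  fixes g :: "real \<Rightarrow> real"
  assumes mono: "\<And>x y. x \<le> y \<Longrightarrow> g x \<le> g y" and cont: "continuous_on UNIV g" and ab: "a \<le> b"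
  shows "emeasure (interval_measure g) {a..b} = ennreal (g b - g a)"
    and "emeasure (interval_measure g) {a<..<b} = ennreal (g b - g a)"
proof -
  have Icc: "emeasure (interval_measure g) {a..b} = ennreal (g b - g a)" if "a \<le> b" for a b
    by (rule emeasure_interval_measure_Icc[OF that mono cont])
  have null: "{x} \<in> null_sets (interval_measure g)" for x
    using Icc[of x x] by (simp add: null_sets_def)
  have "{a, b} \<in> null_sets (interval_measure g)"
    using null_sets.Un[OF null[of a] null[of b]] by (simp add: insert_commute)
  moreover have "{a<..<b} = {a..b} - {a, b}" using ab by auto
  ultimately show "emeasure (interval_measure g) {a<..<b} = ennreal (g b - g a)"
    using emeasure_Diff_null_set[of "{a, b}" "interval_measure g" "{a..b}"] Icc[OF ab] by simp
qed (rule emeasure_interval_measure_Icc[OF ab mono cont])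

text \<open>If \<open>g\<close> and \<open>t - g(t)\<close> are both nondecreasing, the Stieltjes measure of \<open>g\<close> is dominated by
  Lebesgue measure, so \<open>g\<close> is the integral of a Radon--Nikodym density and Lebesgue's
  differentiation theorem applies.\<close>

lemma ae_differentiable_aux:
  fixes g :: "real \<Rightarrow> real"
  assumes mono: "\<And>x y. x \<le> y \<Longrightarrow> g x \<le> g y" and mono': "\<And>x y. x \<le> y \<Longrightarrow> x - g x \<le> y - g y"
    and cont: "continuous_on UNIV g"
  shows "AE t in lborel. \<exists>d. (g has_real_derivative d) (at t)"
proof -
  define \<mu> where "\<mu> = interval_measure g"
  define \<nu> where "\<nu> = interval_measure (\<lambda>t. t - g t)"
  have contg: "isCont g t" for t using cont by (auto simp: continuous_on_eq_continuous_at)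
  have contr: "continuous (at_right t) g" for t by (rule continuous_at_imp_continuous_at_within[OF contg])
  have cont': "continuous_on UNIV (\<lambda>t. t - g t)" by (intro continuous_intros cont)
  have emc: "emeasure \<mu> {a..b} = ennreal (g b - g a)" if "a \<le> b" for a b
    unfolding \<mu>_def by (rule emeasure_interval_measure_continuous(1)[OF _ cont that]) (rule mono)
  have emo: "emeasure \<mu> {a<..<b} = ennreal (g b - g a)" if "a \<le> b" for a b
    unfolding \<mu>_def by (rule emeasure_interval_measure_continuous(2)[OF _ cont that]) (rule mono)
  have eno: "emeasure \<nu> {a<..<b} = ennreal ((b - g b) - (a - g a))" if "a \<le> b" for a b
    unfolding \<nu>_def by (rule emeasure_interval_measure_continuous(2)[OF _ cont' that]) (rule mono')
  have sets: "sets \<mu> = sets borel" "sets \<nu> = sets borel" by (auto simp: \<mu>_def \<nu>_def)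
  \<comment> \<open>The sum of the two Stieltjes measures gives every open interval its length and
    hence equals \<open>lborel\<close>; dropping \<open>\<nu>\<close> yields the domination of
    \<open>\<mu>\<close>.\<close>
  define M where "M = measure_of UNIV (sets borel) (\<lambda>A. emeasure \<mu> A + emeasure \<nu> A)"
  have M: "emeasure M A = emeasure \<mu> A + emeasure \<nu> A" if "A \<in> sets borel" for A
    unfolding M_def
  proof (rule emeasure_measure_of_sigma)
    show "sigma_algebra UNIV (sets (borel :: real measure))"
      by (metis sets.sigma_algebra_axioms space_borel)
    show "countably_additive (sets borel) (\<lambda>A. emeasure \<mu> A + emeasure \<nu> A)"
      unfolding countably_additive_def
    proof (intro allI impI)
      fix A :: "nat \<Rightarrow> real set"
      assume A: "range A \<subseteq> sets borel" "disjoint_family A" "\<Union> (range A) \<in> sets borel"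
      show "(\<Sum>i. emeasure \<mu> (A i) + emeasure \<nu> (A i)) = emeasure \<mu> (\<Union> (range A)) + emeasure \<nu> (\<Union> (range A))"
        using A sets by (subst suminf_add[symmetric]) (auto simp: suminf_emeasure)
    qed
  qed (use that in \<open>auto simp: positive_def\<close>)
  have "lborel = M"
  proof (rule lborel_eqI)
    fix l u :: real assume "\<And>b. b \<in> Basis \<Longrightarrow> l \<bullet> b \<le> u \<bullet> b"
    then have lu: "l \<le> u" by auto
    have "emeasure M {l<..<u} = ennreal (g u - g l) + ennreal ((u - g u) - (l - g l))"
      using M emo[OF lu] eno[OF lu] by simp
    also have "\<dots> = ennreal (u - l)"
      using mono[OF lu] mono'[OF lu] by (subst ennreal_plus[symmetric]) auto
    finally show "emeasure M (box l u) = ennreal (\<Prod>b\<in>Basis. (u - l) \<bullet> b)" by (simp add: box_real)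
  qed (simp add: M_def sets.sigma_sets_eq[of borel, simplified])
  then have le: "emeasure \<mu> A \<le> emeasure lborel A" if "A \<in> sets borel" for A
    using M[OF that] by simp
  have ac: "absolutely_continuous lborel \<mu>"
    unfolding absolutely_continuous_def
  proof
    fix A :: "real set" assume "A \<in> null_sets lborel"
    then show "A \<in> null_sets \<mu>" using le[of A] sets by (auto simp: null_sets_def)
  qed
  define h where "h = RN_deriv lborel \<mu>"
  have dens: "density lborel h = \<mu>"
    unfolding h_def by (rule sigma_finite_measure.density_RN_deriv[OF sigma_finite_lborel ac]) (use sets in auto)
  have hm[measurable]: "h \<in> borel_measurable borel" unfolding h_def using borel_measurable_RN_deriv[of lborel \<mu>] by simp
  have "AE x in lborel. h x \<noteq> \<infinity>"
    unfolding h_def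
  proof (rule sigma_finite_measure.RN_deriv_finite[OF sigma_finite_lborel _ ac])
    show "sigma_finite_measure \<mu>"
      unfolding \<mu>_def by (rule sigma_finite_interval_measure)
        (use mono contr in blast)+
  qed (use sets in auto)
  then have hr: "AE x in lborel. h x = ennreal (enn2real (h x))"
    by eventually_elim (simp add: less_top)
  define r where "r = (\<lambda>x. enn2real (h x))"
  have int: "(r has_integral (g b - g a)) {a..b}" if ab: "a \<le> b" for a b
  proof -
    have "((\<lambda>x. r x * indicator {a..b} x) has_integral (g b - g a)) UNIV"
    proof (rule nn_integral_has_integral)
      have "(\<integral>\<^sup>+x. ennreal (r x * indicator {a..b} x) \<partial>lborel) = (\<integral>\<^sup>+x. h x * indicator {a..b} x \<partial>lborel)"
        by (rule nn_integral_cong_AE, use hr in eventually_elim) (auto simp: r_def indicator_def)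
      also have "\<dots> = emeasure \<mu> {a..b}"
        unfolding dens[symmetric] by (subst emeasure_density) auto
      finally show "(\<integral>\<^sup>+x. ennreal (r x * indicator {a..b} x) \<partial>lborel) = ennreal (g b - g a)"
        using emc[OF ab] by simp
    qed (auto simp: r_def mono[OF ab])
    moreover have "(\<lambda>x. r x * indicator {a..b} x) = (\<lambda>x. if x \<in> {a..b} then r x else 0)"
      by (auto simp: indicator_def)
    ultimately show ?thesis using has_integral_restrict_UNIV[of "{a..b}" r "g b - g a"] by simp
  qed
  \<comment> \<open>The differentiation theorem used below averages over \<open>[x, x + h]\<close>
    only. Applied to the reflected density it supplies the left derivative.\<close>
  have int': "((\<lambda>x. r (- x)) has_integral (g (- a) - g (- b))) {a..b}" if "a \<le> b" for a b
    using int[of "- b" "- a"] that has_integral_reflect_real[of r "g (- a) - g (- b)" "- a" "- b"] by simp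
  obtain N1 where N1: "negligible N1"
    "\<And>x e. x \<notin> N1 \<Longrightarrow> 0 < e \<Longrightarrow> \<exists>d>0. \<forall>h. 0 < h \<and> h < d \<longrightarrow> norm (integral (cbox x (x + h *\<^sub>R One)) r /\<^sub>R h ^ DIM(real) - r x) < e"
  proof (rule integrable_ccontinuous_explicit[of r])
    show "r integrable_on cbox a b" for a b
      using int[of a b] by (cases "a \<le> b") auto
  qed blast
  obtain N2 where N2: "negligible N2"
    "\<And>x e. x \<notin> N2 \<Longrightarrow> 0 < e \<Longrightarrow> \<exists>d>0. \<forall>h. 0 < h \<and> h < d \<longrightarrow> norm (integral (cbox x (x + h *\<^sub>R One)) (\<lambda>x. r (- x)) /\<^sub>R h ^ DIM(real) - r (- x)) < e"
  proof (rule integrable_ccontinuous_explicit[of "\<lambda>x. r (- x)"])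
    show "(\<lambda>x. r (- x)) integrable_on cbox a b" for a b
      using int'[of a b] by (cases "a \<le> b") auto
  qed blast
  define N where "N = N1 \<union> uminus ` N2"
  have "negligible (uminus ` N2)"
    by (rule negligible_differentiable_image_negligible[OF order_refl N2(1)])
      (auto intro!: differentiable_on_minus)
  then have "negligible N" using N1(1) by (simp add: N_def)
  then have "AE x in lebesgue. x \<notin> N"
    by (simp add: negligible_iff_null_sets AE_not_in)
  then have "AE x in lborel. x \<notin> N" by (simp only: AE_completion_iff)
  then show ?thesis
  proof eventually_elim
    case (elim x)
    have "(g has_real_derivative r x) (at x)"
      unfolding has_field_derivative_def has_derivative_at_alt
    proof (intro conjI allI impI)
      fix e :: real assume e: "e > 0"
      obtain d1 where d1: "d1 > 0" "\<And>h. 0 < h \<Longrightarrow> h < d1 \<Longrightarrow> norm (integral (cbox x (x + h *\<^sub>R One)) r /\<^sub>R h ^ DIM(real) - r x) < e"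
        using N1(2)[of x e] elim e by (auto simp: N_def)
      have "- x \<notin> N2" using elim by (force simp: N_def)
      then obtain d2 where d2: "d2 > 0" "\<And>h. 0 < h \<Longrightarrow> h < d2 \<Longrightarrow> norm (integral (cbox (- x) (- x + h *\<^sub>R One)) (\<lambda>x. r (- x)) /\<^sub>R h ^ DIM(real) - r (- (- x))) < e"
        using N2(2)[of "- x" e] e by blast
      have 1: "\<bar>g (x + h) - g x - r x * h\<bar> \<le> e * h" if "0 < h" "h < d1" for h
      proof -
        have "\<bar>(g (x + h) - g x) / h - r x\<bar> < e"
          using d1(2)[OF that] integral_unique[OF int[of x "x + h"]] that by (simp add: divide_inverse mult.commute)
        then have "\<bar>(g (x + h) - g x) / h - r x\<bar> * h \<le> e * h" using that by (intro mult_right_mono) auto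
        moreover have "\<bar>(g (x + h) - g x) / h - r x\<bar> * h = \<bar>((g (x + h) - g x) / h - r x) * h\<bar>"
          using that by (simp add: abs_mult)
        moreover have "((g (x + h) - g x) / h - r x) * h = g (x + h) - g x - r x * h"
          using that by (simp add: field_simps)
        ultimately show ?thesis by simp
      qed
      have 2: "\<bar>g x - g (x - h) - r x * h\<bar> \<le> e * h" if "0 < h" "h < d2" for h
      proof -
        have "\<bar>(g x - g (x - h)) / h - r x\<bar> < e"
          using d2(2)[OF that] integral_unique[OF int'[of "- x" "- x + h"]] that by (simp add: divide_inverse mult.commute)
        then have "\<bar>(g x - g (x - h)) / h - r x\<bar> * h \<le> e * h" using that by (intro mult_right_mono) auto
        moreover have "\<bar>(g x - g (x - h)) / h - r x\<bar> * h = \<bar>((g x - g (x - h)) / h - r x) * h\<bar>"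
          using that by (simp add: abs_mult)
        moreover have "((g x - g (x - h)) / h - r x) * h = g x - g (x - h) - r x * h"
          using that by (simp add: field_simps)
        ultimately show ?thesis by simp
      qed
      show "\<exists>d>0. \<forall>y. norm (y - x) < d \<longrightarrow> norm (g y - g x - r x * (y - x)) \<le> e * norm (y - x)"
      proof (intro exI[of _ "min d1 d2"] conjI allI impI)
        fix y assume y: "norm (y - x) < min d1 d2"
        consider "y = x" | "y > x" | "y < x" by linarith
        then show "norm (g y - g x - r x * (y - x)) \<le> e * norm (y - x)"
        proof cases
          case 2
          then show ?thesis using 1[of "y - x"] y by simp
        next
          case 3
          then show ?thesis using 2[of "x - y"] y by (simp add: abs_minus_commute algebra_simps)
        qed simp
      qed (use d1 d2 in auto)
    qed (rule bounded_linear_mult_right)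
    then show ?case by blast
  qed
qed

lemma lipschitz_ae_differentiable_real:
  fixes f :: "real \<Rightarrow> real"
  assumes "L-lipschitz_on UNIV f"
  shows "AE t in lborel. \<exists>d. (f has_real_derivative d) (at t)"
proof -
  define C where "C = L + 1"
  have C: "C > 0" and lip: "\<bar>f x - f y\<bar> \<le> C * \<bar>x - y\<bar>" for x y
    using lipschitz_on_nonneg[OF assms] lipschitz_on_normD[OF assms, of x y]
    by (auto simp: C_def algebra_simps intro: order_trans)
  \<comment> \<open>The rescaling puts all difference quotients of \<open>g\<close> into
    \<open>[0, 1]\<close>, which makes both \<open>g\<close> and \<open>t - g t\<close>
    nondecreasing.\<close>
  define g where "g t = t / 2 + f t / (2 * C)" for t
  have "AE t in lborel. \<exists>d. (g has_real_derivative d) (at t)"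
  proof (rule ae_differentiable_aux)
    have *: "\<bar>f y - f x\<bar> / (2 * C) \<le> (y - x) / 2" if "x \<le> y" for x y
      using lip[of y x] C that by (simp add: field_simps)
    have **: "\<bar>f y / (2 * C) - f x / (2 * C)\<bar> \<le> (y - x) / 2" if "x \<le> y" for x y
      using *[OF that] C by (simp add: diff_divide_distrib[symmetric] abs_mult)
    have lo: "f y / (2 * C) - f x / (2 * C) \<le> (y - x) / 2" and hi: "f x / (2 * C) - f y / (2 * C) \<le> (y - x) / 2"
      if "x \<le> y" for x y
      using **[OF that] by linarith+
    show "g x \<le> g y" if "x \<le> y" for x y
      using hi[OF that] unfolding g_def by argo
    show "x - g x \<le> y - g y" if "x \<le> y" for x y
      using lo[OF that] unfolding g_def by argo
    show "continuous_on UNIV g"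
      unfolding g_def using lipschitz_on_continuous_on[OF assms] C by (intro continuous_intros) auto
  qed
  then show ?thesis
  proof eventually_elim
    case (elim t)
    then obtain d where d: "(g has_real_derivative d) (at t)" by blast
    have "((\<lambda>t. 2 * C * (g t - t / 2)) has_real_derivative (2 * C * (d - 1 / 2))) (at t)"
      using d by (auto intro!: derivative_eq_intros)
    moreover have "(\<lambda>t. 2 * C * (g t - t / 2)) = f" using C by (auto simp: g_def)
    ultimately show ?case by auto
  qed
qed

lemma lipschitz_ae_differentiable:
  fixes f :: "real \<Rightarrow> 'a::euclidean_space"
  assumes "L-lipschitz_on UNIV f"
  shows "AE t in lborel. \<exists>d. (f has_vector_derivative d) (at t)"
proof -
  have "AE t in lborel. \<forall>b\<in>Basis. \<exists>d. ((\<lambda>t. f t \<bullet> b) has_real_derivative d) (at t)"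
  proof (rule AE_finite_allI[OF finite_Basis], rule lipschitz_ae_differentiable_real)
    fix b :: 'a assume b: "b \<in> Basis"
    show "L-lipschitz_on UNIV (\<lambda>t. f t \<bullet> b)"
    proof (rule lipschitz_onI)
      fix x y
      have "\<bar>(f x - f y) \<bullet> b\<bar> \<le> norm (f x - f y)" using Basis_le_norm[OF b] .
      then show "dist (f x \<bullet> b) (f y \<bullet> b) \<le> L * dist x y"
        using lipschitz_onD[OF assms, of x y] by (simp add: dist_norm inner_diff_left)
    qed (rule lipschitz_on_nonneg[OF assms])
  qed
  then show ?thesis
  proof eventually_elim
    case (elim t)
    then obtain d where d: "\<And>b. b \<in> Basis \<Longrightarrow> ((\<lambda>t. f t \<bullet> b) has_real_derivative d b) (at t)" by metis
    have "((\<lambda>t. \<Sum>b\<in>Basis. (f t \<bullet> b) *\<^sub>R b) has_vector_derivative (\<Sum>b\<in>Basis. d b *\<^sub>R b)) (at t)"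
      using d by (auto intro!: derivative_eq_intros has_vector_derivative_sum
          simp: has_real_derivative_iff_has_vector_derivative)
    then show ?case by (auto simp: euclidean_representation)
  qed
qed

section \<open>Projected dynamics\<close>

lemma tangent_cone_memI:
  assumes "z \<in> S" "c > 0"
  shows "c *\<^sub>R (z - x) \<in> tangent_cone S x"
proof -
  have "c *\<^sub>R (z - x) \<in> (\<Union>\<delta>\<in>{0<..}. (\<lambda>z. (1 / \<delta>) *\<^sub>R (z - x)) ` S)"
  proof (rule UN_I)
    show "c *\<^sub>R (z - x) \<in> (\<lambda>z. (1 / (1 / c)) *\<^sub>R (z - x)) ` S"
      by (rule image_eqI[of _ _ z]) (use assms in simp_all)
  qed (use assms in simp)
  then show ?thesis unfolding tangent_cone_def by (rule subsetD[OF closure_subset])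
qed

lemma closed_tangent_cone: "closed (tangent_cone S x)"
  by (simp add: tangent_cone_def)

lemma tangent_cone_nonempty: "S \<noteq> {} \<Longrightarrow> tangent_cone S x \<noteq> {}"
  using tangent_cone_memI[of _ S 1] by (metis empty_iff equals0I zero_less_one)

lemma tangent_cone_inner_le:
  assumes "w \<in> tangent_cone S x" "\<And>z. z \<in> S \<Longrightarrow> n \<bullet> (z - x) \<le> 0"
  shows "n \<bullet> w \<le> 0"
proof -
  have "(\<Union>\<delta>\<in>{0<..}. (\<lambda>z. (1 / \<delta>) *\<^sub>R (z - x)) ` S) \<subseteq> {w. n \<bullet> w \<le> 0}"
    using assms(2) by (auto simp: mult_le_0_iff divide_le_0_iff)
  moreover have "closed {w. n \<bullet> w \<le> 0}" by (rule closed_halfspace_le)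
  ultimately have "tangent_cone S x \<subseteq> {w. n \<bullet> w \<le> 0}" unfolding tangent_cone_def by (rule closure_minimal)
  then show ?thesis using assms(1) by blast
qed

lemma convex_cone_tangent_cone:
  assumes S: "convex S" "x \<in> S"
  shows "convex (tangent_cone S x)" "cone (tangent_cone S x)"
proof -
  let ?C = "\<Union>\<delta>\<in>{0<..}. (\<lambda>z. (1 / \<delta>) *\<^sub>R (z - x)) ` S"
  have eq: "?C = {c *\<^sub>R (z - x) | c z. c > 0 \<and> z \<in> S}"
  proof (intro equalityI subsetI)
    fix w assume "w \<in> {c *\<^sub>R (z - x) | c z. c > 0 \<and> z \<in> S}"
    then obtain c z where w: "w = c *\<^sub>R (z - x)" "c > 0" "z \<in> S" by blast
    show "w \<in> ?C"
    proof (rule UN_I)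
      show "w \<in> (\<lambda>z. (1 / (1 / c)) *\<^sub>R (z - x)) ` S"
        by (rule image_eqI[of _ _ z]) (use w in auto)
    qed (use w in auto)
  next
    fix w assume "w \<in> ?C"
    then obtain c z where "c > 0" "w = (1 / c) *\<^sub>R (z - x)" "z \<in> S" by blast
    then show "w \<in> {c *\<^sub>R (z - x) | c z. c > 0 \<and> z \<in> S}"
      by (intro CollectI exI[of _ "1 / c"] exI[of _ z]) simp
  qed
  have "convex ?C"
    unfolding eq
  proof (rule convexI)
    fix a b :: 'a and u v :: real
    assume ab: "a \<in> {c *\<^sub>R (z - x) | c z. c > 0 \<and> z \<in> S}" "b \<in> {c *\<^sub>R (z - x) | c z. c > 0 \<and> z \<in> S}"
      and uv: "0 \<le> u" "0 \<le> v" "u + v = 1"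
    obtain c z c' z' where e: "a = c *\<^sub>R (z - x)" "c > 0" "z \<in> S" "b = c' *\<^sub>R (z' - x)" "c' > 0" "z' \<in> S"
      using ab by blast
    define s where "s = u * c + v * c'"
    have s: "s > 0" unfolding s_def using uv e
      by (cases "u = 0") (auto intro: add_pos_nonneg)
    have "u *\<^sub>R a + v *\<^sub>R b = s *\<^sub>R (((u * c / s) *\<^sub>R z + (v * c' / s) *\<^sub>R z') - x)"
    proof -
      have "s * (u * c / s) = u * c" "s * (v * c' / s) = v * c'" using s by simp_all
      then have "s *\<^sub>R (((u * c / s) *\<^sub>R z + (v * c' / s) *\<^sub>R z') - x) = (u * c) *\<^sub>R z + (v * c') *\<^sub>R z' - s *\<^sub>R x"
        by (simp only: scaleR_right_diff_distrib scaleR_right_distrib scaleR_scaleR)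
      then show ?thesis by (simp add: e s_def scaleR_right_diff_distrib scaleR_left_distrib)
    qed
    moreover have "(u * c / s) *\<^sub>R z + (v * c' / s) *\<^sub>R z' \<in> S"
      using S(1) e uv s by (intro convexD) (auto simp: add_divide_distrib[symmetric] s_def)
    ultimately show "u *\<^sub>R a + v *\<^sub>R b \<in> {c *\<^sub>R (z - x) | c z. c > 0 \<and> z \<in> S}" using s by blast
  qed
  then show "convex (tangent_cone S x)" by (simp add: tangent_cone_def convex_closure)
  have "cone ?C"
    unfolding cone_def eq
  proof (intro ballI allI impI)
    fix w and c :: real assume w: "w \<in> {c *\<^sub>R (z - x) | c z. c > 0 \<and> z \<in> S}" and c: "0 \<le> c"
    obtain d z where dz: "w = d *\<^sub>R (z - x)" "d > 0" "z \<in> S" using w by blast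
    show "c *\<^sub>R w \<in> {c *\<^sub>R (z - x) | c z. c > 0 \<and> z \<in> S}"
    proof (cases "c = 0")
      case True
      then show ?thesis using S(2) by (auto intro!: exI[of _ 1] exI[of _ x])
    next
      case False
      then show ?thesis using dz c by (auto intro!: exI[of _ "c * d"] exI[of _ z])
    qed
  qed
  then show "cone (tangent_cone S x)" by (simp add: tangent_cone_def cone_closure)
qed

lemma proj_dyn_in_tangent_cone: "S \<noteq> {} \<Longrightarrow> proj_dyn S x v \<in> tangent_cone S x"
  unfolding proj_dyn_def by (rule closest_point_in_set[OF closed_tangent_cone tangent_cone_nonempty])

text \<open>The tangent cone is convex, so it contains the sum of the projection and
  \<open>z - x\<close>. Testing the projection at this point leaves exactly the residual against
  \<open>z - x\<close>.\<close>

lemma proj_dyn_vi: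
  assumes S: "convex S" "x \<in> S" and z: "z \<in> S"
  shows "(v - proj_dyn S x v) \<bullet> (z - x) \<le> 0"
proof -
  let ?T = "tangent_cone S x" and ?p = "proj_dyn S x v"
  have p: "?p \<in> ?T" using S by (intro proj_dyn_in_tangent_cone) auto
  have w: "z - x \<in> ?T" using tangent_cone_memI[OF z, of 1] by simp
  have "(1/2) *\<^sub>R ?p + (1/2) *\<^sub>R (z - x) \<in> ?T"
    using convex_cone_tangent_cone(1)[OF S] p w by (intro convexD) auto
  then have "2 *\<^sub>R ((1/2) *\<^sub>R ?p + (1/2) *\<^sub>R (z - x)) \<in> ?T"
    using convex_cone_tangent_cone(2)[OF S] unfolding cone_def by (metis zero_le_numeral)
  then have "?p + (z - x) \<in> ?T" by (simp add: scaleR_right_distrib)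
  then have "(v - ?p) \<bullet> (?p + (z - x) - ?p) \<le> 0"
    unfolding proj_dyn_def by (intro closest_point_dot convex_cone_tangent_cone[OF S] closed_tangent_cone)
  then show ?thesis by simp
qed

text \<open>Moreau's decomposition: \<open>d\<close> is tangent, \<open>v - d\<close> is polar to
  the cone, and the two are orthogonal. Nonnegativity of the inner product is enough, as polarity
  gives the other sign.\<close>

lemma proj_dyn_eqI:
  assumes S: "convex S" "x \<in> S" and d: "d \<in> tangent_cone S x" and orth: "(v - d) \<bullet> d \<ge> 0"
    and vi: "\<And>z. z \<in> S \<Longrightarrow> (v - d) \<bullet> (z - x) \<le> 0"
  shows "proj_dyn S x v = d"
  unfolding proj_dyn_def
proof (rule closest_point_unique[symmetric])
  show "\<forall>u\<in>tangent_cone S x. dist v d \<le> dist v u"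
  proof
    fix u assume "u \<in> tangent_cone S x"
    then have "(v - d) \<bullet> u \<le> 0" using tangent_cone_inner_le vi by blast
    then have "(v - d) \<bullet> (d - u) \<ge> 0" using orth by (simp add: inner_diff_right)
    moreover have "(norm (v - u))\<^sup>2 = (norm (v - d))\<^sup>2 + 2 * ((v - d) \<bullet> (d - u)) + (norm (d - u))\<^sup>2"
      by (simp add: power2_norm_eq_inner inner_diff_left inner_diff_right inner_commute)
    ultimately have "(norm (v - d))\<^sup>2 \<le> (norm (v - u))\<^sup>2"
      by (metis (mono_tags, lifting) add_increasing2 add_nonneg_nonneg le_add_same_cancel1 mult_nonneg_nonneg zero_le_numeral zero_le_power2 group_cancel.add1)
    then show "dist v d \<le> dist v u" unfolding dist_norm by (rule power2_le_imp_le) simp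
  qed
qed (use convex_cone_tangent_cone[OF S] closed_tangent_cone d in auto)

lemma proj_dyn_zero:
  assumes "convex S" "x \<in> S" "\<And>z. z \<in> S \<Longrightarrow> v \<bullet> (z - x) \<le> 0"
  shows "proj_dyn S x v = 0"
  by (rule proj_dyn_eqI) (use assms tangent_cone_memI[OF assms(2), of 1 x] in auto)

text \<open>Forward and backward difference quotients are both positive multiples of differences
  with points of \<open>S\<close>, up to the sign of the latter. This reversibility later forces the
  residual to be orthogonal to the velocity.\<close>

lemma vector_derivative_tangent:
  fixes s :: "real \<Rightarrow> 'a::euclidean_space"
  assumes d: "(s has_vector_derivative d) (at t)" and t: "t > 0" and S: "\<And>u. u \<ge> 0 \<Longrightarrow> s u \<in> S"
  shows "d \<in> tangent_cone S (s t)" "- d \<in> tangent_cone S (s t)"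
proof -
  have lim: "((\<lambda>h. (s (t + h) - s t) /\<^sub>R h) \<longlongrightarrow> d) (at 0)"
  proof (rule LIM_zero_cancel, rule tendsto_norm_zero_cancel)
    have "(\<lambda>h. norm (s (t + h) - s t - h *\<^sub>R d) / norm h) \<midarrow>0\<rightarrow> 0"
      using d unfolding has_vector_derivative_def has_derivative_at by blast
    moreover have "norm (s (t + h) - s t - h *\<^sub>R d) / norm h = norm ((s (t + h) - s t) /\<^sub>R h - d)" if "h \<noteq> 0" for h
    proof -
      have "(s (t + h) - s t) /\<^sub>R h - d = (s (t + h) - s t - h *\<^sub>R d) /\<^sub>R h"
        using that by (simp add: scaleR_right_diff_distrib)
      then show ?thesis by (simp add: divide_inverse mult.commute)
    qed
    ultimately show "(\<lambda>h. norm ((s (t + h) - s t) /\<^sub>R h - d)) \<midarrow>0\<rightarrow> 0"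
      by (simp cong: LIM_cong)
  qed
  show "d \<in> tangent_cone S (s t)"
  proof (rule Lim_in_closed_set[OF closed_tangent_cone _ _ tendsto_within_subset[OF lim subset_UNIV]])
    show "\<forall>\<^sub>F h in at_right 0. (s (t + h) - s t) /\<^sub>R h \<in> tangent_cone S (s t)"
      unfolding eventually_at_right_field
      by (rule exI[of _ 1]) (use tangent_cone_memI[OF S] t in auto)
  qed simp
  have "((\<lambda>h. - ((s (t + h) - s t) /\<^sub>R h)) \<longlongrightarrow> - d) (at_left 0)"
    by (intro tendsto_minus tendsto_within_subset[OF lim subset_UNIV])
  then show "- d \<in> tangent_cone S (s t)"
  proof (rule Lim_in_closed_set[OF closed_tangent_cone, rotated -1])
    have "- ((s (t + h) - s t) /\<^sub>R h) \<in> tangent_cone S (s t)" if "- t < h" "h < 0" for h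
      using tangent_cone_memI[OF S, of "t + h" "- inverse h" "s t"] that by simp
    then show "\<forall>\<^sub>F h in at_left 0. - ((s (t + h) - s t) /\<^sub>R h) \<in> tangent_cone S (s t)"
      unfolding eventually_at_left_field
      by (intro exI[of _ "- t"]) (use t in auto)
  qed simp
qed

lemma vector_derivative_eq_proj_dyn:
  fixes s :: "real \<Rightarrow> 'a::euclidean_space"
  assumes conv: "convex S" and d: "(s has_vector_derivative d) (at t)" and t: "t > 0"
    and S: "\<And>u. u \<ge> 0 \<Longrightarrow> s u \<in> S"
    and vi: "\<And>z. z \<in> S \<Longrightarrow> (v - d) \<bullet> (z - s t) \<le> 0"
  shows "proj_dyn S (s t) v = d"
proof (rule proj_dyn_eqI[OF conv])
  show "0 \<le> (v - d) \<bullet> d"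
    using tangent_cone_inner_le[OF vector_derivative_tangent(2)[OF d t S], of "v - d"] vi by auto
qed (use S t vi vector_derivative_tangent(1)[OF d t S] in auto)

text \<open>The upper estimate keeps the projection of \<open>x\<close> fixed; the lower one
  exchanges \<open>x\<close> and \<open>y\<close>. The residual \<open>x - closest_point S x\<close>
  is 2-Lipschitz by the triangle inequality, so the exchange costs 4, and the square itself costs
  1.\<close>

lemma closest_point_norm_diff:
  fixes S :: "'a::euclidean_space set"
  assumes S: "convex S" "closed S" "S \<noteq> {}"
  shows "\<bar>(norm (y - closest_point S y))\<^sup>2 - (norm (x - closest_point S x))\<^sup>2
           - 2 * ((x - closest_point S x) \<bullet> (y - x))\<bar> \<le> 5 * (norm (y - x))\<^sup>2"
proof -
  let ?p = "closest_point S x" and ?q = "closest_point S y"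
  have up: "(norm (y - closest_point S y))\<^sup>2 \<le> (norm (x - closest_point S x))\<^sup>2
      + 2 * ((x - closest_point S x) \<bullet> (y - x)) + (norm (y - x))\<^sup>2" for x y
  proof -
    have "norm (y - closest_point S y) \<le> norm (y - closest_point S x)"
      using closest_point_le[OF S(2) closest_point_in_set[OF S(2,3)]] by (simp add: dist_norm)
    then have "(norm (y - closest_point S y))\<^sup>2 \<le> (norm (y - closest_point S x))\<^sup>2"
      by (rule power_mono) simp
    also have "\<dots> = (norm (x - closest_point S x))\<^sup>2 + 2 * ((x - closest_point S x) \<bullet> (y - x)) + (norm (y - x))\<^sup>2"
      by (simp add: power2_norm_eq_inner inner_diff_left inner_diff_right inner_commute)
    finally show ?thesis .
  qed
  have "norm ((y - ?q) - (x - ?p)) \<le> norm (y - x) + norm (?p - ?q)"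
    using norm_triangle_ineq[of "y - x" "?p - ?q"] by (simp add: algebra_simps)
  also have "\<dots> \<le> 2 * norm (y - x)"
    using closest_point_lipschitz[OF S, of x y] by (simp add: dist_norm norm_minus_commute)
  finally have "norm ((y - ?q) - (x - ?p)) * norm (y - x) \<le> (2 * norm (y - x)) * norm (y - x)"
    by (intro mult_right_mono) auto
  then have "\<bar>((y - ?q) - (x - ?p)) \<bullet> (y - x)\<bar> \<le> 2 * (norm (y - x))\<^sup>2"
    using Cauchy_Schwarz_ineq2[of "(y - ?q) - (x - ?p)" "y - x"] by (simp add: power2_eq_square)
  then have "(y - ?q) \<bullet> (y - x) \<ge> (x - ?p) \<bullet> (y - x) - 2 * (norm (y - x))\<^sup>2"
    by (simp add: inner_diff_left)
  moreover have "(y - ?q) \<bullet> (x - y) = - ((y - ?q) \<bullet> (y - x))" by (simp add: inner_diff_right)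
  ultimately show ?thesis using up[of y x] up[of x y] zero_le_power2[of "norm (y - x)"]
    by (simp add: norm_minus_commute abs_le_iff)
qed

lemma dist_sq_derivative:
  fixes S :: "'a::euclidean_space set"
  assumes S: "convex S" "closed S" "S \<noteq> {}"
  shows "((\<lambda>y. (norm (y - closest_point S y))\<^sup>2) has_derivative (\<lambda>h. 2 * ((x - closest_point S x) \<bullet> h))) (at x)"
  unfolding has_derivative_at_alt
proof (intro conjI allI impI)
  show "bounded_linear (\<lambda>h. 2 * ((x - closest_point S x) \<bullet> h))"
    by (intro bounded_linear_mult_right bounded_linear_compose[OF bounded_linear_mult_right] bounded_linear_inner_right)
  fix e :: real assume e: "e > 0"
  show "\<exists>d>0. \<forall>y. norm (y - x) < d \<longrightarrow> norm ((norm (y - closest_point S y))\<^sup>2 - (norm (x - closest_point S x))\<^sup>2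
           - 2 * ((x - closest_point S x) \<bullet> (y - x))) \<le> e * norm (y - x)"
  proof (intro exI[of _ "e / 5"] conjI allI impI)
    fix y assume "norm (y - x) < e / 5"
    then have "5 * norm (y - x) * norm (y - x) \<le> e * norm (y - x)" by (intro mult_right_mono) auto
    then show "norm ((norm (y - closest_point S y))\<^sup>2 - (norm (x - closest_point S x))\<^sup>2
           - 2 * ((x - closest_point S x) \<bullet> (y - x))) \<le> e * norm (y - x)"
      using closest_point_norm_diff[OF S, of y x] by (simp add: power2_eq_square)
  qed (use e in simp)
qed

text \<open>The tangent cone at a point \<open>x\<close> outside \<open>S\<close> lies in the half space pointing towards the
  projection of \<open>x\<close>; hence solutions cannot leave \<open>S\<close>.\<close>

lemma tangent_derivative_invariance:
  fixes s :: "real \<Rightarrow> 'a::euclidean_space"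
  assumes S: "convex S" "closed S" and ac: "abs_continuous_on_interval 0 T s" and T: "T \<ge> 0"
    and s0: "s 0 \<in> S"
    and der: "AE t in lborel. 0 < t \<and> t < T \<longrightarrow> (\<exists>d \<in> tangent_cone S (s t). (s has_vector_derivative d) (at t))"
  shows "s T \<in> S"
proof -
  have ne: "S \<noteq> {}" using s0 by auto
  let ?D = "\<lambda>y. (norm (y - closest_point S y))\<^sup>2"
  have "?D (s T) - ?D (s 0) \<le> 0 * (T - 0)"
  proof (rule ac_rate[OF ac T _ _ dist_sq_derivative[OF S ne], where P = "\<lambda>t d. d \<in> tangent_cone S (s t)"])
    have "1-lipschitz_on UNIV (closest_point S)"
      by (rule lipschitz_onI) (use closest_point_lipschitz[OF S ne] in auto)
    then show "lipschitz_on_bounded ?D"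
      unfolding power2_norm_eq_inner by (intro lob_intros lob_lipschitz)
    show "AE t in lborel. 0 < t \<and> t < T \<longrightarrow> (\<exists>d. (s has_vector_derivative d) (at t) \<and> d \<in> tangent_cone S (s t))"
      using der by eventually_elim blast
    fix t d assume d: "d \<in> tangent_cone S (s t)"
    let ?n = "s t - closest_point S (s t)"
    have "?n \<bullet> d \<le> 0"
    proof (rule tangent_cone_inner_le[OF d])
      fix z assume z: "z \<in> S"
      have "?n \<bullet> (z - closest_point S (s t)) \<le> 0" using closest_point_dot[OF S z] .
      moreover have "?n \<bullet> (z - s t) = ?n \<bullet> (z - closest_point S (s t)) - ?n \<bullet> ?n"
        by (simp add: inner_diff_right)
      ultimately show "?n \<bullet> (z - s t) \<le> 0" using inner_ge_zero[of ?n] by linarith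
    qed
    then show "2 * (?n \<bullet> d) \<le> 0" by simp
  qed
  then have "?D (s T) \<le> ?D (s 0)" by simp
  also have "?D (s 0) = 0" using closest_point_self[OF s0] by simp
  finally have "s T = closest_point S (s T)" by simp
  then show ?thesis using closest_point_in_set[OF S(2) ne] by metis
qed

text \<open>Tangency is required at every state, also where \<open>P x\<close> is outside
  \<open>C\<close>, because invariance must be proved before the solution is known to stay in
  \<open>C\<close>. The map \<open>P\<close> selects one constrained block.\<close>

lemma caratheodory_component_invariant:
  fixes P :: "'a::real_normed_vector \<Rightarrow> 'b::euclidean_space"
  assumes sol: "caratheodory_solution rhs s0 s" and P: "bounded_linear P"
    and C: "convex C" "closed C" and init: "P s0 \<in> C"
    and tan: "\<And>x. P (rhs x) \<in> tangent_cone C (P x)" and t: "t \<ge> 0"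
  shows "P (s t) \<in> C"
proof (rule tangent_derivative_invariance[where s = "\<lambda>t. P (s t)", OF C _ t])
  have "abs_continuous_on_interval 0 (t + 1) s" using sol t by (auto simp: caratheodory_solution_def)
  then show "abs_continuous_on_interval 0 t (\<lambda>t. P (s t))"
    by (intro ac_compose[OF ac_subinterval lob_linear[OF P lob_ident]]) auto
  show "P (s 0) \<in> C" using sol init by (simp add: caratheodory_solution_def)
  have "AE t in lborel. 0 \<le> t \<longrightarrow> (s has_vector_derivative rhs (s t)) (at t)"
    using sol unfolding caratheodory_solution_def by blast
  then show "AE u in lborel. 0 < u \<and> u < t \<longrightarrow>
        (\<exists>d\<in>tangent_cone C (P (s u)). ((\<lambda>t. P (s t)) has_vector_derivative d) (at u))"
  proof eventually_elim
    case (elim u)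
    then show ?case using bounded_linear.has_vector_derivative[OF P, of s "rhs (s u)" "at u"] tan by auto
  qed
qed

section \<open>Solutions of the differential variational inequality\<close>

abbreviation vi_velocity :: "'a::euclidean_space set \<Rightarrow> ('a \<Rightarrow> 'a) \<Rightarrow> 'a \<Rightarrow> 'a \<Rightarrow> bool" where
  "vi_velocity S f x d \<equiv> \<forall>z\<in>S. (f x - d) \<bullet> (z - x) \<le> 0"

text \<open>The horizon is finite so that a priori bounds can be applied before global existence is
  known.\<close>

definition vi_solution :: "'a::euclidean_space set \<Rightarrow> ('a \<Rightarrow> 'a) \<Rightarrow> real \<Rightarrow> (real \<Rightarrow> 'a) \<Rightarrow> bool" where
  "vi_solution S f T s \<longleftrightarrow> abs_continuous_on_interval 0 T s \<and> (\<forall>t\<in>{0..T}. s t \<in> S) \<and>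
     (AE t in lborel. 0 < t \<and> t < T \<longrightarrow>
        (\<exists>d. (s has_vector_derivative d) (at t) \<and> vi_velocity S f (s t) d))"

text \<open>Each inequality is tested at the other solution. On adding them the normal components
  have a favourable sign, and the squared distance grows at most at twice the Lipschitz rate of
  \<open>f\<close> on a ball containing both curves.\<close>

lemma vi_solution_unique:
  fixes S :: "'a::euclidean_space set"
  assumes f: "lipschitz_on_bounded f" and T: "T \<ge> 0"
    and s: "vi_solution S f T s" and r: "vi_solution S f T r" and eq: "s 0 = r 0"
  shows "s T = r T"
proof -
  have acs: "abs_continuous_on_interval 0 T s" and acr: "abs_continuous_on_interval 0 T r"
    using s r by (auto simp: vi_solution_def)
  have "bounded (s ` {0..T} \<union> r ` {0..T})"
    using ac_continuous_on[OF acs] ac_continuous_on[OF acr]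
    by (auto intro!: compact_imp_bounded compact_continuous_image)
  then obtain R where "\<forall>x\<in>s ` {0..T} \<union> r ` {0..T}. norm x \<le> R" unfolding bounded_iff by blast
  then have R: "s t \<in> cball 0 R" "r t \<in> cball 0 R" if "t \<in> {0..T}" for t using that by auto
  obtain L where L: "L-lipschitz_on (cball 0 R) f" using f by (auto simp: lipschitz_on_bounded_def)
  have "(s T - r T) \<bullet> (s T - r T) \<le> 0"
  proof (rule gronwall_zero[OF _ T, of "\<lambda>t. (s t - r t) \<bullet> (s t - r t)" "2 * L"])
    have "lipschitz_on_bounded (\<lambda>p::'a\<times>'a. (fst p - snd p) \<bullet> (fst p - snd p))" by (intro lob_intros)
    from ac_compose[OF ac_Pair[OF acs acr] this]
    show "abs_continuous_on_interval 0 T (\<lambda>t. (s t - r t) \<bullet> (s t - r t))" by simp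
    have "AE t in lborel. 0 < t \<and> t < T \<longrightarrow>
        (\<exists>d. (s has_vector_derivative d) (at t) \<and> vi_velocity S f (s t) d)"
      and "AE t in lborel. 0 < t \<and> t < T \<longrightarrow>
        (\<exists>d. (r has_vector_derivative d) (at t) \<and> vi_velocity S f (r t) d)"
      using s r unfolding vi_solution_def by blast+
    then show "AE t in lborel. 0 < t \<and> t < T \<longrightarrow>
        (\<exists>d\<le>2 * L * ((s t - r t) \<bullet> (s t - r t)). ((\<lambda>t. (s t - r t) \<bullet> (s t - r t)) has_real_derivative d) (at t))"
    proof eventually_elim
      case (elim t)
      show ?case
      proof
        assume t: "0 < t \<and> t < T"
        then obtain d e where d: "(s has_vector_derivative d) (at t)" "\<forall>z\<in>S. (f (s t) - d) \<bullet> (z - s t) \<le> 0"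
          and e: "(r has_vector_derivative e) (at t)" "\<forall>z\<in>S. (f (r t) - e) \<bullet> (z - r t) \<le> 0"
          using elim by blast
        let ?w = "s t - r t"
        have "((\<lambda>t. (s t - r t) \<bullet> (s t - r t)) has_vector_derivative (?w \<bullet> (d - e) + (d - e) \<bullet> ?w)) (at t)"
          by (intro bounded_bilinear.has_vector_derivative[OF bounded_bilinear_inner] has_vector_derivative_diff d e)
        moreover have "?w \<bullet> (d - e) + (d - e) \<bullet> ?w \<le> 2 * L * (?w \<bullet> ?w)"
        proof -
          have "(f (s t) - d) \<bullet> (r t - s t) \<le> 0" "(f (r t) - e) \<bullet> (s t - r t) \<le> 0"
            using d(2) e(2) s r t by (auto simp: vi_solution_def)
          then have "(d - e) \<bullet> ?w \<le> (f (s t) - f (r t)) \<bullet> ?w"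
            by (simp add: inner_diff_left inner_diff_right)
          also have "\<dots> \<le> norm (f (s t) - f (r t)) * norm ?w" by (rule norm_cauchy_schwarz)
          also have "\<dots> \<le> (L * norm ?w) * norm ?w"
            using lipschitz_on_normD[OF L] R t by (intro mult_right_mono) auto
          finally have "(d - e) \<bullet> ?w \<le> L * (?w \<bullet> ?w)" by (simp add: power2_norm_eq_inner[symmetric] power2_eq_square)
          then show ?thesis by (simp add: inner_commute)
        qed
        ultimately show "\<exists>d\<le>2 * L * ((s t - r t) \<bullet> (s t - r t)). ((\<lambda>t. (s t - r t) \<bullet> (s t - r t)) has_real_derivative d) (at t)"
          by (auto simp: has_real_derivative_iff_has_vector_derivative)
      qed
    qed
  qed (simp add: eq)
  then show ?thesis by (metis inner_gt_zero_iff linorder_not_le right_minus_eq)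
qed

section \<open>Existence by projected Euler steps\<close>

fun euler_step :: "'a::euclidean_space set \<Rightarrow> ('a \<Rightarrow> 'a) \<Rightarrow> 'a \<Rightarrow> real \<Rightarrow> nat \<Rightarrow> 'a" where
  "euler_step S f x0 h 0 = x0"
| "euler_step S f x0 h (Suc k) = closest_point S (euler_step S f x0 h k + h *\<^sub>R f (euler_step S f x0 h k))"

context
  fixes S :: "'a::euclidean_space set" and f :: "'a \<Rightarrow> 'a" and x0 :: 'a and M :: real
  assumes S: "convex S" "closed S" and x0: "x0 \<in> S"
    and M: "\<And>x. norm (f x) \<le> M"
begin

abbreviation euler :: "real \<Rightarrow> nat \<Rightarrow> 'a" where "euler \<equiv> euler_step S f x0"

lemma euler_in: "euler h k \<in> S"
proof (cases k)
  case (Suc j)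
  then show ?thesis using closest_point_in_set[OF S(2)] x0 by auto
qed (simp add: x0)

lemma M_nonneg: "M \<ge> 0"
  using M[of 0] norm_ge_zero order_trans by blast

lemma euler_Suc_dist:
  assumes "h > 0"
  shows "norm (euler h (Suc k) - euler h k) \<le> h * M"
proof -
  let ?x = "euler h k"
  have "dist (closest_point S (?x + h *\<^sub>R f ?x)) (closest_point S ?x) \<le> dist (?x + h *\<^sub>R f ?x) ?x"
    by (rule closest_point_lipschitz) (use S x0 in auto)
  also have "\<dots> \<le> h * M" using assms M by (simp add: dist_norm)
  finally show ?thesis by (simp add: closest_point_self[OF euler_in] dist_norm)
qed

lemma euler_dist:
  assumes "h > 0" "j \<le> k"
  shows "norm (euler h k - euler h j) \<le> (real k - real j) * h * M"
  using assms(2)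
proof (induction k rule: dec_induct)
  case (step k)
  have "norm (euler h (Suc k) - euler h j)
      \<le> norm (euler h (Suc k) - euler h k) + norm (euler h k - euler h j)"
    by (metis norm_triangle_sub diff_add_cancel norm_triangle_ineq add_diff_eq)
  then show ?case using step.IH euler_Suc_dist[OF assms(1), of k] by (simp add: algebra_simps)
qed simp

text \<open>Projection is nonexpansive and fixes \<open>z\<close>, so the distance to
  \<open>z\<close> is no larger than after an unprojected step. This is the discrete form of the
  variational inequality tested at \<open>z\<close>.\<close>

lemma euler_Suc_energy:
  assumes h: "h > 0" and z: "z \<in> S"
  shows "(norm (euler h (Suc k) - z))\<^sup>2 \<le> (norm (euler h k - z))\<^sup>2
     + 2 * h * (f (euler h k) \<bullet> (euler h k - z)) + h\<^sup>2 * M\<^sup>2"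
proof -
  let ?x = "euler h k"
  have "dist (closest_point S (?x + h *\<^sub>R f ?x)) (closest_point S z) \<le> dist (?x + h *\<^sub>R f ?x) z"
    by (rule closest_point_lipschitz) (use S x0 in auto)
  then have "norm (euler h (Suc k) - z) \<le> norm ((?x - z) + h *\<^sub>R f ?x)"
    by (simp add: closest_point_self[OF z] dist_norm algebra_simps)
  then have "(norm (euler h (Suc k) - z))\<^sup>2 \<le> (norm ((?x - z) + h *\<^sub>R f ?x))\<^sup>2"
    by (rule power_mono) simp
  also have "\<dots> = (norm (?x - z))\<^sup>2 + 2 * h * (f ?x \<bullet> (?x - z)) + h\<^sup>2 * (norm (f ?x))\<^sup>2"
    unfolding power2_norm_eq_inner by (simp add: inner_add_left inner_add_right inner_commute power2_eq_square algebra_simps)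
  also have "\<dots> \<le> (norm (?x - z))\<^sup>2 + 2 * h * (f ?x \<bullet> (?x - z)) + h\<^sup>2 * M\<^sup>2"
    using M[of ?x] by (intro add_left_mono mult_left_mono power_mono) auto
  finally show ?thesis .
qed

lemma euler_energy:
  assumes h: "h > 0" and z: "z \<in> S" and jk: "j \<le> k"
    and c: "\<And>i. j \<le> i \<Longrightarrow> i < k \<Longrightarrow> f (euler h i) \<bullet> (euler h i - z) \<le> c"
  shows "(norm (euler h k - z))\<^sup>2 \<le> (norm (euler h j - z))\<^sup>2
     + (real k - real j) * h * (2 * c + h * M\<^sup>2)"
  using jk c
proof (induction k rule: dec_induct)
  case (step k)
  let ?x = "euler h k"
  have "(norm (euler h (Suc k) - z))\<^sup>2 \<le> (norm (?x - z))\<^sup>2 + 2 * h * (f ?x \<bullet> (?x - z)) + h\<^sup>2 * M\<^sup>2"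
    by (rule euler_Suc_energy[OF h z])
  also have "2 * h * (f ?x \<bullet> (?x - z)) \<le> 2 * h * c"
    using step.prems[of k] step.hyps h by (intro mult_left_mono) auto
  finally have "(norm (euler h (Suc k) - z))\<^sup>2 \<le> (norm (?x - z))\<^sup>2 + h * (2 * c + h * M\<^sup>2)"
    by (simp add: algebra_simps power2_eq_square)
  moreover have "(norm (?x - z))\<^sup>2 \<le> (norm (euler h j - z))\<^sup>2 + (real k - real j) * h * (2 * c + h * M\<^sup>2)"
    by (rule step.IH) (use step.prems in auto)
  moreover have "(real (Suc k) - real j) * h * (2 * c + h * M\<^sup>2) = (real k - real j) * h * (2 * c + h * M\<^sup>2) + h * (2 * c + h * M\<^sup>2)"
    by (simp add: algebra_simps)
  ultimately show ?case by linarith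
qed simp

text \<open>A step function: its values are iterates, so they lie in \<open>S\<close> and obey
  \<open>euler_energy\<close>. The price is the jump term \<open>h\<close> in
  \<open>euler_fun_dist\<close>.\<close>

definition euler_fun :: "real \<Rightarrow> real \<Rightarrow> 'a" where
  "euler_fun h t = euler h (nat \<lfloor>t / h\<rfloor>)"

lemma floor_div:
  assumes "h > 0" "t \<ge> 0"
  shows "real (nat \<lfloor>t / h\<rfloor>) * h \<le> t" "t < real (nat \<lfloor>t / h\<rfloor>) * h + h"
proof -
  have r: "real (nat \<lfloor>t / h\<rfloor>) = of_int \<lfloor>t / h\<rfloor>" using assms by simp
  show "real (nat \<lfloor>t / h\<rfloor>) * h \<le> t"
    unfolding r using mult_right_mono[OF of_int_floor_le[of "t / h"], of h] assms by simp
  have "t / h < of_int \<lfloor>t / h\<rfloor> + 1" by linarith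
  then have "t < (of_int \<lfloor>t / h\<rfloor> + 1) * h" using mult_strict_right_mono[of "t / h" "of_int \<lfloor>t / h\<rfloor> + 1" h] assms by simp
  then show "t < real (nat \<lfloor>t / h\<rfloor>) * h + h" unfolding r by (simp add: algebra_simps)
qed

lemma euler_fun_dist:
  assumes h: "h > 0" and st: "0 \<le> s" "s \<le> t"
  shows "norm (euler_fun h t - euler_fun h s) \<le> (t - s + h) * M"
proof -
  have le: "nat \<lfloor>s / h\<rfloor> \<le> nat \<lfloor>t / h\<rfloor>"
    using st h by (intro nat_mono floor_mono divide_right_mono) auto
  have "(real (nat \<lfloor>t / h\<rfloor>) - real (nat \<lfloor>s / h\<rfloor>)) * h \<le> t - s + h"
    using floor_div[OF h, of t] floor_div[OF h, of s] st by (simp add: algebra_simps)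
  then have "(real (nat \<lfloor>t / h\<rfloor>) - real (nat \<lfloor>s / h\<rfloor>)) * h * M \<le> (t - s + h) * M"
    using M_nonneg by (rule mult_right_mono)
  then show ?thesis using euler_dist[OF h le] unfolding euler_fun_def by linarith
qed

lemma vi_existence:
  assumes f: "continuous_on UNIV f"
  shows "\<exists>s. s 0 = x0 \<and> M-lipschitz_on {0..} s \<and> (\<forall>t\<ge>0. s t \<in> S) \<and>
     (AE t in lborel. 0 < t \<longrightarrow>
        (\<exists>d. (s has_vector_derivative d) (at t) \<and> vi_velocity S f (s t) d))"
proof -
  define h where "h n = 1 / (real n + 1)" for n :: nat
  have h: "h n > 0" "h n \<le> 1" for n by (auto simp: h_def)
  have h0: "h \<longlonglongrightarrow> 0" unfolding h_def
    using LIMSEQ_inverse_real_of_nat by (simp add: inverse_eq_divide add.commute)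
  define Q where "Q = {q. q \<in> \<rat> \<and> q \<ge> (0::real)}"
  have "countable Q" unfolding Q_def by (rule countable_subset[OF _ countable_rat]) auto
  \<comment> \<open>The iterates may grow linearly in time; dividing by \<open>1 + q\<close> gives
    the single bound over all rational times that the diagonal subsequence asks for.\<close>
  moreover have "norm (euler_fun (h n) q /\<^sub>R (1 + q)) \<le> norm x0 + M" if "q \<in> Q" for n q
  proof -
    have q: "q \<ge> 0" using that by (simp add: Q_def)
    have "norm (euler_fun (h n) q) \<le> norm x0 + (q + h n) * M"
      using euler_fun_dist[OF h(1), of 0 q n] q norm_triangle_sub[of "euler_fun (h n) q" x0]
      by (simp add: euler_fun_def)
    also have "\<dots> \<le> norm x0 * (1 + q) + (1 + q) * M"
    proof (rule add_mono)
      show "(q + h n) * M \<le> (1 + q) * M" using h(2)[of n] M_nonneg by (intro mult_right_mono) auto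
      show "norm x0 \<le> norm x0 * (1 + q)" using q mult_left_mono[of 1 "1 + q" "norm x0"] by simp
    qed
    finally show ?thesis using q by (simp add: divide_simps algebra_simps)
  qed
  ultimately obtain k where k: "strict_mono (k::nat\<Rightarrow>nat)"
    "\<And>q. q \<in> Q \<Longrightarrow> \<exists>l. (\<lambda>n. euler_fun (h (k n)) q /\<^sub>R (1 + q)) \<longlonglongrightarrow> l"
    using function_convergent_subsequence[of Q "\<lambda>n q. euler_fun (h n) q /\<^sub>R (1 + q)" "norm x0 + M"] by blast
  define g where "g n = h (k n)" for n
  have g: "g n > 0" for n by (simp add: g_def h)
  have g0: "g \<longlonglongrightarrow> 0" unfolding g_def using LIMSEQ_subseq_LIMSEQ[OF h0 k(1)] by (simp add: o_def)
  define e where "e n = euler_fun (g n)" for n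
  have convQ: "Cauchy (\<lambda>n. e n q)" if q: "q \<in> Q" for q
  proof -
    obtain l where "(\<lambda>n. e n q /\<^sub>R (1 + q)) \<longlonglongrightarrow> l" using k(2)[OF q] unfolding e_def g_def by blast
    then have "(\<lambda>n. (1 + q) *\<^sub>R (e n q /\<^sub>R (1 + q))) \<longlonglongrightarrow> (1 + q) *\<^sub>R l" by (intro tendsto_intros)
    moreover have "1 + q \<noteq> 0" using q by (auto simp: Q_def)
    ultimately have "(\<lambda>n. e n q) \<longlonglongrightarrow> (1 + q) *\<^sub>R l" by simp
    then show ?thesis by (rule LIMSEQ_imp_Cauchy)
  qed
  have "\<exists>l. (\<lambda>n. e n t) \<longlonglongrightarrow> l" if t: "t \<ge> 0" for t
  proof -
    have "Cauchy (\<lambda>n. e n t)"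
    proof (rule metric_CauchyI)
      fix r :: real assume r: "r > 0"
      \<comment> \<open>With a rational time within \<open>\<delta>\<close> of \<open>t\<close> and
        steps below \<open>\<delta>\<close>, the change is at most \<open>2 * \<delta> * M\<close>,
        hence at most \<open>r / 3\<close>; \<open>M + 1\<close> avoids division by zero.\<close>
      define \<delta> where "\<delta> = r / (6 * (M + 1))"
      have \<delta>: "\<delta> > 0" "\<delta> * M \<le> r / 6" using r M_nonneg by (auto simp: \<delta>_def field_simps)
      obtain q where q: "q \<in> \<rat>" "t < q" "q < t + \<delta>" using Rats_dense_in_real[of t "t + \<delta>"] \<delta> by auto
      then have "q \<in> Q" using t by (auto simp: Q_def)
      then obtain N1 where N1: "\<And>m n. m \<ge> N1 \<Longrightarrow> n \<ge> N1 \<Longrightarrow> dist (e m q) (e n q) < r / 3"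
        using metric_CauchyD[OF convQ, of q "r / 3"] r by auto
      obtain N2 where N2: "\<And>n. n \<ge> N2 \<Longrightarrow> g n < \<delta>"
        using order_tendstoD(2)[OF g0 \<delta>(1)] by (auto simp: eventually_sequentially)
      have d: "dist (e n t) (e n q) \<le> r / 3" if "n \<ge> N2" for n
      proof -
        have "dist (e n t) (e n q) \<le> (q - t + g n) * M"
          using euler_fun_dist[OF g, of t q n] q t by (simp add: e_def dist_norm norm_minus_commute)
        also have "\<dots> \<le> (2 * \<delta>) * M" using q N2[OF that] M_nonneg by (intro mult_right_mono) auto
        finally show ?thesis using \<delta> by simp
      qed
      show "\<exists>N. \<forall>m\<ge>N. \<forall>n\<ge>N. dist (e m t) (e n t) < r"
      proof (intro exI[of _ "max N1 N2"] allI impI)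
        fix m n assume mn: "max N1 N2 \<le> m" "max N1 N2 \<le> n"
        have "dist (e m t) (e n t) \<le> dist (e m t) (e m q) + dist (e m q) (e n q) + dist (e n t) (e n q)"
          using dist_triangle[of "e m t" "e n t" "e m q"] dist_triangle2[of "e m q" "e n t" "e n q"] by linarith
        then show "dist (e m t) (e n t) < r"
          using d[of m] d[of n] N1[of m n] mn by auto
      qed
    qed
    then show ?thesis by (simp add: Cauchy_convergent_iff convergent_def)
  qed
  then obtain s where s: "\<And>t. t \<ge> 0 \<Longrightarrow> (\<lambda>n. e n t) \<longlonglongrightarrow> s t" by metis
  have sS: "s t \<in> S" if "t \<ge> 0" for t
    by (rule closed_sequentially[OF S(2) _ s[OF that]]) (simp add: e_def euler_fun_def euler_in)
  have s0: "s 0 = x0"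
    by (rule LIMSEQ_unique[OF s]) (auto simp: e_def euler_fun_def)
  have lip': "norm (s b - s a) \<le> (b - a) * M" if "0 \<le> a" "a \<le> b" for a b
  proof (rule LIMSEQ_le)
    show "(\<lambda>n. norm (e n b - e n a)) \<longlonglongrightarrow> norm (s b - s a)" using s that by (intro tendsto_intros) auto
    show "(\<lambda>n. (b - a + g n) * M) \<longlonglongrightarrow> (b - a) * M" by (rule tendsto_eq_intros g0 refl | simp)+
    show "\<exists>N. \<forall>n\<ge>N. norm (e n b - e n a) \<le> (b - a + g n) * M"
      using euler_fun_dist[OF g that] by (auto simp: e_def)
  qed
  have lip: "M-lipschitz_on {0..} s"
  proof (rule lipschitz_on_leI)
    show "dist (s x) (s y) \<le> M * dist x y" if "x \<in> {0..}" "y \<in> {0..}" "x \<le> y" for x y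
      using lip'[of x y] that by (simp add: dist_norm norm_minus_commute mult.commute)
  qed (rule M_nonneg)
  \<comment> \<open>Integrated inequality: on a short window all iterates stay in the ball where
    \<open>c\<close> bounds the field, and \<open>euler_energy\<close> passes to the limit.\<close>
  have energy: "(norm (s b - z))\<^sup>2 - (norm (s a - z))\<^sup>2 \<le> (b - a) * (2 * c)"
    if ab: "0 \<le> a" "a < b" and z: "z \<in> S" and r: "(b - a) * M < r"
      and c: "\<And>y. norm (y - s a) < r \<Longrightarrow> f y \<bullet> (y - z) \<le> c" for a b z c r
  proof -
    define j k where "j n = nat \<lfloor>a / g n\<rfloor>" and "k n = nat \<lfloor>b / g n\<rfloor>" for n
    have jk: "j n \<le> k n" for n
      unfolding j_def k_def using ab g[of n] by (intro nat_mono floor_mono divide_right_mono) auto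
    have fl: "b - a - g n < (real (k n) - real (j n)) * g n" "(real (k n) - real (j n)) * g n < b - a + g n" for n
      using floor_div[OF g, of a n] floor_div[OF g, of b n] ab by (simp_all add: j_def k_def left_diff_distrib)
    have lim: "(\<lambda>n. (real (k n) - real (j n)) * g n) \<longlonglongrightarrow> b - a"
    proof (rule tendsto_sandwich)
      show "\<forall>\<^sub>F n in sequentially. b - a - g n \<le> (real (k n) - real (j n)) * g n"
        using fl
        by (intro always_eventually allI) (simp add: algebra_simps less_imp_le)
      show "\<forall>\<^sub>F n in sequentially. (real (k n) - real (j n)) * g n \<le> b - a + g n"
        using fl by (intro always_eventually allI) (simp add: algebra_simps less_imp_le)
      show "(\<lambda>n. b - a - g n) \<longlonglongrightarrow> b - a" "(\<lambda>n. b - a + g n) \<longlonglongrightarrow> b - a"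
        by (rule tendsto_eq_intros g0 refl | simp)+
    qed
    have "(\<lambda>n. (b - a + g n) * M + norm (e n a - s a)) \<longlonglongrightarrow> (b - a) * M"
    proof -
      have "(\<lambda>n. norm (e n a - s a)) \<longlonglongrightarrow> 0"
        using tendsto_norm[OF LIM_zero[OF s[OF ab(1)]]] by simp
      then have "(\<lambda>n. (b - a + g n) * M + norm (e n a - s a)) \<longlonglongrightarrow> (b - a + 0) * M + 0"
        by (intro tendsto_intros g0)
      then show ?thesis by simp
    qed
    then have ev: "\<forall>\<^sub>F n in sequentially. (b - a + g n) * M + norm (e n a - s a) < r"
      using r by (rule order_tendstoD)
    have "(norm (s b - z))\<^sup>2 \<le> (norm (s a - z))\<^sup>2 + (b - a) * (2 * c + 0 * M\<^sup>2)"
    proof (rule tendsto_le[OF sequentially_bot])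
      show "(\<lambda>n. (norm (e n a - z))\<^sup>2 + (real (k n) - real (j n)) * g n * (2 * c + g n * M\<^sup>2))
         \<longlonglongrightarrow> (norm (s a - z))\<^sup>2 + (b - a) * (2 * c + 0 * M\<^sup>2)"
        using s ab by (intro tendsto_intros lim g0) auto
      show "(\<lambda>n. (norm (e n b - z))\<^sup>2) \<longlonglongrightarrow> (norm (s b - z))\<^sup>2"
        using s ab by (intro tendsto_intros) auto
      show "\<forall>\<^sub>F n in sequentially. (norm (e n b - z))\<^sup>2
          \<le> (norm (e n a - z))\<^sup>2 + (real (k n) - real (j n)) * g n * (2 * c + g n * M\<^sup>2)"
        using ev
      proof eventually_elim
        case (elim n)
        show ?case
          unfolding e_def euler_fun_def j_def[symmetric] k_def[symmetric]
        proof (rule euler_energy[OF g z jk])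
          fix i assume i: "j n \<le> i" "i < k n"
          let ?y = "euler (g n) i"
          show "f ?y \<bullet> (?y - z) \<le> c"
          proof (rule c)
            have "norm (?y - e n a) \<le> (real i - real (j n)) * g n * M"
              using euler_dist[OF g i(1), of n] by (simp add: e_def euler_fun_def j_def)
            also have "\<dots> \<le> (b - a + g n) * M"
            proof (rule mult_right_mono[OF _ M_nonneg])
              have "(real i - real (j n)) * g n \<le> (real (k n) - real (j n)) * g n"
                using i g[of n] by (intro mult_right_mono) auto
              also have "\<dots> \<le> b - a + g n"
                using floor_div[OF g, of a n] floor_div[OF g, of b n] ab by (simp add: j_def k_def algebra_simps)
              finally show "(real i - real (j n)) * g n \<le> b - a + g n" .
            qed
            finally show "norm (?y - s a) < r"
              using elim norm_triangle_ineq[of "?y - e n a" "e n a - s a"] by simp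
          qed
        qed
      qed
    qed
    then show ?thesis by simp
  qed
  have vi: "(f (s t) - d) \<bullet> (z - s t) \<le> 0"
    if t: "t > 0" and d: "(s has_vector_derivative d) (at t)" and z: "z \<in> S" for t d z
  proof (rule ccontr)
    assume "\<not> ?thesis"
    then have neg: "d \<bullet> (s t - z) > f (s t) \<bullet> (s t - z)" by (simp add: inner_diff_left inner_diff_right)
    \<comment> \<open>A value strictly between the two rates: the derivative at \<open>t\<close>
      makes the squared distance to \<open>z\<close> grow faster than \<open>2 * c\<close>, which
      \<open>energy\<close> forbids on short windows.\<close>
    define c where "c = (d \<bullet> (s t - z) + f (s t) \<bullet> (s t - z)) / 2"
    have c: "f (s t) \<bullet> (s t - z) < c" "c < d \<bullet> (s t - z)" using neg by (auto simp: c_def)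
    have "continuous_on UNIV (\<lambda>y. f y \<bullet> (y - z))" using f by (intro continuous_intros)
    then have "((\<lambda>y. f y \<bullet> (y - z)) \<longlongrightarrow> f (s t) \<bullet> (s t - z)) (nhds (s t))"
      by (simp add: continuous_on_eq_continuous_at isCont_def tendsto_nhds_iff)
    then have "\<forall>\<^sub>F y in nhds (s t). f y \<bullet> (y - z) < c" using c(1) by (rule order_tendstoD)
    then obtain r where r: "r > 0" "\<And>y. dist y (s t) < r \<Longrightarrow> f y \<bullet> (y - z) < c"
      by (auto simp: eventually_nhds_metric)
    have "((\<lambda>u. (s u - z) \<bullet> (s u - z)) has_vector_derivative ((s t - z) \<bullet> d + d \<bullet> (s t - z))) (at t)"
      using bounded_bilinear.has_vector_derivative[OF bounded_bilinear_inner, of "\<lambda>u. s u - z" d t UNIV "\<lambda>u. s u - z" d]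
        has_vector_derivative_diff[OF d has_vector_derivative_const[of z]] by simp
    then have "((\<lambda>u. (s u - z) \<bullet> (s u - z)) has_real_derivative 2 * (d \<bullet> (s t - z))) (at t)"
      by (simp add: has_real_derivative_iff_has_vector_derivative inner_commute)
    then have "((\<lambda>u. (s u - z) \<bullet> (s u - z) - 2 * c * u) has_real_derivative (2 * (d \<bullet> (s t - z)) - 2 * c)) (at t)"
      by (auto intro!: derivative_eq_intros)
    then obtain \<eta> where \<eta>: "\<eta> > 0" "\<And>u. u > 0 \<Longrightarrow> u < \<eta> \<Longrightarrow>
        (s t - z) \<bullet> (s t - z) - 2 * c * t < (s (t + u) - z) \<bullet> (s (t + u) - z) - 2 * c * (t + u)"
      using DERIV_pos_inc_right[of "\<lambda>u. (s u - z) \<bullet> (s u - z) - 2 * c * u" "2 * (d \<bullet> (s t - z)) - 2 * c" t] c(2)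
      by auto
    \<comment> \<open>Short enough for the derivative comparison and, through
      \<open>u * M < r\<close>, for the ball condition of \<open>energy\<close>.\<close>
    define u where "u = min (\<eta> / 2) (r / (2 * (M + 1)))"
    have "u \<le> r / (2 * (M + 1))" by (simp add: u_def)
    then have "u * (2 * (M + 1)) \<le> r" using M_nonneg by (simp add: pos_le_divide_eq)
    then have "u * M + u * M + 2 * u \<le> r" by (simp add: algebra_simps)
    moreover have u: "u > 0" "u < \<eta>" using \<eta> r M_nonneg by (auto simp: u_def)
    moreover have "u * M \<ge> 0" using u M_nonneg by simp
    ultimately have uM: "u * M < r" by linarith
    have "(norm (s (t + u) - z))\<^sup>2 - (norm (s t - z))\<^sup>2 \<le> ((t + u) - t) * (2 * c)"
    proof (rule energy[OF _ _ z])
      show "(t + u - t) * M < r" using uM by simp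
      show "f y \<bullet> (y - z) \<le> c" if "norm (y - s t) < r" for y using r(2)[of y] that by (simp add: dist_norm)
    qed (use t u in auto)
    then show False using \<eta>(2)[OF u] by (simp add: power2_norm_eq_inner algebra_simps)
  qed
  \<comment> \<open>Freezing the curve before time 0 makes it Lipschitz on the whole line, as the
    differentiability theorem requires.\<close>
  have "M-lipschitz_on UNIV (\<lambda>t. s (max 0 t))"
  proof (rule lipschitz_onI)
    fix x y :: real
    have "dist (s (max 0 x)) (s (max 0 y)) \<le> M * dist (max 0 x) (max 0 y)"
      by (rule lipschitz_onD[OF lip]) auto
    also have "\<dots> \<le> M * dist x y" using M_nonneg by (intro mult_left_mono) (auto simp: dist_real_def)
    finally show "dist (s (max 0 x)) (s (max 0 y)) \<le> M * dist x y" .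
  qed (rule M_nonneg)
  then have "AE t in lborel. \<exists>d. ((\<lambda>t. s (max 0 t)) has_vector_derivative d) (at t)"
    by (rule lipschitz_ae_differentiable)
  then have "AE t in lborel. 0 < t \<longrightarrow>
        (\<exists>d. (s has_vector_derivative d) (at t) \<and> vi_velocity S f (s t) d)"
  proof eventually_elim
    case (elim t)
    then obtain d where d: "((\<lambda>t. s (max 0 t)) has_vector_derivative d) (at t)" by blast
    show ?case
    proof
      assume t: "0 < t"
      have "(s has_vector_derivative d) (at t)"
        by (rule has_vector_derivative_transform_within_open[OF d, of "{0<..}"]) (use t in auto)
      then show "\<exists>d. (s has_vector_derivative d) (at t) \<and> vi_velocity S f (s t) d"
        using vi[OF t] by blast
    qed
  qed
  then show ?thesis using s0 lip sS by blast
qed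

end

text \<open>Composing the field with the projection onto the ball of radius \<open>R\<close> makes
  it bounded. Up to the first time the norm reaches \<open>R\<close> the truncation is invisible,
  and the strict a priori bound rules that time out.\<close>

lemma vi_global_existence:
  fixes S :: "'a::euclidean_space set"
  assumes S: "convex S" "closed S" and x0: "x0 \<in> S" and f: "continuous_on UNIV f"
    and apriori: "\<And>T s. T \<ge> 0 \<Longrightarrow> vi_solution S f T s \<Longrightarrow> s 0 = x0 \<Longrightarrow> norm (s T) < R"
  shows "\<exists>s. s 0 = x0 \<and> (\<forall>T\<ge>0. vi_solution S f T s \<and> norm (s T) < R)"
proof -
  \<comment> \<open>The a priori bound at horizon 0, applied to the constant curve, places the
    initial point inside the ball.\<close>
  have x0R: "norm x0 < R"
  proof -
    have "norm ((\<lambda>_. x0) (0::real)) < R"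
    proof (rule apriori)
      show "vi_solution S f 0 (\<lambda>_. x0)"
        unfolding vi_solution_def
        using ac_lipschitz[OF lipschitz_on_constant, of 0 0 x0] x0 by auto
    qed auto
    then show ?thesis by simp
  qed
  then have R: "R > 0" using norm_ge_zero[of x0] by linarith
  define P where "P = closest_point (cball (0::'a) R)"
  have B: "convex (cball (0::'a) R)" "closed (cball (0::'a) R)" "cball (0::'a) R \<noteq> {}" using R by auto
  define fR where "fR x = f (P x)" for x
  have cont: "continuous_on UNIV fR"
    unfolding fR_def P_def by (rule continuous_on_compose2[OF f continuous_on_closest_point[OF B]]) simp
  have "compact (f ` cball 0 R)" using f by (intro compact_continuous_image) (auto intro: continuous_on_subset)
  then obtain M where "\<forall>y\<in>f ` cball 0 R. norm y \<le> M" using compact_imp_bounded bounded_iff by metis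
  then have M: "norm (fR x) \<le> M" for x unfolding fR_def P_def using closest_point_in_set[OF B(2,3)] by blast
  obtain s where s0: "s 0 = x0" and lip: "M-lipschitz_on {0..} s" and sS: "\<And>t. t \<ge> 0 \<Longrightarrow> s t \<in> S"
    and der: "AE t in lborel. 0 < t \<longrightarrow>
        (\<exists>d. (s has_vector_derivative d) (at t) \<and> vi_velocity S fR (s t) d)"
    using vi_existence[OF S x0 M cont] by blast
  have contS: "continuous_on {0..} s" using lip by (rule lipschitz_on_continuous_on)
  have sol: "vi_solution S f T s" if T: "T \<ge> 0" and le: "\<And>t. 0 \<le> t \<Longrightarrow> t \<le> T \<Longrightarrow> norm (s t) \<le> R" for T
    unfolding vi_solution_def
  proof (intro conjI ballI)
    show "abs_continuous_on_interval 0 T s"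
      by (rule ac_lipschitz[OF lipschitz_on_subset[OF lip]]) auto
    show "AE t in lborel. 0 < t \<and> t < T \<longrightarrow>
        (\<exists>d. (s has_vector_derivative d) (at t) \<and> vi_velocity S f (s t) d)"
      using der
    proof eventually_elim
      case (elim t)
      have "fR (s t) = f (s t)" if "0 < t \<and> t < T"
        using le[of t] that closest_point_self[of "s t" "cball 0 R"] by (simp add: fR_def P_def)
      then show ?case using elim by (intro impI) (auto split: if_splits)
    qed
  qed (use sS in auto)
  have bound: "norm (s T) < R" if T: "T \<ge> 0" for T
  proof (rule ccontr)
    assume "\<not> norm (s T) < R"
    define A where "A = {0..T} \<inter> (\<lambda>t. norm (s t)) -` {R..}"
    have "closed A"
      unfolding A_def by (intro continuous_closed_preimage continuous_intros continuous_on_subset[OF contS]) auto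
    moreover have "T \<in> A" using T \<open>\<not> norm (s T) < R\<close> by (simp add: A_def)
    moreover have "bdd_below A" unfolding A_def by (rule bdd_below_mono[of "{0..T}"]) auto
    ultimately have inA: "Inf A \<in> A" using closed_contains_Inf by blast
    define t1 where "t1 = Inf A"
    have t1: "t1 \<ge> 0" "norm (s t1) \<ge> R" "t1 \<le> T" using inA by (auto simp: A_def t1_def)
    have lt: "norm (s t) < R" if "0 \<le> t" "t < t1" for t
    proof (rule ccontr)
      assume "\<not> norm (s t) < R"
      then have "t \<in> A" using that t1 by (auto simp: A_def)
      then have "t1 \<le> t" unfolding t1_def using \<open>bdd_below A\<close> by (rule cInf_lower)
      then show False using that by simp
    qed
    \<comment> \<open>Left continuity bounds the norm at the hitting time itself, so
      \<open>sol\<close> still covers the closed interval up to \<open>t1\<close>.\<close>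
    have "norm (s t1) \<le> R"
    proof (cases "t1 = 0")
      case True
      then show ?thesis using x0R s0 by simp
    next
      case False
      have "((\<lambda>t. norm (s t)) \<longlongrightarrow> norm (s t1)) (at_left t1)"
      proof (rule tendsto_norm)
        have "isCont s t1"
          using contS t1(1) False continuous_on_interior[of "{0..}" s t1] by (simp add: interior_real_atLeast)
        then show "(s \<longlongrightarrow> s t1) (at_left t1)" unfolding isCont_def by (rule tendsto_within_subset) simp
      qed
      moreover have "\<forall>\<^sub>F t in at_left t1. norm (s t) \<le> R"
        unfolding eventually_at_left_field
        by (intro exI[of _ 0]) (use False t1 lt less_imp_le in auto)
      ultimately show ?thesis by (rule tendsto_upperbound) simp
    qed
    then have "vi_solution S f t1 s" by (intro sol) (use t1 lt less_imp_le in \<open>force simp: order_le_less\<close>)+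
    then show False using apriori[of t1 s] t1 s0 by simp
  qed
  have "vi_solution S f T s" if "T \<ge> 0" for T
    by (rule sol[OF that]) (use bound less_imp_le in blast)
  then show ?thesis using s0 bound by blast
qed

section \<open>The graph Laplacian\<close>

lemma posdef_lower_bound:
  fixes M :: "'a::euclidean_space \<Rightarrow> 'a"
  assumes M: "linear M" and pos: "\<And>z. z \<noteq> 0 \<Longrightarrow> z \<bullet> M z > 0"
  obtains c where "c > 0" "\<And>z. z \<bullet> M z \<ge> c * (norm z)\<^sup>2"
proof -
  have cont: "continuous_on (sphere 0 1) (\<lambda>z. z \<bullet> M z)"
    by (intro continuous_intros linear_continuous_on linear_conv_bounded_linear[THEN iffD1] M)
  have "sphere (0::'a) 1 \<noteq> {}" by simp
  then obtain z0 where z0: "z0 \<in> sphere 0 1" "\<And>z. z \<in> sphere 0 1 \<Longrightarrow> z0 \<bullet> M z0 \<le> z \<bullet> M z"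
    using continuous_attains_inf[OF compact_sphere _ cont] by blast
  define c where "c = z0 \<bullet> M z0"
  have "c > 0" unfolding c_def by (rule pos) (use z0(1) in auto)
  moreover have "z \<bullet> M z \<ge> c * (norm z)\<^sup>2" for z
  proof (cases "z = 0")
    case False
    have "c \<le> (z /\<^sub>R norm z) \<bullet> M (z /\<^sub>R norm z)" unfolding c_def by (rule z0(2)) (use False in simp)
    also have "\<dots> = (z \<bullet> M z) / (norm z)\<^sup>2"
      by (simp add: linear_scale[OF M] divide_inverse power2_eq_square)
    finally show ?thesis using False by (simp add: pos_le_divide_eq)
  qed simp
  ultimately show thesis using that by blast
qed

lemma kron_id_component: "kron_id A y $ i = (\<Sum>j\<in>UNIV. A $ i $ j *\<^sub>R y $ j)"
  by (simp add: kron_id_def)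

lemma linear_kron_id: "linear (kron_id A)"
  by (rule linearI) (simp_all add: vec_eq_iff kron_id_component scaleR_right_distrib sum.distrib
      scaleR_sum_right mult.commute)

lemma lap_component:
  "lap E y $ i = (\<Sum>j\<in>UNIV. adjacency E $ i $ j *\<^sub>R (y $ i - y $ j))"
proof -
  have "lap E y $ i = (\<Sum>j\<in>UNIV. (if i = j then (\<Sum>l\<in>UNIV. adjacency E $ i $ l) *\<^sub>R y $ j else 0)
      - adjacency E $ i $ j *\<^sub>R y $ j)"
    unfolding kron_id_component laplacian_def
    by (rule sum.cong) (auto simp: scaleR_left_diff_distrib)
  also have "\<dots> = (\<Sum>l\<in>UNIV. adjacency E $ i $ l) *\<^sub>R y $ i - (\<Sum>j\<in>UNIV. adjacency E $ i $ j *\<^sub>R y $ j)"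
    by (simp add: sum_subtractf sum.delta)
  also have "\<dots> = (\<Sum>j\<in>UNIV. adjacency E $ i $ j *\<^sub>R (y $ i - y $ j))"
    by (simp add: scaleR_left.sum sum_subtractf scaleR_right_diff_distrib)
  finally show ?thesis .
qed

lemma adjacency_sym: "sym E \<Longrightarrow> adjacency E $ i $ j = adjacency E $ j $ i"
  by (auto simp: adjacency_def sym_def)

text \<open>The double sum is symmetrised by exchanging \<open>i\<close> and \<open>j\<close>. The
  result is the Dirichlet form of the graph, from which self-adjointness and nonnegativity are read
  off.\<close>

lemma lap_inner:
  fixes x y :: "real^'q^'i::finite"
  assumes "sym E"
  shows "x \<bullet> lap E y = (\<Sum>i\<in>UNIV. \<Sum>j\<in>UNIV. adjacency E $ i $ j * ((x $ i - x $ j) \<bullet> (y $ i - y $ j))) / 2"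
proof -
  let ?a = "\<lambda>i j. adjacency E $ i $ j"
  have 1: "x \<bullet> lap E y = (\<Sum>i\<in>UNIV. \<Sum>j\<in>UNIV. ?a i j * (x $ i \<bullet> (y $ i - y $ j)))"
    by (simp only: inner_vec_def[of x "lap E y"] lap_component inner_sum_right inner_scaleR_right)
  also have "\<dots> = (\<Sum>j\<in>UNIV. \<Sum>i\<in>UNIV. ?a i j * (x $ i \<bullet> (y $ i - y $ j)))" by (rule sum.swap)
  also have "\<dots> = (\<Sum>i\<in>UNIV. \<Sum>j\<in>UNIV. - ?a i j * (x $ j \<bullet> (y $ i - y $ j)))"
    using adjacency_sym[OF assms] by (intro sum.cong refl) (simp add: inner_diff_right algebra_simps)
  finally have 2: "x \<bullet> lap E y = (\<Sum>i\<in>UNIV. \<Sum>j\<in>UNIV. - ?a i j * (x $ j \<bullet> (y $ i - y $ j)))" .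
  have "2 * (x \<bullet> lap E y) = (\<Sum>i\<in>UNIV. \<Sum>j\<in>UNIV. ?a i j * (x $ i \<bullet> (y $ i - y $ j)) + - ?a i j * (x $ j \<bullet> (y $ i - y $ j)))"
    using 1 2 by (simp only: sum.distrib mult_2)
  also have "\<dots> = (\<Sum>i\<in>UNIV. \<Sum>j\<in>UNIV. ?a i j * ((x $ i - x $ j) \<bullet> (y $ i - y $ j)))"
    by (intro sum.cong refl) (simp add: inner_diff_left right_diff_distrib)
  finally show ?thesis by simp
qed

lemma lap_self_adjoint: "sym E \<Longrightarrow> x \<bullet> lap E y = lap E x \<bullet> y"
  using lap_inner[of E x y] lap_inner[of E y x] by (simp add: inner_commute)

lemma lap_nonneg: "sym E \<Longrightarrow> x \<bullet> lap E x \<ge> 0"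
  unfolding lap_inner by (auto intro!: sum_nonneg simp: adjacency_def)

lemma lap_replicated: "lap E (replicated v) = 0"
  by (simp add: vec_eq_iff lap_component replicated_def)

text \<open>The Dirichlet form is a sum of nonnegative edge terms, so all of them vanish, and
  equality propagates along a path from \<open>i\<close> to \<open>j\<close>.\<close>

lemma lap_quadratic_zero:
  fixes y :: "real^'q^'i::finite"
  assumes E: "undirected_connected E" and z: "y \<bullet> lap E y = 0"
  shows "y $ i = y $ j"
proof -
  have sym: "sym E" and conn: "(i, j) \<in> E\<^sup>*" using E by (auto simp: undirected_connected_def)
  let ?t = "\<lambda>i j. adjacency E $ i $ j * ((y $ i - y $ j) \<bullet> (y $ i - y $ j))"
  have nn: "?t i j \<ge> 0" for i j by (simp add: adjacency_def)
  have "(\<Sum>i\<in>UNIV. \<Sum>j\<in>UNIV. ?t i j) = 0" using z lap_inner[OF sym, of y y] by simp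
  then have t0: "?t i j = 0" for i j
    using nn by (simp add: sum_nonneg_eq_0_iff sum_nonneg)
  have step: "y $ a = y $ b" if "(a, b) \<in> E" for a b
    using t0[of a b] that by (simp add: adjacency_def)
  show ?thesis using conn by (induction rule: rtrancl_induct) (use step in auto)
qed

section \<open>Averages and a regularised inverse of the Laplacian\<close>

definition avg :: "real^'q^'i \<Rightarrow> real^'q" where
  "avg y = (1 / real CARD('i)) *\<^sub>R (\<Sum>i\<in>UNIV. y $ i)"

lemma avg_E_perp: "avg y = 0 \<longleftrightarrow> y \<in> E_perp"
  by (simp add: avg_def E_perp_def)

lemma linear_avg: "linear avg"
  by (rule linearI) (simp_all add: avg_def sum.distrib scaleR_right_distrib scaleR_sum_right mult.commute)

lemma avg_replicated [simp]: "avg (replicated v :: real^'q^'i::finite) = v"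
  by (simp add: avg_def replicated_def sum_constant_scaleR del: sum_constant)

lemma inner_replicated: "y \<bullet> (replicated v :: real^'q^'i::finite) = real CARD('i) * (avg y \<bullet> v)"
  by (simp add: avg_def replicated_def inner_vec_def[of y] inner_sum_left)

lemma linear_replicated: "linear replicated"
  by (rule linearI) (simp_all add: replicated_def vec_eq_iff)

text \<open>The Laplacian is self-adjoint and kills replicated vectors, so its range is orthogonal
  to them; that orthogonality is a zero average.\<close>

lemma lap_in_E_perp:
  assumes "sym E" shows "lap E y \<in> E_perp"
proof -
  have "replicated v \<bullet> lap E y = 0" for v using lap_self_adjoint[OF assms, of "replicated v" y] by (simp add: lap_replicated)
  then have "avg (lap E y) \<bullet> v = 0" for v
    using inner_replicated[of "lap E y" v] by (simp add: inner_commute)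
  then have "avg (lap E y) = 0" using inner_eq_zero_iff by blast
  then show ?thesis by (simp add: avg_E_perp)
qed

text \<open>Adding the averaging projection makes the Laplacian invertible without changing it on
  \<open>E_perp\<close>.\<close>

definition reg_lap :: "('i \<times> 'i) set \<Rightarrow> real^'q^'i::finite \<Rightarrow> real^'q^'i" where
  "reg_lap E y = lap E y + replicated (avg y)"

lemma linear_reg_lap: "linear (reg_lap E)"
  unfolding reg_lap_def
  by (intro linear_compose_add linear_kron_id linear_compose[OF linear_avg linear_replicated, unfolded o_def])

text \<open>The Dirichlet form vanishes only on replicated vectors, and on nonzero ones among these
  the averaging term is positive.\<close>

lemma reg_lap_pos:
  fixes y :: "real^'q^'i::finite"
  assumes E: "undirected_connected E" and y: "y \<noteq> 0"
  shows "y \<bullet> reg_lap E y > 0"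
proof -
  have sym: "sym E" using E by (simp add: undirected_connected_def)
  have eq: "y \<bullet> reg_lap E y = y \<bullet> lap E y + real CARD('i) * (avg y \<bullet> avg y)"
    by (simp add: reg_lap_def inner_add_right inner_replicated)
  have nn: "y \<bullet> lap E y \<ge> 0" "real CARD('i) * (avg y \<bullet> avg y) \<ge> 0" using lap_nonneg[OF sym] by auto
  moreover have "y \<bullet> reg_lap E y \<noteq> 0"
  proof
    assume "y \<bullet> reg_lap E y = 0"
    then have "y \<bullet> lap E y = 0" "real CARD('i) * (avg y \<bullet> avg y) = 0" using eq nn by linarith+
    then have z: "y \<bullet> lap E y = 0" "avg y = 0" by simp_all
    then have "y = replicated (y $ undefined)"
      using lap_quadratic_zero[OF E z(1)] by (simp add: vec_eq_iff replicated_def)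
    then show False using y z(2) avg_replicated[of "y $ undefined"] by (metis linear_0[OF linear_replicated])
  qed
  ultimately show ?thesis using eq by linarith
qed

lemma reg_lap_self_adjoint: "sym E \<Longrightarrow> x \<bullet> reg_lap E y = reg_lap E x \<bullet> y"
  using lap_self_adjoint[of E x y] inner_replicated[of x "avg y"] inner_replicated[of y "avg x"]
  by (simp add: reg_lap_def inner_add_right inner_add_left inner_commute)

text \<open>\<open>M\<close> inverts \<open>reg_lap\<close>, and \<open>reg_lap\<close> maps
  \<open>y - replicated (avg y)\<close> to \<open>lap E y\<close>. Hence \<open>M\<close> undoes the
  Laplacian up to the average and yet is positive definite on the whole space, which a
  pseudo-inverse would not be.\<close>

lemma reg_lap_inverse:
  fixes E :: "('i::finite \<times> 'i) set"
  assumes E: "undirected_connected E"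
  obtains M :: "real^'q^'i \<Rightarrow> real^'q^'i" and c where "linear M" "\<And>x y. x \<bullet> M y = M x \<bullet> y"
    "\<And>y. M (lap E y) = y - replicated (avg y)" "c > 0" "\<And>z. z \<bullet> M z \<ge> c * (norm z)\<^sup>2"
proof -
  have sym: "sym E" using E by (simp add: undirected_connected_def)
  let ?A = "reg_lap E :: real^'q^'i \<Rightarrow> real^'q^'i"
  have inj: "inj ?A"
    unfolding linear_injective_0[OF linear_reg_lap]
  proof (intro allI impI)
    fix y assume "?A y = 0"
    then show "y = 0" using reg_lap_pos[OF E, of y] by fastforce
  qed
  obtain M where M: "linear M" "M \<circ> ?A = id" using linear_injective_left_inverse[OF linear_reg_lap inj] by blast
  then have "?A \<circ> M = id" using linear_inverse_left[OF linear_reg_lap M(1)] by blast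
  then have MA: "M (?A y) = y" and AM: "?A (M y) = y" for y using M(2) by (metis o_apply id_apply)+
  have adj: "x \<bullet> M y = M x \<bullet> y" for x y
    using reg_lap_self_adjoint[OF sym, of "M x" "M y"] by (simp add: AM)
  have lapM: "M (lap E y) = y - replicated (avg y)" for y
  proof -
    have "?A (y - replicated (avg y)) = lap E y"
      by (simp add: reg_lap_def linear_diff[OF linear_kron_id] linear_diff[OF linear_avg] lap_replicated
          linear_0[OF linear_replicated])
    then show ?thesis by (metis MA)
  qed
  have pos: "z \<bullet> M z > 0" if "z \<noteq> 0" for z
  proof -
    have "M z \<noteq> 0" using AM[of z] that linear_0[OF linear_reg_lap] by metis
    then have "M z \<bullet> ?A (M z) > 0" by (rule reg_lap_pos[OF E])
    then show ?thesis by (simp add: AM inner_commute)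
  qed
  obtain c where "c > 0" "\<And>z. z \<bullet> M z \<ge> c * (norm z)\<^sup>2"
    using posdef_lower_bound[OF M(1) pos] by blast
  then show thesis using that M(1) adj lapM by blast
qed

text \<open>\<open>reg_lap\<close> and \<open>lap\<close> agree on \<open>E_perp\<close>, so
  injectivity of the former gives the bound; \<open>c\<close> stands in for the algebraic
  connectivity of the graph.\<close>

lemma lap_bounded_below:
  fixes E :: "('i::finite \<times> 'i) set"
  assumes E: "undirected_connected E"
  obtains c where "c > 0" "\<And>y :: real^'q^'i. y \<in> E_perp \<Longrightarrow> c * norm y \<le> norm (lap E y)"
proof -
  have "inj (reg_lap E :: real^'q^'i \<Rightarrow> real^'q^'i)"
    unfolding linear_injective_0[OF linear_reg_lap]
  proof (intro allI impI)
    fix y :: "real^'q^'i" assume "reg_lap E y = 0"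
    then show "y = 0" using reg_lap_pos[OF E, of y] by fastforce
  qed
  then obtain c where "c > 0" "\<And>y :: real^'q^'i. c * norm y \<le> norm (reg_lap E y)"
    using linear_inj_bounded_below_pos[OF linear_reg_lap] by blast
  moreover have "reg_lap E y = lap E y" if "y \<in> E_perp" for y :: "real^'q^'i"
    using that avg_E_perp[of y] linear_0[OF linear_replicated] by (simp add: reg_lap_def)
  ultimately show thesis using that by metis
qed

section \<open>Convexity, variational inequalities and multipliers\<close>

text \<open>\<open>gradient\<close> is a definite description, so the Riesz vector of the derivative
  must be shown to be unique before it can be named.\<close>

lemma GDERIV_gradient:
  fixes f :: "'a::euclidean_space \<Rightarrow> real"
  assumes "f differentiable (at x)"
  shows "(f has_derivative (\<lambda>h. gradient f x \<bullet> h)) (at x)"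
proof -
  obtain f' where f': "(f has_derivative f') (at x)" using assms by (auto simp: differentiable_def)
  have lin: "linear f'" using has_derivative_linear[OF f'] .
  define D where "D = (\<Sum>b\<in>Basis. f' b *\<^sub>R b)"
  have f'D: "f' h = h \<bullet> D" for h
  proof -
    have "f' h = f' (\<Sum>b\<in>Basis. (h \<bullet> b) *\<^sub>R b)" by (simp add: euclidean_representation)
    also have "\<dots> = (\<Sum>b\<in>Basis. (h \<bullet> b) * f' b)" by (simp add: linear_sum[OF lin] linear_scale[OF lin])
    finally show ?thesis by (simp add: D_def inner_sum_right mult.commute)
  qed
  have "GDERIV f x :> D" using f' by (simp add: gderiv_def f'D[abs_def])
  moreover have "D' = D" if "GDERIV f x :> D'" for D'
  proof -
    have "(\<lambda>h. h \<bullet> D') = f'" using that f' unfolding gderiv_def by (rule has_derivative_unique)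
    then have "h \<bullet> D' = h \<bullet> D" for h using f'D by metis
    then show ?thesis by (metis vector_eq_ldot)
  qed
  ultimately have "gradient f x = D" unfolding gradient_def by (rule the_equality)
  then show ?thesis using f' by (simp add: f'D[abs_def] inner_commute)
qed

lemma gradient_eqI:
  fixes f :: "'a::euclidean_space \<Rightarrow> real"
  assumes "(f has_derivative (\<lambda>h. D \<bullet> h)) (at x)"
  shows "gradient f x = D"
proof -
  have "(f has_derivative (\<lambda>h. gradient f x \<bullet> h)) (at x)"
    by (rule GDERIV_gradient) (use assms differentiableI in blast)
  then have "(\<lambda>h. gradient f x \<bullet> h) = (\<lambda>h. D \<bullet> h)" using assms by (rule has_derivative_unique)
  then show ?thesis by (metis vector_eq_ldot inner_commute)
qed

lemma directional_derivative:
  fixes f :: "'a::real_normed_vector \<Rightarrow> real"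
  assumes "(f has_derivative f') (at x)"
  shows "((\<lambda>t. f (x + t *\<^sub>R d)) has_real_derivative f' d) (at 0)"
proof -
  have "((\<lambda>t::real. x + t *\<^sub>R d) has_derivative (\<lambda>t. t *\<^sub>R d)) (at 0)"
    by (auto intro!: derivative_eq_intros)
  moreover have "(f has_derivative f') (at (x + 0 *\<^sub>R d))" using assms by simp
  ultimately have "((\<lambda>t. f (x + t *\<^sub>R d)) has_derivative (\<lambda>t. f' (t *\<^sub>R d))) (at 0)"
    by (rule has_derivative_compose)
  moreover have "f' (t *\<^sub>R d) = f' d * t" for t
    using linear_scale[OF has_derivative_linear[OF assms]] by simp
  ultimately show ?thesis by (simp add: has_field_derivative_def)
qed

lemma derivative_nonneg_of_min:
  fixes f :: "'a::real_normed_vector \<Rightarrow> real"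
  assumes f: "(f has_derivative f') (at x)"
    and min: "\<And>t. 0 < t \<Longrightarrow> t < 1 \<Longrightarrow> f x \<le> f (x + t *\<^sub>R d)"
  shows "f' d \<ge> 0"
proof (rule ccontr)
  assume "\<not> ?thesis"
  then obtain e where e: "e > 0" "\<And>h. h > 0 \<Longrightarrow> h < e \<Longrightarrow> f (x + h *\<^sub>R d) < f x"
    using DERIV_neg_dec_right[OF directional_derivative[OF f, of d]] by auto
  define h where "h = min (1/2) (e/2)"
  have h: "h > 0" "h < e" "h < 1" using e(1) by (auto simp: h_def)
  show False using min[OF h(1,3)] e(2)[OF h(1,2)] by simp
qed

lemma convex_on_gradient_ineq:
  fixes f :: "'a::real_normed_vector \<Rightarrow> real"
  assumes cv: "convex_on UNIV f" and f: "(f has_derivative f') (at x)"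
  shows "f x + f' (y - x) \<le> f y"
proof -
  \<comment> \<open>Chord minus function: if the claim failed, this would have a negative derivative
    at 0 and drop below its initial value, against convexity.\<close>
  have *: "((\<lambda>t. t * (f y - f x) - f (x + t *\<^sub>R (y - x))) has_real_derivative ((f y - f x) - f' (y - x))) (at 0)"
    using directional_derivative[OF f, of "y - x"] by (auto intro!: derivative_eq_intros)
  show ?thesis
  proof (rule ccontr)
    assume "\<not> ?thesis"
    then have "(f y - f x) - f' (y - x) < 0" by simp
    then obtain e where e: "e > 0"
      "\<And>h. h > 0 \<Longrightarrow> h < e \<Longrightarrow> h * (f y - f x) - f (x + h *\<^sub>R (y - x)) < - f x"
      using DERIV_neg_dec_right[OF *] by auto
    define h where "h = min (1/2) (e/2)"
    have h: "h > 0" "h < e" "h < 1" using e(1) by (auto simp: h_def)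
    have "f ((1 - h) *\<^sub>R x + h *\<^sub>R y) \<le> (1 - h) * f x + h * f y"
      using convex_onD[OF cv, of h x y] h by simp
    moreover have "(1 - h) *\<^sub>R x + h *\<^sub>R y = x + h *\<^sub>R (y - x)" by (simp add: algebra_simps)
    ultimately show False using e(2)[OF h(1,2)] by (simp add: algebra_simps)
  qed
qed

lemma C1_map_lipschitz_on_bounded:
  fixes f :: "'a::euclidean_space \<Rightarrow> 'b::real_normed_vector"
  assumes "C1_map f" shows "lipschitz_on_bounded f"
  unfolding lipschitz_on_bounded_def
proof
  fix R :: real
  obtain f' :: "'a \<Rightarrow> 'a \<Rightarrow>\<^sub>L 'b" where f': "\<And>x. (f has_derivative blinfun_apply (f' x)) (at x)" "continuous_on UNIV f'"
    using assms unfolding C1_map_def by blast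
  have "compact (f' ` cball 0 R)" using f'(2) by (intro compact_continuous_image) (auto intro: continuous_on_subset)
  then obtain B where B: "\<forall>y\<in>f' ` cball 0 R. norm y \<le> B" using compact_imp_bounded bounded_iff by metis
  have "(max B 0)-lipschitz_on (cball 0 R) f"
  proof (rule bounded_derivative_imp_lipschitz)
    show "(f has_derivative blinfun_apply (f' x)) (at x within cball 0 R)" for x
      using f'(1) by (rule has_derivative_at_withinI)
    show "onorm (blinfun_apply (f' x)) \<le> max B 0" if "x \<in> cball 0 R" for x
    proof -
      have "norm (f' x) \<le> B" using B that by blast
      then show ?thesis by (simp add: norm_blinfun.rep_eq)
    qed
  qed auto
  then show "\<exists>L. L-lipschitz_on (cball 0 R) f" by blast
qed

text \<open>The projected gradient step with step size \<open>\<mu>/L\<^sup>2\<close> is a contraction.\<close>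

lemma vi_point_exists:
  fixes F :: "'a::euclidean_space \<Rightarrow> 'a"
  assumes X: "convex X" "closed X" "X \<noteq> {}" and L: "L-lipschitz_on UNIV F" and mu: "\<mu> > 0"
    and mono: "\<And>x y. (F x - F y) \<bullet> (x - y) \<ge> \<mu> * (norm (x - y))\<^sup>2"
  shows "\<exists>x\<in>X. \<forall>y\<in>X. F x \<bullet> (y - x) \<ge> 0"
proof -
  \<comment> \<open>The maximum guarantees \<open>L' > 0\<close> and \<open>\<mu> \<le> L'\<close>,
    so that \<open>q\<close> lies in \<open>[0, 1)\<close>.\<close>
  define L' where "L' = max L \<mu>"
  have L': "L' > 0" "L' \<ge> \<mu>" using mu by (auto simp: L'_def)
  have lipF: "norm (F x - F y) \<le> L' * norm (x - y)" for x y
  proof -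
    have "norm (F x - F y) \<le> L * norm (x - y)" using lipschitz_on_normD[OF L] by simp
    also have "\<dots> \<le> L' * norm (x - y)" by (intro mult_right_mono) (auto simp: L'_def)
    finally show ?thesis .
  qed
  define a where "a = \<mu> / L'\<^sup>2"
  have a: "a > 0" using mu L' by (simp add: a_def)
  define T where "T x = closest_point X (x - a *\<^sub>R F x)" for x
  define q where "q = 1 - \<mu>\<^sup>2 / L'\<^sup>2"
  have q: "0 \<le> q" "q < 1" using mu L' by (auto simp: q_def power_mono)
  have sq: "(norm (u - a *\<^sub>R v))\<^sup>2 = (norm u)\<^sup>2 - 2 * a * (v \<bullet> u) + a\<^sup>2 * (norm v)\<^sup>2" for u v :: 'a
    unfolding power2_norm_eq_inner
    by (simp add: inner_diff_left inner_diff_right inner_commute power2_eq_square[of a] algebra_simps)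
  have contr: "dist (T x) (T y) \<le> sqrt q * dist x y" for x y
  proof -
    have "dist (T x) (T y) \<le> norm ((x - y) - a *\<^sub>R (F x - F y))"
      unfolding T_def using closest_point_lipschitz[OF X, of "x - a *\<^sub>R F x" "y - a *\<^sub>R F y"]
      by (simp add: dist_norm algebra_simps)
    then have "(dist (T x) (T y))\<^sup>2 \<le> (norm ((x - y) - a *\<^sub>R (F x - F y)))\<^sup>2" by (rule power_mono) simp
    also have "\<dots> = (norm (x - y))\<^sup>2 - 2 * a * ((F x - F y) \<bullet> (x - y)) + a\<^sup>2 * (norm (F x - F y))\<^sup>2"
      by (rule sq)
    also have "\<dots> \<le> (norm (x - y))\<^sup>2 - 2 * a * (\<mu> * (norm (x - y))\<^sup>2) + a\<^sup>2 * (L' * norm (x - y))\<^sup>2"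
      using mono[of x y] lipF[of x y] a
      by (intro add_mono diff_mono order_refl mult_left_mono power_mono) auto
    also have "\<dots> = (1 - 2 * a * \<mu> + a\<^sup>2 * L'\<^sup>2) * (norm (x - y))\<^sup>2"
      by (simp add: algebra_simps power_mult_distrib)
    also have "1 - 2 * a * \<mu> + a\<^sup>2 * L'\<^sup>2 = q"
      using L'(1) by (simp add: a_def q_def power2_eq_square field_simps)
    finally have "(dist (T x) (T y))\<^sup>2 \<le> (sqrt q * dist x y)\<^sup>2"
      using q by (simp add: power_mult_distrib dist_norm)
    then show ?thesis by (rule power2_le_imp_le) (use q in simp)
  qed
  have "\<exists>!x. T x = x"
    by (rule banach_fix_type[of "sqrt q" T]) (use q contr in auto)
  then obtain x where x: "T x = x" by blast
  have "x \<in> X" using closest_point_in_set[OF X(2,3)] x unfolding T_def by metis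
  moreover have "F x \<bullet> (y - x) \<ge> 0" if "y \<in> X" for y
  proof -
    have "(x - a *\<^sub>R F x - x) \<bullet> (y - x) \<le> 0"
      using closest_point_dot[OF X(1,2) that, of "x - a *\<^sub>R F x"] x unfolding T_def by simp
    then have "a * (F x \<bullet> (y - x)) \<ge> 0" by (simp add: inner_diff_left)
    then show ?thesis using a by (simp add: zero_le_mult_iff)
  qed
  ultimately show ?thesis by blast
qed

text \<open>A hyperplane separating the origin from the set of attainable pairs (objective, constraint)
  cannot be vertical by Slater's condition.\<close>

lemma lagrange_multiplier:
  fixes \<Omega> :: "'a::euclidean_space set" and g :: "'a \<Rightarrow> real^'m" and q :: 'a
  assumes cO: "convex \<Omega>" and cg: "\<And>j. convex_on UNIV (\<lambda>y. g y $ j)"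
    and sl: "xs \<in> \<Omega>" "\<And>j. g xs $ j < 0"
    and xb: "xb \<in> \<Omega>" "g xb \<le> 0"
    and opt: "\<And>y. y \<in> \<Omega> \<Longrightarrow> g y \<le> 0 \<Longrightarrow> q \<bullet> (y - xb) \<ge> 0"
  shows "\<exists>\<nu>\<ge>0. (\<forall>y\<in>\<Omega>. q \<bullet> (y - xb) + \<nu> \<bullet> g y \<ge> 0) \<and> \<nu> \<bullet> g xb = 0"
proof -
  \<comment> \<open>The objective is strict and the constraint is not, so optimality of
    \<open>xb\<close> says precisely that the origin is outside \<open>A\<close>.\<close>
  define A where "A = {(r::real, u). \<exists>y\<in>\<Omega>. q \<bullet> (y - xb) < r \<and> g y \<le> u}"
  have "convex A"
  proof (rule convexI)
    fix a b and s t :: real assume ab: "a \<in> A" "b \<in> A" and st: "0 \<le> s" "0 \<le> t" "s + t = 1"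
    obtain r u r' u' where e: "a = (r, u)" "b = (r', u')" by (cases a, cases b)
    obtain y y' where y: "y \<in> \<Omega>" "q \<bullet> (y - xb) < r" "g y \<le> u" and y': "y' \<in> \<Omega>" "q \<bullet> (y' - xb) < r'" "g y' \<le> u'"
      using ab e by (auto simp: A_def)
    let ?w = "s *\<^sub>R y + t *\<^sub>R y'"
    have "?w \<in> \<Omega>" using cO y y' st by (intro convexD) auto
    moreover have "q \<bullet> (?w - xb) < s * r + t * r'"
    proof -
      have "?w - xb = s *\<^sub>R (y - xb) + t *\<^sub>R (y' - xb)"
      proof -
        have "xb = s *\<^sub>R xb + t *\<^sub>R xb" using st(3) by (metis scaleR_left_distrib scaleR_one)
        then show ?thesis unfolding scaleR_right_diff_distrib by (metis add_diff_add)
      qed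
      then have "q \<bullet> (?w - xb) = s * (q \<bullet> (y - xb)) + t * (q \<bullet> (y' - xb))" by (simp add: inner_add_right)
      moreover have "s * (q \<bullet> (y - xb)) \<le> s * r" "t * (q \<bullet> (y' - xb)) \<le> t * r'"
        using y y' st by (auto intro!: mult_left_mono)
      moreover have "s * (q \<bullet> (y - xb)) < s * r \<or> t * (q \<bullet> (y' - xb)) < t * r'"
        using y y' st by (cases "s = 0") auto
      ultimately show ?thesis by linarith
    qed
    moreover have "g ?w \<le> s *\<^sub>R u + t *\<^sub>R u'"
      unfolding less_eq_vec_def
    proof
      fix j
      have "g ?w $ j \<le> s * g y $ j + t * g y' $ j"
        using cg[of j] st unfolding convex_on_def by blast
      also have "\<dots> \<le> s * u $ j + t * u' $ j"
        using y(3) y'(3) st by (intro add_mono mult_left_mono) (auto simp: less_eq_vec_def)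
      finally show "g ?w $ j \<le> (s *\<^sub>R u + t *\<^sub>R u') $ j" by simp
    qed
    ultimately show "s *\<^sub>R a + t *\<^sub>R b \<in> A" unfolding A_def e by auto
  qed
  moreover have "0 \<notin> A" using opt by (force simp: A_def zero_prod_def)
  ultimately have "\<exists>n. n \<noteq> 0 \<and> (\<forall>x\<in>A. 0 \<le> n \<bullet> x)" by (rule separating_hyperplane_set_0)
  then obtain n where n: "n \<noteq> 0" "\<forall>x\<in>A. 0 \<le> n \<bullet> x" by (elim exE conjE)
  obtain a l where al: "n = (a, l)" by (cases n)
  have sep: "0 \<le> a * r + l \<bullet> u" if "y \<in> \<Omega>" "q \<bullet> (y - xb) < r" "g y \<le> u" for r u y
  proof -
    have "(r, u) \<in> A" using that by (auto simp: A_def)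
    then show ?thesis using bspec[OF n(2)] al by fastforce
  qed
  \<comment> \<open>\<open>A\<close> is closed upwards, and the separating functional is bounded
    below on upward rays; \<open>unb\<close> turns this into sign conditions on \<open>a\<close> and
    \<open>l\<close>.\<close>
  have base: "0 \<le> a * (1 + r) + l \<bullet> (g xb + u)" if "r \<ge> 0" "u \<ge> 0" for r u
    by (rule sep[OF xb(1)]) (use that in \<open>auto simp: less_eq_vec_def\<close>)
  have unb: "c \<ge> 0" if "\<And>t. t \<ge> 0 \<Longrightarrow> 0 \<le> b + t * c" for b c :: real
  proof (rule ccontr)
    assume "\<not> c \<ge> 0"
    then have "0 \<le> (\<bar>b\<bar> + 1) / - c" by (intro divide_nonneg_pos) auto
    from that[OF this] have "0 \<le> b + (\<bar>b\<bar> + 1) / - c * c" .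
    moreover have "(\<bar>b\<bar> + 1) / - c * c = - (\<bar>b\<bar> + 1)" using \<open>\<not> c \<ge> 0\<close> by simp
    ultimately show False by linarith
  qed
  have a0: "a \<ge> 0"
    by (rule unb[of "a + l \<bullet> g xb"]) (use base[of _ 0] in \<open>auto simp: algebra_simps\<close>)
  have l0: "l $ j \<ge> 0" for j
  proof (rule unb[of "a + l \<bullet> g xb"])
    fix t :: real assume t: "t \<ge> 0"
    have "(0 :: real^'m) \<le> t *\<^sub>R axis j 1" using t by (auto simp: less_eq_vec_def axis_def)
    then show "0 \<le> a + l \<bullet> g xb + t * l $ j"
      using base[of 0 "t *\<^sub>R axis j 1"] by (simp add: inner_add_right inner_axis)
  qed
  \<comment> \<open>Otherwise \<open>l\<close> alone separates. At the Slater point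
    \<open>l \<bullet> g xs\<close> is a sum of nonpositive terms and yet nonnegative, which forces
    \<open>l = 0\<close> and contradicts \<open>n \<noteq> 0\<close>.\<close>
  have "a \<noteq> 0"
  proof
    assume a: "a = 0"
    have "0 \<le> l \<bullet> g xs" using sep[OF sl(1), of "q \<bullet> (xs - xb) + 1" "g xs"] a by simp
    moreover have "l $ j * g xs $ j \<le> 0" for j using l0 sl(2)[of j] by (simp add: mult_nonneg_nonpos)
    ultimately have "(\<Sum>j\<in>UNIV. - (l $ j * g xs $ j)) \<le> 0" and nn: "\<And>j. 0 \<le> - (l $ j * g xs $ j)"
      by (simp_all add: inner_vec_def sum_negf)
    moreover have "(\<Sum>j\<in>UNIV. - (l $ j * g xs $ j)) \<ge> 0" using nn by (intro sum_nonneg) blast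
    ultimately have "(\<Sum>j\<in>UNIV. - (l $ j * g xs $ j)) = 0" by linarith
    then have "\<forall>j\<in>UNIV. - (l $ j * g xs $ j) = 0" using nn by (subst (asm) sum_nonneg_eq_0_iff) auto
    then have "l $ j * g xs $ j = 0" for j by simp
    then have "l $ j = 0" for j using sl(2)[of j] by (metis less_irrefl mult_eq_0_iff)
    then show False using n(1) al a by (simp add: vec_eq_iff zero_prod_def)
  qed
  with a0 have apos: "a > 0" by simp
  define \<nu> where "\<nu> = l /\<^sub>R a"
  have nu0: "\<nu> \<ge> 0" using l0 apos by (simp add: \<nu>_def less_eq_vec_def)
  have main: "q \<bullet> (y - xb) + \<nu> \<bullet> g y \<ge> 0" if y: "y \<in> \<Omega>" for y
  \<comment> \<open>The slack \<open>e\<close> compensates for the strict objective inequality in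
    \<open>A\<close>.\<close>
  proof (rule field_le_epsilon)
    fix e :: real assume e: "e > 0"
    have "0 \<le> a * (q \<bullet> (y - xb) + e) + l \<bullet> g y" using sep[OF y, of "q \<bullet> (y - xb) + e" "g y"] e by simp
    also have "\<dots> = a * (q \<bullet> (y - xb) + \<nu> \<bullet> g y + e)"
      using apos by (simp add: \<nu>_def algebra_simps)
    finally show "0 \<le> q \<bullet> (y - xb) + \<nu> \<bullet> g y + e" using apos by (simp add: zero_le_mult_iff)
  qed
  have "\<nu> \<bullet> g xb \<le> 0"
    unfolding inner_vec_def using nu0 xb(2) by (intro sum_nonpos) (auto simp: less_eq_vec_def mult_nonneg_nonpos)
  moreover have "\<nu> \<bullet> g xb \<ge> 0" using main[OF xb(1)] by simp
  ultimately show ?thesis using nu0 main by (intro exI[of _ \<nu>]) auto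
qed

section \<open>The game\<close>

lemma linear_blk: "linear (blk G i)"
  by (rule linearI) (auto simp: blk_def vec_eq_iff)

lemma blk_blk [simp]: "blk G i (blk G i x) = blk G i x"
  by (auto simp: blk_def vec_eq_iff)

lemma blk_inner: "blk G i x \<bullet> y = x \<bullet> blk G i y"
  unfolding blk_def inner_vec_def by (intro sum.cong) auto

lemma blk_deviate: "blk G i (deviate G i y x) = blk G i y" "j \<noteq> i \<Longrightarrow> blk G j (deviate G i y x) = blk G j x"
  by (auto simp: blk_def deviate_def vec_eq_iff)

lemma deviate_minus: "deviate G i y x - x = blk G i (y - x)"
  by (auto simp: blk_def deviate_def vec_eq_iff)

lemma deviate_deviate: "deviate G i (deviate G i y x) x = deviate G i y x" "deviate G i x x = x"
    "deviate G i (blk G i x) x = x"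
  by (auto simp: blk_def deviate_def vec_eq_iff)

lemma col_inner:
  fixes G :: "('i::finite, 'n::finite, 'p::finite, 'm::finite) agg_game"
  shows "col G v \<bullet> h = (\<Sum>i\<in>UNIV. v i \<bullet> blk G i h)"
proof -
  have "(\<Sum>i\<in>UNIV. v i \<bullet> blk G i h) = (\<Sum>i\<in>UNIV. \<Sum>k\<in>UNIV. if owner G k = i then v i $ k * h $ k else 0)"
    unfolding inner_vec_def blk_def by (intro sum.cong refl) auto
  also have "\<dots> = (\<Sum>k\<in>UNIV. \<Sum>i\<in>UNIV. if owner G k = i then v i $ k * h $ k else 0)" by (rule sum.swap)
  also have "\<dots> = col G v \<bullet> h" by (simp add: inner_vec_def col_def)
  finally show ?thesis ..
qed

lemma transpose_mult_inner: "(transpose A *v x) \<bullet> y = x \<bullet> ((A :: real^'n^'m) *v y)"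
  by (simp add: dot_lmul_matrix transpose_matrix_vector)

lemma inner_nonneg: "0 \<le> x \<Longrightarrow> 0 \<le> y \<Longrightarrow> 0 \<le> x \<bullet> (y :: real^'m)"
  unfolding inner_vec_def less_eq_vec_def by (intro sum_nonneg) simp

lemma inner_nonpos: "0 \<le> x \<Longrightarrow> y \<le> 0 \<Longrightarrow> x \<bullet> (y :: real^'m) \<le> 0"
  using inner_nonneg[of x "- y"] by (simp add: less_eq_vec_def)

lemma orthant_convex_closed:
  "convex {l :: real^'m. 0 \<le> l}" "closed {l :: real^'m. 0 \<le> l}"
  "convex {l :: real^'m^'i. 0 \<le> l}" "closed {l :: real^'m^'i. 0 \<le> l}"
proof -
  have 1: "{l :: real^'m. 0 \<le> l} = {l. \<forall>j. 0 \<le> l $ j}" by (auto simp: less_eq_vec_def)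
  have 2: "{l :: real^'m^'i. 0 \<le> l} = {l. \<forall>i j. 0 \<le> l $ i $ j}" by (auto simp: less_eq_vec_def)
  show "closed {l :: real^'m. 0 \<le> l}" "closed {l :: real^'m^'i. 0 \<le> l}"
    unfolding 1 2 by (intro closed_Collect_all closed_Collect_le continuous_intros)+
  show "convex {l :: real^'m. 0 \<le> l}" "convex {l :: real^'m^'i. 0 \<le> l}"
    unfolding 1 2 convex_def by auto
qed

text \<open>The block diagonal matrix \<open>B\<close> of the affine aggregation, adjoint to
  \<open>agg_transpose\<close>.\<close>

definition agg_lin :: "('i::finite, 'n::finite, 'p::finite, 'm::finite) agg_game \<Rightarrow> real^'n \<Rightarrow> real^'p^'i" where
  "agg_lin G h = (\<chi> i. agg_mat G i *v blk G i h)"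

lemma linear_agg_lin: "linear (agg_lin G)"
  by (rule linearI) (simp_all add: agg_lin_def vec_eq_iff linear_add[OF linear_blk] linear_scale[OF linear_blk]
      matrix_vector_right_distrib matrix_vector_mult_scaleR)

lemma agg_stack_diff: "agg_stack G x - agg_stack G y = agg_lin G (x - y)"
  by (simp add: agg_stack_def agg_lin_def agg_loc_def vec_eq_iff linear_diff[OF linear_blk]
      matrix_vector_mult_diff_distrib)

lemma agg_stack_eq: "agg_stack G x = agg_lin G x + agg_stack G 0"
  using agg_stack_diff[of G x 0] by (simp add: algebra_simps)

lemma avg_agg_stack: "avg (agg_stack G x) = aggregate G x"
  by (simp add: avg_def agg_stack_def aggregate_def)

lemma agg_transpose_inner: "agg_transpose G y \<bullet> h = y \<bullet> agg_lin G h"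
  unfolding agg_transpose_def col_inner transpose_mult_inner
  by (simp add: agg_lin_def inner_vec_def[of y])

locale agg_setting =
  fixes G :: "('i::finite, 'n::finite, 'p::finite, 'm::finite) agg_game"
    and E :: "('i \<times> 'i) set"
    and \<gamma> :: "real^'i"
    and \<mu> \<theta> :: real
  assumes strategies_closed: "\<And>i. closed (strategies G i)"
    and strategies_convex: "\<And>i. convex (strategies G i)"
    and constr_convex: "\<And>i j. convex_on UNIV (\<lambda>y. loc_constr G i (blk G i y) $ j)"
    and constr_C2: "\<And>i. C2_map (\<lambda>y. loc_constr G i (blk G i y))"
    and slater_cq: "slater G"
    and loc_cost_differentiable:
      "\<And>i. (\<lambda>(y, w). loc_cost G i (blk G i y) w) differentiable_on UNIV"
    and cost_convex: "\<And>i x. convex_on UNIV (\<lambda>y. cost G i (deviate G i y x))"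
    and mu_pos: "\<mu> > 0"
    and strongly_monotone:
      "\<And>x y. (pseudo_gradient G x - pseudo_gradient G y) \<bullet> (x - y) \<ge> \<mu> * (norm (x - y))\<^sup>2"
    and graph: "undirected_connected E"
    and theta_pos: "\<theta> > 0"
    and ext_lipschitz: "\<theta>-lipschitz_on UNIV (\<lambda>(x, \<sigma>). ext_pseudo_gradient G x \<sigma>)"
    and gamma_pos: "\<And>i. \<gamma> $ i > 0"
begin

abbreviation F :: "real^'n \<Rightarrow> real^'n" where "F \<equiv> pseudo_gradient G"

abbreviation gi :: "'i \<Rightarrow> real^'n \<Rightarrow> real^'m" where "gi i x \<equiv> loc_constr G i (blk G i x)"

abbreviation J :: "'i \<Rightarrow> real^'n \<Rightarrow> real^'n^'m" where "J i x \<equiv> jacobian (\<lambda>y. gi i y) (at x)"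

lemma sym_graph: "sym E"
  using graph by (simp add: undirected_connected_def)

lemma gi_derivative: "(gi i has_derivative (\<lambda>h. J i x *v h)) (at x)"
proof -
  have "gi i differentiable (at x)" using constr_C2[of i] unfolding C2_map_def by (auto intro: differentiableI)
  then show ?thesis using jacobian_works[of "gi i" "at x"] by simp
qed

lemma blk_derivative: "(blk G i has_derivative blk G i) (at x)"
  by (rule linear_imp_has_derivative[OF linear_blk])

text \<open>\<open>blk\<close> is idempotent, so \<open>gi i\<close> is unchanged by precomposition
  with it. The chain rule rewrites \<open>J i x\<close> through \<open>J i (blk G i x)\<close> for
  any increment \<open>h\<close>, and the result depends only on the own block of
  \<open>h\<close>.\<close>

lemma J_blk: "J i x *v blk G i h = J i x *v h"
proof -
  have "((\<lambda>y. gi i (blk G i y)) has_derivative (\<lambda>h. J i (blk G i x) *v blk G i h)) (at x)"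
    by (rule has_derivative_compose[OF blk_derivative gi_derivative])
  then have "(gi i has_derivative (\<lambda>h. J i (blk G i x) *v blk G i h)) (at x)" by simp
  then have "(\<lambda>h. J i (blk G i x) *v blk G i h) = (\<lambda>h. J i x *v h)"
    using gi_derivative by (rule has_derivative_unique)
  then have "J i x *v h = J i (blk G i x) *v blk G i h" for h by metis
  then show ?thesis by simp
qed

lemma constr_derivative: "(constr G has_derivative (\<lambda>h. \<Sum>i\<in>UNIV. J i x *v h)) (at x)"
  unfolding constr_def[abs_def] by (rule has_derivative_sum) (rule gi_derivative)

lemma jacobian_constr: "jacobian (constr G) (at x) *v h = (\<Sum>i\<in>UNIV. J i x *v h)"
proof -
  have "constr G differentiable (at x)" using constr_derivative by (rule differentiableI)
  then have "(constr G has_derivative (\<lambda>h. jacobian (constr G) (at x) *v h)) (at x)"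
    using jacobian_works by blast
  then have "(\<lambda>h. jacobian (constr G) (at x) *v h) = (\<lambda>h. \<Sum>i\<in>UNIV. J i x *v h)"
    using constr_derivative by (rule has_derivative_unique)
  then show ?thesis by metis
qed

lemma constr_jac_transpose_inner: "constr_jac_transpose G x \<nu> \<bullet> h = (\<Sum>i\<in>UNIV. \<nu> $ i \<bullet> (J i x *v h))"
  unfolding constr_jac_transpose_def col_inner transpose_mult_inner J_blk ..

lemma gi_convex:
  assumes "0 \<le> l"
  shows "l \<bullet> (gi i x + J i x *v (y - x)) \<le> l \<bullet> gi i y"
proof -
  have "gi i x $ j + (J i x *v (y - x)) $ j \<le> gi i y $ j" for j
    by (rule convex_on_gradient_ineq[OF constr_convex])
      (rule bounded_linear.has_derivative[OF bounded_linear_vec_nth gi_derivative])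
  then show ?thesis using assms unfolding inner_vec_def less_eq_vec_def
    by (intro sum_mono) (auto intro!: mult_left_mono)
qed

lemma constr_convex_ineq:
  assumes "0 \<le> l"
  shows "l \<bullet> constr G x + (\<Sum>i\<in>UNIV. l \<bullet> (J i x *v (y - x))) \<le> l \<bullet> constr G y"
proof -
  have "(\<Sum>i\<in>UNIV. l \<bullet> (gi i x + J i x *v (y - x))) \<le> (\<Sum>i\<in>UNIV. l \<bullet> gi i y)"
    by (intro sum_mono gi_convex assms)
  then show ?thesis by (simp add: constr_def inner_sum_right inner_add_right sum.distrib)
qed

lemma constr_component_convex: "convex_on UNIV (\<lambda>y. constr G y $ j)"
proof -
  have "convex_on UNIV (\<lambda>y. \<Sum>i\<in>I. gi i y $ j)" if "finite I" for I
    using that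
  proof induction
    case (insert i I)
    have "convex_on UNIV (\<lambda>y. gi i y $ j + (\<Sum>i\<in>I. gi i y $ j))"
      by (rule convex_on_add[OF constr_convex insert.IH])
    then show ?case using insert.hyps by simp
  qed (simp add: convex_on_const)
  then show ?thesis by (simp add: constr_def)
qed

lemma convex_closed_Omega: "convex (Omega G)" "closed (Omega G)"
proof -
  have eq: "Omega G = (\<Inter>i. blk G i -` strategies G i)" by (auto simp: Omega_def)
  show "convex (Omega G)" unfolding eq
    by (intro convex_INT convex_linear_vimage linear_blk strategies_convex)
  show "closed (Omega G)" unfolding eq
    by (intro closed_INT ballI continuous_closed_vimage strategies_closed)
      (simp add: linear_continuous_at linear_conv_bounded_linear[symmetric] linear_blk)
qed

lemma continuous_constr: "continuous_on UNIV (constr G)"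
  by (intro differentiable_imp_continuous_on) (auto simp: differentiable_on_def intro: differentiableI constr_derivative)

lemma convex_closed_feasible: "convex (feasible G)" "closed (feasible G)" "feasible G \<noteq> {}"
proof -
  have eq: "{x. constr G x \<le> 0} = (\<Inter>j. {x. constr G x $ j \<le> 0})"
    by (auto simp: less_eq_vec_def)
  have "convex {x. constr G x $ j \<le> 0}" for j
  proof (rule convexI)
    fix x y and u v :: real
    assume *: "x \<in> {x. constr G x $ j \<le> 0}" "y \<in> {x. constr G x $ j \<le> 0}" "0 \<le> u" "0 \<le> v" "u + v = 1"
    have "constr G (u *\<^sub>R x + v *\<^sub>R y) $ j \<le> u * constr G x $ j + v * constr G y $ j"
      using constr_component_convex[of j] * unfolding convex_on_def by blast
    also have "\<dots> \<le> 0" using * by (simp add: add_nonpos_nonpos mult_nonneg_nonpos)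
    finally show "u *\<^sub>R x + v *\<^sub>R y \<in> {x. constr G x $ j \<le> 0}" by simp
  qed
  then show "convex (feasible G)"
    unfolding feasible_def eq by (intro convex_Int convex_INT convex_closed_Omega)
  have "closed {x. constr G x $ j \<le> 0}" for j
    by (intro closed_Collect_le continuous_on_component continuous_constr continuous_on_const)
  then show "closed (feasible G)"
    unfolding feasible_def eq by (intro closed_Int closed_INT ballI convex_closed_Omega)
  obtain x where "x \<in> rel_interior (Omega G)" "\<forall>j. constr G x $ j < 0"
    using slater_cq by (auto simp: slater_def)
  then have "x \<in> feasible G"
    using rel_interior_subset by (force simp: feasible_def less_eq_vec_def intro: less_imp_le)
  then show "feasible G \<noteq> {}" by auto
qed

lemma aggregate_deviate:
  "aggregate G (deviate G i y x) = aggregate G x + (1 / real CARD('i)) *\<^sub>R (agg_mat G i *v blk G i (y - x))"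
proof -
  have "(\<Sum>j\<in>UNIV. agg_loc G j (blk G j (deviate G i y x)) - agg_loc G j (blk G j x))
      = (\<Sum>j\<in>UNIV. if j = i then agg_mat G i *v blk G i (y - x) else 0)"
    by (intro sum.cong refl)
      (auto simp: blk_deviate agg_loc_def linear_diff[OF linear_blk] matrix_vector_mult_diff_distrib)
  also have "\<dots> = agg_mat G i *v blk G i (y - x)" by simp
  finally have "(\<Sum>j\<in>UNIV. agg_loc G j (blk G j (deviate G i y x)))
      = (\<Sum>j\<in>UNIV. agg_loc G j (blk G j x)) + agg_mat G i *v blk G i (y - x)"
    by (simp add: sum_subtractf algebra_simps)
  then show ?thesis by (simp add: aggregate_def scaleR_right_distrib)
qed

text \<open>The own decision enters \<open>cost\<close> directly and through the aggregate with
  weight 1/N. Joint differentiability of \<open>loc_cost\<close> splits the derivative into these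
  two channels, which is the origin of the 1/N term in \<open>ext_pseudo_gradient\<close>.\<close>

lemma cost_gradient:
  fixes i x
  defines "D1 \<equiv> gradient (\<lambda>y. loc_cost G i (blk G i y) (aggregate G x)) x"
    and "D2 \<equiv> gradient (\<lambda>w. loc_cost G i (blk G i x) w) (aggregate G x)"
  shows "((\<lambda>y. cost G i (deviate G i y x)) has_derivative
     (\<lambda>h. (D1 + (1 / real CARD('i)) *\<^sub>R blk G i (transpose (agg_mat G i) *v D2)) \<bullet> h)) (at x)"
proof -
  define \<Phi> where "\<Phi> = (\<lambda>(y, w). loc_cost G i (blk G i y) w)"
  let ?w = "aggregate G x"
  have "\<Phi> differentiable (at (x, ?w))"
    using loc_cost_differentiable[of i] by (simp add: \<Phi>_def differentiable_on_def)
  then obtain \<Phi>' where \<Phi>': "(\<Phi> has_derivative \<Phi>') (at (x, ?w))" by (auto simp: differentiable_def)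
  have lin: "linear \<Phi>'" using has_derivative_linear[OF \<Phi>'] .
  have "((\<lambda>y. (y, ?w)) has_derivative (\<lambda>h. (h, 0))) (at x)" by (auto intro!: derivative_eq_intros)
  from has_derivative_compose[OF this \<Phi>']
  have d1: "((\<lambda>y. loc_cost G i (blk G i y) ?w) has_derivative (\<lambda>h. \<Phi>' (h, 0))) (at x)" by (simp add: \<Phi>_def)
  then have "(\<lambda>h. D1 \<bullet> h) = (\<lambda>h. \<Phi>' (h, 0))"
    unfolding D1_def by (intro has_derivative_unique[OF GDERIV_gradient d1] differentiableI[OF d1])
  then have e1: "\<Phi>' (h, 0) = D1 \<bullet> h" for h by metis
  have "((\<lambda>w. (x, w)) has_derivative (\<lambda>h. (0, h))) (at ?w)" by (auto intro!: derivative_eq_intros)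
  from has_derivative_compose[OF this \<Phi>']
  have d2: "((\<lambda>w. loc_cost G i (blk G i x) w) has_derivative (\<lambda>h. \<Phi>' (0, h))) (at ?w)" by (simp add: \<Phi>_def)
  then have "(\<lambda>h. D2 \<bullet> h) = (\<lambda>h. \<Phi>' (0, h))"
    unfolding D2_def by (intro has_derivative_unique[OF GDERIV_gradient d2] differentiableI[OF d2])
  then have e2: "\<Phi>' (0, h) = D2 \<bullet> h" for h by metis
  have e: "\<Phi>' (h, k) = D1 \<bullet> h + D2 \<bullet> k" for h k
    using linear_add[OF lin, of "(h, 0)" "(0, k)"] by (simp add: e1 e2)
  let ?c = "1 / real CARD('i)"
  let ?a = "\<lambda>y. ?w + ?c *\<^sub>R (agg_mat G i *v blk G i (y - x))"
  have bl: "bounded_linear (\<lambda>h. ?c *\<^sub>R (agg_mat G i *v blk G i h))"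
    by (intro linear_conv_bounded_linear[THEN iffD1] linear_compose_scale_right
        linear_compose[OF linear_blk matrix_vector_mul_linear, unfolded o_def])
  have "((\<lambda>y. y - x) has_derivative (\<lambda>h. h)) (at x)" by (auto intro!: derivative_eq_intros)
  then have "((\<lambda>y. ?c *\<^sub>R (agg_mat G i *v blk G i (y - x))) has_derivative (\<lambda>h. ?c *\<^sub>R (agg_mat G i *v blk G i h))) (at x)"
    by (rule bounded_linear.has_derivative[OF bl])
  then have "(?a has_derivative (\<lambda>h. 0 + ?c *\<^sub>R (agg_mat G i *v blk G i h))) (at x)"
    by (intro has_derivative_add has_derivative_const)
  then have "((\<lambda>y. (y, ?a y)) has_derivative (\<lambda>h. (h, 0 + ?c *\<^sub>R (agg_mat G i *v blk G i h)))) (at x)"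
    by (intro has_derivative_Pair has_derivative_ident)
  moreover have "(\<Phi> has_derivative \<Phi>') (at (x, ?a x))" using \<Phi>' by (simp add: linear_0[OF linear_blk])
  ultimately have "((\<lambda>y. \<Phi> (y, ?a y)) has_derivative (\<lambda>h. \<Phi>' (h, 0 + ?c *\<^sub>R (agg_mat G i *v blk G i h)))) (at x)"
    by (rule has_derivative_compose)
  moreover have "(\<lambda>y. \<Phi> (y, ?a y)) = (\<lambda>y. cost G i (deviate G i y x))"
    by (simp add: \<Phi>_def cost_def blk_deviate aggregate_deviate)
  moreover have "\<Phi>' (h, 0 + ?c *\<^sub>R (agg_mat G i *v blk G i h))
      = (D1 + ?c *\<^sub>R blk G i (transpose (agg_mat G i) *v D2)) \<bullet> h" for h
    by (simp add: e inner_add_left blk_inner dot_lmul_matrix)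
  ultimately show ?thesis by simp
qed

text \<open>\<open>col\<close> reads only owned coordinates, so the \<open>blk\<close> occurring in
  \<open>cost_gradient\<close> disappears. The identity allows the error caused by wrong estimates
  to be measured with the Lipschitz constant of the extended map.\<close>

lemma F_eq_ext: "F x = ext_pseudo_gradient G x (replicated (aggregate G x))"
proof -
  have "gradient (\<lambda>y. cost G i (deviate G i y x)) x
    = gradient (\<lambda>y. loc_cost G i (blk G i y) (aggregate G x)) x
      + (1 / real CARD('i)) *\<^sub>R blk G i (transpose (agg_mat G i) *v gradient (\<lambda>w. loc_cost G i (blk G i x) w) (aggregate G x))" for i
    by (rule gradient_eqI) (rule cost_gradient)
  then show ?thesis
    unfolding pseudo_gradient_def ext_pseudo_gradient_def col_def
    by (simp add: vec_eq_iff replicated_def blk_def)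
qed

lemma ext_lip: "norm (ext_pseudo_gradient G x \<sigma> - ext_pseudo_gradient G x \<sigma>') \<le> \<theta> * norm (\<sigma> - \<sigma>')"
  using lipschitz_on_normD[OF ext_lipschitz, of "(x, \<sigma>)" "(x, \<sigma>')"] by simp

text \<open>\<open>F\<close> is the extended map composed with an affine map and inherits its
  Lipschitz property, which the contraction in \<open>vi_point_exists\<close> needs.\<close>

lemma F_lipschitz: "\<exists>L. L-lipschitz_on UNIV F"
proof -
  have "linear (\<lambda>x :: real^'n. replicated (avg (agg_lin G x)) :: real^'p^'i)"
    by (intro linear_compose[OF linear_compose[OF linear_agg_lin linear_avg] linear_replicated, unfolded o_def])
  then have bl: "bounded_linear (\<lambda>x :: real^'n. replicated (avg (agg_lin G x)) :: real^'p^'i)"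
    by (simp add: linear_conv_bounded_linear)
  obtain B where B: "B-lipschitz_on UNIV (\<lambda>x :: real^'n. replicated (avg (agg_lin G x)) :: real^'p^'i)"
    using bounded_linear.lipschitz_boundE[OF bl] by blast
  have eq: "replicated (aggregate G x) = (replicated (avg (agg_lin G x)) :: real^'p^'i) + replicated (avg (agg_stack G 0))" for x
    by (simp add: avg_agg_stack[symmetric] agg_stack_eq[of G x] linear_add[OF linear_avg] linear_add[OF linear_replicated])
  have "\<exists>L. L-lipschitz_on UNIV (\<lambda>x. (x, replicated (aggregate G x) :: real^'p^'i))"
    unfolding eq by (rule exI, rule lipschitz_on_Pair[OF lipschitz_on_id lipschitz_on_add[OF B lipschitz_on_constant]])
  then obtain L where L: "L-lipschitz_on UNIV (\<lambda>x. (x, replicated (aggregate G x) :: real^'p^'i))" by blast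
  have "(\<theta> * L)-lipschitz_on UNIV (\<lambda>x. (\<lambda>(x, \<sigma>). ext_pseudo_gradient G x \<sigma>) (x, replicated (aggregate G x)))"
    by (rule lipschitz_on_compose2[OF L]) (rule lipschitz_on_subset[OF ext_lipschitz], simp)
  then show ?thesis by (auto simp: F_eq_ext[abs_def])
qed

section \<open>KKT conditions in variational form\<close>

definition KKT_vi :: "real^'n \<Rightarrow> real^'m \<Rightarrow> bool" where
  "KKT_vi x l \<longleftrightarrow> x \<in> Omega G \<and> 0 \<le> l \<and>
     (\<forall>y\<in>Omega G. F x \<bullet> (y - x) + (\<Sum>i\<in>UNIV. l \<bullet> (J i x *v (y - x))) \<ge> 0) \<and>
     constr G x \<le> 0 \<and> l \<bullet> constr G x = 0"

lemma KKT_iff: "KKT G x l \<longleftrightarrow> KKT_vi x l"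
proof -
  let ?q = "F x + transpose (jacobian (constr G) (at x)) *v l"
  have q: "?q \<bullet> h = F x \<bullet> h + (\<Sum>i\<in>UNIV. l \<bullet> (J i x *v h))" for h
    by (simp only: inner_add_left transpose_mult_inner jacobian_constr inner_sum_right)
  have 1: "(\<exists>v \<in> normal_cone (Omega G) x. 0 = ?q + v) \<longleftrightarrow> (\<forall>y\<in>Omega G. ?q \<bullet> (y - x) \<ge> 0)"
  proof
    assume "\<exists>v \<in> normal_cone (Omega G) x. 0 = ?q + v"
    then obtain v where v: "v \<in> normal_cone (Omega G) x" "v = - ?q" by (metis add.commute eq_neg_iff_add_eq_0)
    show "\<forall>y\<in>Omega G. ?q \<bullet> (y - x) \<ge> 0"
    proof
      fix y assume "y \<in> Omega G"
      then have "v \<bullet> (y - x) \<le> 0" using v(1) by (auto simp: normal_cone_def)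
      then show "?q \<bullet> (y - x) \<ge> 0" unfolding v(2) by (simp only: inner_minus_left neg_le_0_iff_le)
    qed
  next
    assume "\<forall>y\<in>Omega G. ?q \<bullet> (y - x) \<ge> 0"
    then have "- ?q \<in> normal_cone (Omega G) x"
      unfolding normal_cone_def by (simp only: inner_minus_left mem_Collect_eq neg_le_0_iff_le)
    then show "\<exists>v \<in> normal_cone (Omega G) x. 0 = ?q + v" by (rule bexI[rotated]) simp
  qed
  have 2: "(\<exists>w \<in> normal_cone {l. 0 \<le> l} l. 0 = - constr G x + w) \<longleftrightarrow> constr G x \<le> 0 \<and> l \<bullet> constr G x = 0"
    if l: "0 \<le> l"
  proof
    assume "\<exists>w \<in> normal_cone {l. 0 \<le> l} l. 0 = - constr G x + w"
    then have w: "constr G x \<bullet> (z - l) \<le> 0" if "0 \<le> z" for z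
      using that by (auto simp: normal_cone_def)
    \<comment> \<open>The test point \<open>l + axis j 1\<close> isolates the sign of one
      constraint; below, 0 and \<open>l + l\<close> give the two halves of complementarity.\<close>
    have "constr G x $ j \<le> 0" for j
    proof -
      have "0 \<le> l + axis j 1" using l by (simp add: less_eq_vec_def axis_def)
      from w[OF this] show ?thesis by (simp add: inner_axis)
    qed
    moreover have "l \<bullet> constr G x \<ge> 0" using w[of 0] by (simp add: inner_commute)
    moreover have "l \<bullet> constr G x \<le> 0"
    proof -
      have "0 \<le> l + l" using l by (simp add: less_eq_vec_def)
      from w[OF this] show ?thesis by (simp add: inner_commute)
    qed
    ultimately show "constr G x \<le> 0 \<and> l \<bullet> constr G x = 0" by (auto simp: less_eq_vec_def)
  next
    assume *: "constr G x \<le> 0 \<and> l \<bullet> constr G x = 0"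
    have "constr G x \<in> normal_cone {l. 0 \<le> l} l"
      unfolding normal_cone_def using * inner_nonpos[of _ "constr G x"]
      by (auto simp: inner_diff_right inner_commute)
    then show "\<exists>w \<in> normal_cone {l. 0 \<le> l} l. 0 = - constr G x + w" by (rule bexI[rotated]) simp
  qed
  show ?thesis unfolding KKT_def KKT_vi_def 1 q using 2 by blast
qed

text \<open>Convexity of the weighted constraint replaces its linearisation by values, which are
  nonpositive at a feasible \<open>y\<close>. The multiplier thus disappears, which is why the
  primal part is unique even when multipliers are not.\<close>

lemma KKT_vi_feasible:
  assumes "KKT_vi x l" "y \<in> feasible G"
  shows "F x \<bullet> (y - x) \<ge> 0"
proof -
  have "l \<bullet> constr G x + (\<Sum>i\<in>UNIV. l \<bullet> (J i x *v (y - x))) \<le> l \<bullet> constr G y"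
    using assms by (intro constr_convex_ineq) (auto simp: KKT_vi_def)
  moreover have "l \<bullet> constr G y \<le> 0" using assms by (intro inner_nonpos) (auto simp: KKT_vi_def feasible_def)
  moreover have "F x \<bullet> (y - x) + (\<Sum>i\<in>UNIV. l \<bullet> (J i x *v (y - x))) \<ge> 0"
    using assms by (auto simp: KKT_vi_def feasible_def)
  ultimately show ?thesis using assms by (simp add: KKT_vi_def)
qed

lemma KKT_vi_unique:
  assumes "KKT_vi x l" "KKT_vi y l'"
  shows "x = y"
proof -
  have "x \<in> feasible G" "y \<in> feasible G" using assms by (auto simp: KKT_vi_def feasible_def)
  then have "F x \<bullet> (y - x) \<ge> 0" "F y \<bullet> (x - y) \<ge> 0" using KKT_vi_feasible assms by auto
  then have "(F x - F y) \<bullet> (x - y) \<le> 0" by (simp add: inner_diff_left inner_diff_right)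
  then have "\<mu> * (norm (x - y))\<^sup>2 \<le> 0" using strongly_monotone[of x y] by linarith
  then show ?thesis using mu_pos by (simp add: mult_le_0_iff)
qed

text \<open>With the pseudo-gradient frozen at the solution \<open>x\<close> of the variational
  inequality over the feasible set, \<open>x\<close> minimises a linear objective under convex
  constraints. The multiplier makes \<open>x\<close> a minimiser of the Lagrangian over
  \<open>Omega G\<close>, whose directional derivatives into \<open>Omega G\<close> are then
  nonnegative.\<close>

lemma KKT_vi_exists: "\<exists>x l. KKT_vi x l"
proof -
  obtain L where "L-lipschitz_on UNIV F" using F_lipschitz by blast
  then obtain x where x: "x \<in> feasible G" "\<forall>y\<in>feasible G. F x \<bullet> (y - x) \<ge> 0"
    using vi_point_exists[OF convex_closed_feasible _ mu_pos strongly_monotone] by blast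
  obtain xs where xs: "xs \<in> Omega G" "\<And>j. constr G xs $ j < 0"
    using slater_cq rel_interior_subset unfolding slater_def by blast
  have xO: "x \<in> Omega G" "constr G x \<le> 0" using x by (auto simp: feasible_def)
  have "\<exists>\<nu>\<ge>0. (\<forall>y\<in>Omega G. F x \<bullet> (y - x) + \<nu> \<bullet> constr G y \<ge> 0) \<and> \<nu> \<bullet> constr G x = 0"
    by (rule lagrange_multiplier[OF convex_closed_Omega(1) constr_component_convex xs xO])
      (use x(2) in \<open>auto simp: feasible_def\<close>)
  then obtain \<nu> where \<nu>: "\<nu> \<ge> 0" "\<And>y. y \<in> Omega G \<Longrightarrow> F x \<bullet> (y - x) + \<nu> \<bullet> constr G y \<ge> 0" "\<nu> \<bullet> constr G x = 0"
    by blast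
  have "F x \<bullet> (y - x) + (\<Sum>i\<in>UNIV. \<nu> \<bullet> (J i x *v (y - x))) \<ge> 0" if y: "y \<in> Omega G" for y
  proof -
    have "((\<lambda>y. F x \<bullet> (y - x)) has_derivative (\<lambda>h. F x \<bullet> h)) (at x)"
      by (auto intro!: derivative_eq_intros)
    moreover have "((\<lambda>y. \<nu> \<bullet> constr G y) has_derivative (\<lambda>h. \<nu> \<bullet> (\<Sum>i\<in>UNIV. J i x *v h))) (at x)"
      by (rule bounded_linear.has_derivative[OF bounded_linear_inner_right constr_derivative])
    ultimately have d: "((\<lambda>y. F x \<bullet> (y - x) + \<nu> \<bullet> constr G y) has_derivative
        (\<lambda>h. F x \<bullet> h + \<nu> \<bullet> (\<Sum>i\<in>UNIV. J i x *v h))) (at x)"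
      by (rule has_derivative_add)
    have "F x \<bullet> (y - x) + \<nu> \<bullet> (\<Sum>i\<in>UNIV. J i x *v (y - x)) \<ge> 0"
    proof (rule derivative_nonneg_of_min[OF d])
      fix t :: real assume t: "0 < t" "t < 1"
      have "x + t *\<^sub>R (y - x) = (1 - t) *\<^sub>R x + t *\<^sub>R y" by (simp add: algebra_simps)
      also have "\<dots> \<in> Omega G" using convex_closed_Omega(1) xO(1) y t by (intro convexD) auto
      finally have m: "x + t *\<^sub>R (y - x) \<in> Omega G" .
      show "F x \<bullet> (x - x) + \<nu> \<bullet> constr G x
          \<le> F x \<bullet> (x + t *\<^sub>R (y - x) - x) + \<nu> \<bullet> constr G (x + t *\<^sub>R (y - x))"
        using \<nu>(2)[OF m] \<nu>(3) by simp
    qed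
    then show ?thesis by (simp add: inner_sum_right)
  qed
  then have "KKT_vi x \<nu>" using xO \<nu> by (simp add: KKT_vi_def)
  then show ?thesis by blast
qed

text \<open>A unilateral deviation moves only block \<open>i\<close>, so \<open>F x\<close> sees it
  through the own gradient alone; by convexity of the own cost an improving deviation would violate
  \<open>KKT_vi_feasible\<close>.\<close>

lemma KKT_vi_GNE:
  assumes K: "KKT_vi x l" shows "is_GNE G x"
  unfolding is_GNE_def is_arg_min_def
proof (intro allI conjI notI)
  fix i
  have "x \<in> feasible G" using K by (auto simp: KKT_vi_def feasible_def)
  then show "deviate G i (blk G i x) x \<in> feasible G" by (simp add: deviate_deviate)
  assume "\<exists>y. deviate G i y x \<in> feasible G \<and> cost G i (deviate G i y x) < cost G i (deviate G i (blk G i x) x)"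
  then obtain y where y: "deviate G i y x \<in> feasible G" "cost G i (deviate G i y x) < cost G i x"
    by (auto simp: deviate_deviate)
  let ?\<phi> = "\<lambda>y. cost G i (deviate G i y x)" and ?d = "deviate G i y x"
  have diff: "?\<phi> differentiable (at x)" using cost_gradient by (rule differentiableI)
  have "?\<phi> x + gradient ?\<phi> x \<bullet> (?d - x) \<le> ?\<phi> ?d"
    by (rule convex_on_gradient_ineq[OF cost_convex GDERIV_gradient[OF diff]])
  then have "gradient ?\<phi> x \<bullet> (?d - x) < 0" using y(2) by (simp add: deviate_deviate)
  moreover have "F x \<bullet> (?d - x) = gradient ?\<phi> x \<bullet> (?d - x)"
  proof -
    have "blk G j (blk G i (y - x)) = (if j = i then blk G i (y - x) else 0)" for j
      by (auto simp: blk_def vec_eq_iff)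
    then have "F x \<bullet> blk G i (y - x) = (\<Sum>j\<in>UNIV. if j = i then gradient ?\<phi> x \<bullet> blk G i (y - x) else 0)"
      unfolding pseudo_gradient_def col_inner by (intro sum.cong) auto
    then show ?thesis by (simp add: deviate_minus)
  qed
  ultimately show False using KKT_vi_feasible[OF K y(1)] by simp
qed

end

section \<open>Limit points of bounded solutions\<close>

lemma vi_rate:
  fixes U :: "'a::euclidean_space \<Rightarrow> real"
  assumes sol: "vi_solution S f T s" and ab: "0 \<le> a" "a \<le> b" "b \<le> T"
    and lob: "lipschitz_on_bounded U" and dU: "\<And>x. (U has_derivative U' x) (at x)"
    and le: "\<And>t d. a < t \<Longrightarrow> t < b \<Longrightarrow> (s has_vector_derivative d) (at t)
      \<Longrightarrow> (\<And>z. z \<in> S \<Longrightarrow> (f (s t) - d) \<bullet> (z - s t) \<le> 0) \<Longrightarrow> U' (s t) d \<le> c"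
  shows "U (s b) - U (s a) \<le> c * (b - a)"
proof (rule ac_rate[OF ac_subinterval[OF _ ab(1,3)] ab(2) _ lob dU, where P = "\<lambda>t. vi_velocity S f (s t)"])
  show "abs_continuous_on_interval 0 T s" using sol unfolding vi_solution_def by blast
  have "AE t in lborel. 0 < t \<and> t < T \<longrightarrow> (\<exists>d. (s has_vector_derivative d) (at t) \<and> vi_velocity S f (s t) d)"
    using sol unfolding vi_solution_def by blast
  then show "AE t in lborel. a < t \<and> t < b \<longrightarrow> (\<exists>d. (s has_vector_derivative d) (at t) \<and> vi_velocity S f (s t) d)"
    by eventually_elim (use ab in force)
qed (use le in blast)

lemma quadratic_has_derivative:
  fixes Q :: "'a::euclidean_space \<Rightarrow> 'a"
  assumes Q: "linear Q" and adj: "\<And>x y. x \<bullet> Q y = Q x \<bullet> y"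
  shows "((\<lambda>s. (s - a) \<bullet> Q (s - a) / 2) has_derivative (\<lambda>h. Q (s - a) \<bullet> h)) (at s)"
proof -
  have 1: "((\<lambda>s. s - a) has_derivative (\<lambda>h. h)) (at s)" by (auto intro!: derivative_eq_intros)
  have 2: "((\<lambda>s. Q (s - a)) has_derivative (\<lambda>h. Q h)) (at s)"
    using bounded_linear.has_derivative[OF linear_conv_bounded_linear[THEN iffD1, OF Q] 1] .
  have "((\<lambda>s. (s - a) \<bullet> Q (s - a)) has_derivative (\<lambda>h. (s - a) \<bullet> Q h + h \<bullet> Q (s - a))) (at s)"
    by (rule has_derivative_inner[OF 1 2])
  then have "((\<lambda>s. (s - a) \<bullet> Q (s - a) / 2) has_derivative (\<lambda>h. ((s - a) \<bullet> Q h + h \<bullet> Q (s - a)) / 2)) (at s)"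
    by (rule bounded_linear.has_derivative[OF bounded_linear_divide])
  moreover have "((s - a) \<bullet> Q h + h \<bullet> Q (s - a)) / 2 = Q (s - a) \<bullet> h" for h
    by (simp add: adj[of h "s - a", symmetric] adj[of "s - a" h] inner_commute)
  ultimately show ?thesis by simp
qed

lemma quadratic_lob:
  fixes Q :: "'a::euclidean_space \<Rightarrow> 'a"
  assumes Q: "linear Q"
  shows "lipschitz_on_bounded (\<lambda>s. (s - a) \<bullet> Q (s - a) / 2)"
proof -
  have "lipschitz_on_bounded (\<lambda>s. Q (s - a))"
    by (rule lob_linear[OF linear_conv_bounded_linear[THEN iffD1, OF Q] lob_diff[OF lob_ident lob_const]])
  then have "lipschitz_on_bounded (\<lambda>s. (1 / 2) * ((s - a) \<bullet> Q (s - a)))"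
    by (intro lob_intros)
  then show ?thesis by simp
qed

lemma antimono_tendsto:
  fixes U :: "real \<Rightarrow> real"
  assumes dec: "\<And>a b. 0 \<le> a \<Longrightarrow> a \<le> b \<Longrightarrow> U b \<le> U a" and lb: "\<And>t. t \<ge> 0 \<Longrightarrow> B \<le> U t"
  shows "\<exists>l. (U \<longlongrightarrow> l) at_top"
proof -
  define l where "l = Inf (U ` {0..})"
  have bdd: "bdd_below (U ` {0..})" using lb by (intro bdd_belowI2[of _ B]) auto
  have "(U \<longlongrightarrow> l) at_top"
  proof (rule tendstoI)
    fix e :: real assume e: "e > 0"
    have "\<exists>y\<in>U ` {0..}. y < l + e"
      using cInf_lessD[of "U ` {0..}" "l + e"] e unfolding l_def by auto
    then obtain a where a: "a \<ge> 0" "U a < l + e" by auto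
    have "dist (U t) l < e" if "t \<ge> a" for t
    proof -
      have "l \<le> U t" unfolding l_def using that a by (intro cInf_lower bdd) auto
      moreover have "U t < l + e" using dec[of a t] a that by simp
      ultimately show ?thesis by (simp add: dist_real_def)
    qed
    then show "\<forall>\<^sub>F t in at_top. dist (U t) l < e" unfolding eventually_at_top_linorder by blast
  qed
  then show ?thesis by blast
qed

locale bounded_vi_solution =
  fixes S :: "'a::euclidean_space set" and f :: "'a \<Rightarrow> 'a" and s :: "real \<Rightarrow> 'a" and R :: real
  assumes sol: "\<And>T. T \<ge> 0 \<Longrightarrow> vi_solution S f T s"
    and bnd: "\<And>t. t \<ge> 0 \<Longrightarrow> norm (s t) < R"
    and lob_f: "lipschitz_on_bounded f"
begin

text \<open>Membership in the omega-limit set of \<open>s\<close>.\<close>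

definition limit_point :: "'a \<Rightarrow> bool" where
  "limit_point p \<longleftrightarrow> (\<exists>\<tau>. filterlim \<tau> at_top sequentially \<and> (\<forall>n. \<tau> n \<ge> 0) \<and> (\<lambda>n. s (\<tau> n)) \<longlonglongrightarrow> p)"

lemma in_S: "t \<ge> 0 \<Longrightarrow> s t \<in> S"
  using sol[of t] by (auto simp: vi_solution_def)

text \<open>The reversed velocity is tangent as well, so the inequality yields
  \<open>norm d \<le> norm (f (s t))\<close>, and \<open>f\<close> is bounded on the ball that
  contains the solution.\<close>

lemma lipschitz_in_time: "\<exists>C>0. \<forall>a b. 0 \<le> a \<longrightarrow> a \<le> b \<longrightarrow> norm (s b - s a) \<le> C * (b - a)"
proof -
  obtain B where B: "\<forall>x\<in>cball 0 R. norm (f x) \<le> B" using lob_bounded_image[OF lob_f] by blast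
  have "norm (s b - s a) \<le> (\<bar>B\<bar> + 1) * (b - a)" if ab: "0 \<le> a" "a \<le> b" for a b
  proof (cases "s b = s a")
    case False
    let ?w = "s b - s a"
    have b: "0 \<le> b" using ab by simp
    \<comment> \<open>\<open>vi_rate\<close> handles scalar functions only, so the increment is
      measured against its own direction \<open>?w\<close>.\<close>
    have "s b \<bullet> ?w - s a \<bullet> ?w \<le> ((\<bar>B\<bar> + 1) * norm ?w) * (b - a)"
    proof (rule vi_rate[OF sol[OF b] ab order_refl lob_inner[OF lob_ident lob_const]
          bounded_linear_imp_has_derivative[OF bounded_linear_inner_left]])
      fix t d assume t: "a < t" "t < b" and d: "(s has_vector_derivative d) (at t)"
        and vi: "\<And>z. z \<in> S \<Longrightarrow> (f (s t) - d) \<bullet> (z - s t) \<le> 0"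
      have "- d \<in> tangent_cone S (s t)"
        by (rule vector_derivative_tangent(2)[OF d]) (use t ab in_S in auto)
      then have "(f (s t) - d) \<bullet> (- d) \<le> 0" using tangent_cone_inner_le[of "- d" S "s t" "f (s t) - d"] vi by blast
      then have "norm d * norm d \<le> f (s t) \<bullet> d"
        by (simp add: inner_diff_left power2_norm_eq_inner[symmetric] power2_eq_square)
      also have "\<dots> \<le> norm (f (s t)) * norm d" by (rule norm_cauchy_schwarz)
      finally have "norm d \<le> norm (f (s t))" by (metis mult_right_le_imp_le norm_ge_zero norm_zero order_le_less)
      also have "\<dots> \<le> B" using B bnd[of t] t ab by simp
      finally have "norm d * norm ?w \<le> (\<bar>B\<bar> + 1) * norm ?w" by (intro mult_right_mono) auto
      then show "d \<bullet> ?w \<le> (\<bar>B\<bar> + 1) * norm ?w" using norm_cauchy_schwarz[of d ?w] by linarith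
    qed
    then have "norm ?w * norm ?w \<le> ((\<bar>B\<bar> + 1) * (b - a)) * norm ?w"
      by (simp add: inner_diff_left[symmetric] power2_norm_eq_inner[symmetric] power2_eq_square mult_ac)
    then show ?thesis using False by simp
  qed (use ab in simp)
  then show ?thesis by (intro exI[of _ "\<bar>B\<bar> + 1"]) auto
qed

lemma limit_point_exists:
  assumes \<tau>: "\<And>n::nat. \<tau> n \<ge> real n"
  obtains p r where "limit_point p" "strict_mono (r::nat\<Rightarrow>nat)" "(\<lambda>n. s (\<tau> (r n))) \<longlonglongrightarrow> p"
proof -
  have \<tau>0: "\<tau> n \<ge> 0" for n using \<tau>[of n] by linarith
  have "\<forall>n. s (\<tau> n) \<in> cball 0 R" using bnd[OF \<tau>0] by (simp add: less_imp_le)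
  then obtain p r where pr: "strict_mono (r::nat\<Rightarrow>nat)" "((\<lambda>n. s (\<tau> n)) \<circ> r) \<longlonglongrightarrow> p"
    using compact_cball[of 0 R] unfolding compact_def by meson
  have "filterlim \<tau> at_top sequentially"
    by (rule filterlim_at_top_mono[OF filterlim_real_sequentially]) (use \<tau> in auto)
  then have "filterlim (\<lambda>n. \<tau> (r n)) at_top sequentially"
    by (rule filterlim_compose) (use pr(1) in \<open>rule filterlim_subseq\<close>)
  then have "limit_point p" unfolding limit_point_def
    using pr(2) \<tau>0 by (intro exI[of _ "\<lambda>n. \<tau> (r n)"]) (simp add: o_def)
  then show thesis using that pr by (simp add: o_def)
qed

text \<open>Times at which \<open>h\<close> stays away from \<open>c\<close> would, by compactness,
  accumulate at a limit point with \<open>h p \<noteq> c\<close>.\<close>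

lemma tendsto_of_limit_points:
  fixes h :: "'a \<Rightarrow> 'b::metric_space"
  assumes h: "continuous_on UNIV h" and c: "\<And>p. limit_point p \<Longrightarrow> h p = c"
  shows "((\<lambda>t. h (s t)) \<longlongrightarrow> c) at_top"
proof (rule ccontr)
  assume "\<not> ?thesis"
  then obtain e where e: "e > 0" "\<not> (\<forall>\<^sub>F t in at_top. dist (h (s t)) c < e)"
    unfolding tendsto_iff by blast
  then have "\<exists>t\<ge>real n. \<not> dist (h (s t)) c < e" for n :: nat
    unfolding eventually_at_top_linorder by blast
  then obtain \<tau> where \<tau>: "\<And>n::nat. \<tau> n \<ge> real n" "\<And>n. \<not> dist (h (s (\<tau> n))) c < e" by metis
  obtain p r where p: "limit_point p" "(\<lambda>n. s (\<tau> (r n))) \<longlonglongrightarrow> p"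
    using limit_point_exists[OF \<tau>(1)] by metis
  have "isCont h p" using h by (simp add: continuous_on_eq_continuous_at)
  then have "(\<lambda>n. h (s (\<tau> (r n)))) \<longlonglongrightarrow> h p" using p(2) by (rule isCont_tendsto_compose)
  then have "(\<lambda>n. dist (h (s (\<tau> (r n)))) c) \<longlonglongrightarrow> dist (h p) c" by (intro tendsto_intros)
  then have "dist (h p) c \<ge> e"
    by (rule tendsto_lowerbound) (use \<tau>(2) in \<open>auto simp: not_less\<close>)
  then show False using c[OF p(1)] e(1) by simp
qed

text \<open>A LaSalle-type principle: if \<open>U\<close> converges along the solution and decreases at least at rate
  \<open>W\<close>, then \<open>W\<close> cannot be positive near a limit point, since the solution is Lipschitz in time and
  stays near that point on windows of fixed length.\<close>

lemma limit_point_rate: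
  fixes U W :: "'a \<Rightarrow> real"
  assumes p: "limit_point p" and lob: "lipschitz_on_bounded U" and dU: "\<And>x. (U has_derivative U' x) (at x)"
    and W: "continuous_on UNIV W" and U: "((\<lambda>t. U (s t)) \<longlongrightarrow> l) at_top"
    and rate: "\<And>t d. t > 0 \<Longrightarrow> (\<And>z. z \<in> S \<Longrightarrow> (f (s t) - d) \<bullet> (z - s t) \<le> 0) \<Longrightarrow> U' (s t) d \<le> - W (s t)"
  shows "W p \<le> 0"
proof (rule ccontr)
  assume "\<not> W p \<le> 0"
  then have w: "W p / 2 > 0" by simp
  obtain \<tau> where \<tau>: "filterlim \<tau> at_top sequentially" "\<And>n. \<tau> n \<ge> 0" "(\<lambda>n. s (\<tau> n)) \<longlonglongrightarrow> p"
    using p by (auto simp: limit_point_def)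
  have "isCont W p" using W by (simp add: continuous_on_eq_continuous_at)
  then obtain r where r: "r > 0" "\<And>x. dist x p < r \<Longrightarrow> dist (W x) (W p) < W p / 2"
    using w unfolding continuous_at_eps_delta by (metis dist_commute)
  have Wr: "W x \<ge> W p / 2" if "dist x p < r" for x
    using r(2)[OF that] unfolding dist_real_def by linarith
  obtain C where C: "C > 0" "\<And>a b. 0 \<le> a \<Longrightarrow> a \<le> b \<Longrightarrow> norm (s b - s a) \<le> C * (b - a)"
    using lipschitz_in_time by blast
  \<comment> \<open>In time \<open>\<delta>\<close> the solution moves at most \<open>r / 2\<close>;
    a window that starts within \<open>r / 2\<close> of \<open>p\<close> stays where
    \<open>W\<close> is at least half of \<open>W p\<close>.\<close>
  define \<delta> where "\<delta> = r / (2 * C)"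
  have \<delta>: "\<delta> > 0" "C * \<delta> = r / 2" using r C by (auto simp: \<delta>_def)
  have step: "U (s (\<tau> n + \<delta>)) - U (s (\<tau> n)) \<le> - (W p / 2) * \<delta>" if n: "dist (s (\<tau> n)) p < r / 2" for n
  proof -
    have "U (s (\<tau> n + \<delta>)) - U (s (\<tau> n)) \<le> (- (W p / 2)) * (\<tau> n + \<delta> - \<tau> n)"
    proof (rule vi_rate[OF sol _ _ order_refl lob dU])
      fix t d assume t: "\<tau> n < t" "t < \<tau> n + \<delta>" and vi: "\<And>z. z \<in> S \<Longrightarrow> (f (s t) - d) \<bullet> (z - s t) \<le> 0"
      have "norm (s t - s (\<tau> n)) \<le> C * (t - \<tau> n)" using C(2) \<tau>(2) t by simp
      also have "\<dots> \<le> C * \<delta>" using t C by (intro mult_left_mono) auto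
      finally have "dist (s t) p < r" using n \<delta>(2) dist_triangle[of "s t" p "s (\<tau> n)"] by (simp add: dist_norm)
      then show "U' (s t) d \<le> - (W p / 2)" using rate[OF _ vi] Wr \<tau>(2)[of n] t by force
    qed (use \<tau>(2)[of n] \<delta> in auto)
    then show ?thesis by simp
  qed
  have "\<forall>\<^sub>F n in sequentially. dist (s (\<tau> n)) p < r / 2" using \<tau>(3) r(1) by (intro tendstoD) auto
  then have ev: "\<forall>\<^sub>F n in sequentially. U (s (\<tau> n + \<delta>)) - U (s (\<tau> n)) \<le> - (W p / 2) * \<delta>"
    by (rule eventually_mono) (rule step)
  have "filterlim (\<lambda>n. \<tau> n + \<delta>) at_top sequentially"
    by (rule filterlim_at_top_mono[OF \<tau>(1)]) (use \<delta> in auto)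
  then have "(\<lambda>n. U (s (\<tau> n + \<delta>)) - U (s (\<tau> n))) \<longlonglongrightarrow> l - l"
    by (intro tendsto_diff filterlim_compose[OF U] \<tau>(1))
  then have "l - l \<le> - (W p / 2) * \<delta>" using ev by (rule tendsto_upperbound) simp
  then show False using w \<delta>(1) by (simp add: mult_le_0_iff)
qed

end

section \<open>The primal-dual dynamics\<close>

lemma C2_map_C1_map:
  fixes f :: "'a::euclidean_space \<Rightarrow> 'b::real_normed_vector"
  shows "C2_map f \<Longrightarrow> C1_map f"
  unfolding C2_map_def[of f] C1_map_def[of f]
  using C1_map_lipschitz_on_bounded lob_continuous by blast

lemma linear_lob: "linear h \<Longrightarrow> lipschitz_on_bounded f \<Longrightarrow> lipschitz_on_bounded (\<lambda>x. h (f x))"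
  for h :: "'a::euclidean_space \<Rightarrow> 'b::real_normed_vector"
  by (rule lob_linear) (simp add: linear_conv_bounded_linear)

lemma linear_agg_transpose: "linear (agg_transpose G)"
  by (rule linearI) (simp_all add: agg_transpose_def col_def vec_eq_iff matrix_vector_right_distrib
      matrix_vector_mult_scaleR del: transpose_matrix_vector)

abbreviation px :: "('i, 'n::finite, 'p::finite, 'm::finite) state \<Rightarrow> real^'n" where "px s \<equiv> fst s"
abbreviation pt :: "('i, 'n::finite, 'p::finite, 'm::finite) state \<Rightarrow> real^'p^'i" where "pt s \<equiv> fst (snd s)"
abbreviation pk :: "('i, 'n::finite, 'p::finite, 'm::finite) state \<Rightarrow> real^'i" where "pk s \<equiv> fst (snd (snd s))"
abbreviation pz :: "('i, 'n::finite, 'p::finite, 'm::finite) state \<Rightarrow> real^'m^'i" where "pz s \<equiv> fst (snd (snd (snd s)))"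
abbreviation pn :: "('i, 'n::finite, 'p::finite, 'm::finite) state \<Rightarrow> real^'m^'i" where "pn s \<equiv> snd (snd (snd (snd s)))"

context agg_setting
begin

definition sg :: "('i, 'n, 'p, 'm) state \<Rightarrow> real^'p^'i" where "sg s = agg_stack G (px s) + pt s"
definition rh :: "('i, 'n, 'p, 'm) state \<Rightarrow> real^'p^'i" where "rh s = lap E (sg s)"
definition kr :: "('i, 'n, 'p, 'm) state \<Rightarrow> real^'p^'i" where "kr s = block_scale (pk s) (rh s)"

definition fx :: "('i, 'n, 'p, 'm) state \<Rightarrow> real^'n" where
  "fx s = - ext_pseudo_gradient G (px s) (sg s) - constr_jac_transpose G (px s) (pn s) - agg_transpose G (lap E (kr s))"
definition fn :: "('i, 'n, 'p, 'm) state \<Rightarrow> real^'m^'i" where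
  "fn s = constr_stack G (px s) - pz s - lap E (pn s)"

text \<open>The dynamics before projection.\<close>

definition fld :: "('i, 'n, 'p, 'm) state \<Rightarrow> ('i, 'n, 'p, 'm) state" where
  "fld s = (fx s, - lap E (kr s), D_transpose (rh s) (block_scale \<gamma> (rh s)), lap E (pn s), fn s)"

text \<open>Only the constraints that are enforced by projection. Without \<open>E_perp\<close>
  three factors are free, and there the variational inequality becomes an equation; zero averages
  are recovered as conserved quantities in \<open>vi_E_perp\<close>.\<close>

definition SS :: "('i, 'n, 'p, 'm) state set" where
  "SS = Omega G \<times> UNIV \<times> UNIV \<times> UNIV \<times> {l. 0 \<le> l}"

lemma dynamics_eq: "dynamics G E \<gamma> s = (proj_dyn (Omega G) (px s) (fx s), - lap E (kr s),
    D_transpose (rh s) (block_scale \<gamma> (rh s)), lap E (pn s), proj_dyn {l. 0 \<le> l} (pn s) (fn s))"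
  by (cases s) (simp add: dynamics_def fx_def fn_def kr_def rh_def sg_def Let_def)

lemma lob_sg: "lipschitz_on_bounded sg"
  unfolding sg_def[abs_def] agg_stack_eq[of G "px _"]
  by (intro lob_intros linear_lob[OF linear_agg_lin])

lemma lob_rh: "lipschitz_on_bounded rh"
  unfolding rh_def[abs_def] by (rule linear_lob[OF linear_kron_id lob_sg])

lemma lob_kr: "lipschitz_on_bounded kr"
  unfolding kr_def[abs_def] block_scale_def by (intro lob_intros lob_rh)

lemma lob_gi: "lipschitz_on_bounded (gi i)"
  by (rule C1_map_lipschitz_on_bounded[OF C2_map_C1_map[OF constr_C2]])

lemma lob_fn: "lipschitz_on_bounded fn"
  unfolding fn_def[abs_def] constr_stack_def
  by (intro lob_intros linear_lob[OF linear_kron_id] lob_compose[OF _ lob_gi])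

text \<open>Second derivatives of the constraints enter here: the Jacobian itself must be Lipschitz
  on balls. Its entries are expressed through the bounded linear derivative because that is what
  \<open>C2_map\<close> provides.\<close>

lemma lob_constr_jac_transpose:
  "lipschitz_on_bounded (\<lambda>s :: ('i, 'n, 'p, 'm) state. constr_jac_transpose G (px s) (pn s))"
proof -
  have "\<exists>g' :: real^'n \<Rightarrow> ((real^'n) \<Rightarrow>\<^sub>L (real^'m)). (\<forall>x. (gi i has_derivative blinfun_apply (g' x)) (at x)) \<and> C1_map g'" for i
    using constr_C2[of i] unfolding C2_map_def .
  then obtain g' :: "'i \<Rightarrow> real^'n \<Rightarrow> ((real^'n) \<Rightarrow>\<^sub>L (real^'m))"
    where g': "\<And>i x. (gi i has_derivative blinfun_apply (g' i x)) (at x)" "\<And>i. C1_map (g' i)"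
    by metis
  have J: "J i x *v h = blinfun_apply (g' i x) h" for i x h
    using has_derivative_unique[OF gi_derivative g'(1)] by metis
  have eq: "constr_jac_transpose G x \<nu> = (\<chi> k. \<Sum>i\<in>UNIV. \<nu> $ i \<bullet> blinfun_apply (g' i x) (axis k 1))" for x \<nu>
  proof (rule vec_eq_iff[THEN iffD2], rule allI)
    fix k
    have "constr_jac_transpose G x \<nu> $ k = constr_jac_transpose G x \<nu> \<bullet> axis k 1" by (simp add: inner_axis)
    then show "constr_jac_transpose G x \<nu> $ k = (\<chi> k. \<Sum>i\<in>UNIV. \<nu> $ i \<bullet> blinfun_apply (g' i x) (axis k 1)) $ k"
      by (simp add: constr_jac_transpose_inner J)
  qed
  have "lipschitz_on_bounded (\<lambda>s :: ('i, 'n, 'p, 'm) state. blinfun_apply (g' i (px s)) (axis k 1))" for i k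
    by (rule lob_linear[OF blinfun.bounded_linear_left lob_compose[OF lob_fst[OF lob_ident] C1_map_lipschitz_on_bounded[OF g'(2)]]])
  then show ?thesis unfolding eq by (intro lob_intros)
qed

lemma lob_fx: "lipschitz_on_bounded fx"
proof -
  have "lipschitz_on_bounded (\<lambda>s. (\<lambda>(x, \<sigma>). ext_pseudo_gradient G x \<sigma>) (px s, sg s))"
    by (rule lob_compose[OF _ lob_lipschitz[OF ext_lipschitz]]) (intro lob_intros lob_sg)
  then have "lipschitz_on_bounded (\<lambda>s. ext_pseudo_gradient G (px s) (sg s))" by simp
  then show ?thesis unfolding fx_def[abs_def]
    by (intro lob_intros lob_constr_jac_transpose linear_lob[OF linear_agg_transpose] linear_lob[OF linear_kron_id] lob_kr)
qed

lemma lob_fld: "lipschitz_on_bounded fld"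
  unfolding fld_def[abs_def]
proof (intro lob_Pair lob_fx lob_fn)
  show "lipschitz_on_bounded (\<lambda>s. - lap E (kr s))"
    by (intro lob_intros linear_lob[OF linear_kron_id] lob_kr)
  show "lipschitz_on_bounded (\<lambda>s. D_transpose (rh s) (block_scale \<gamma> (rh s)))"
    unfolding D_transpose_def block_scale_def by (simp, intro lob_intros lob_rh)
  show "lipschitz_on_bounded (\<lambda>s :: ('i, 'n, 'p, 'm) state. lap E (pn s))"
    by (intro lob_intros linear_lob[OF linear_kron_id])
qed

lemma convex_closed_SS: "convex SS" "closed SS"
  unfolding SS_def
  by (intro convex_Times closed_Times convex_closed_Omega orthant_convex_closed convex_UNIV closed_UNIV)+

lemma state_set_SS: "s \<in> state_set G \<longleftrightarrow> s \<in> SS \<and> pt s \<in> E_perp \<and> pz s \<in> E_perp"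
  by (cases s) (auto simp: state_set_def SS_def)

lemma vi_components:
  assumes s: "s \<in> SS" and vi: "\<And>y. y \<in> SS \<Longrightarrow> (fld s - d) \<bullet> (y - s) \<le> 0"
  shows "x \<in> Omega G \<Longrightarrow> (fx s - px d) \<bullet> (x - px s) \<le> 0"
    and "pt d = - lap E (kr s)" "pk d = D_transpose (rh s) (block_scale \<gamma> (rh s))" "pz d = lap E (pn s)"
    and "0 \<le> n \<Longrightarrow> (fn s - pn d) \<bullet> (n - pn s) \<le> 0"
proof -
  show "(fx s - px d) \<bullet> (x - px s) \<le> 0" if "x \<in> Omega G"
    using vi[of "(x, snd s)"] s that by (cases s) (auto simp: SS_def fld_def inner_prod_def)
  show "(fn s - pn d) \<bullet> (n - pn s) \<le> 0" if "0 \<le> n"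
    using vi[of "(px s, pt s, pk s, pz s, n)"] s that by (cases s) (auto simp: SS_def fld_def inner_prod_def)
  \<comment> \<open>Moving the free components by their own residual stays in \<open>SS\<close>, so
    the sum of the squared residuals is nonpositive.\<close>
  let ?e = "fld s - d"
  have "?e \<bullet> ((px s, pt s + pt ?e, pk s + pk ?e, pz s + pz ?e, pn s) - s) \<le> 0"
    by (rule vi) (use s in \<open>cases s, auto simp: SS_def\<close>)
  then have "pt ?e \<bullet> pt ?e + pk ?e \<bullet> pk ?e + pz ?e \<bullet> pz ?e \<le> 0"
    by (cases s) (simp add: inner_prod_def)
  then have "pt ?e = 0" "pk ?e = 0" "pz ?e = 0"
    using inner_ge_zero[of "pt ?e"] inner_ge_zero[of "pk ?e"] inner_ge_zero[of "pz ?e"]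
      inner_eq_zero_iff[of "pt ?e"] inner_eq_zero_iff[of "pk ?e"] inner_eq_zero_iff[of "pz ?e"] by linarith+
  then show "pt d = - lap E (kr s)" "pk d = D_transpose (rh s) (block_scale \<gamma> (rh s))" "pz d = lap E (pn s)"
    by (simp_all add: fld_def)
qed

lemma caratheodory_invariant:
  assumes sol: "caratheodory_solution (dynamics G E \<gamma>) s0 s" and s0: "s0 \<in> SS" and t: "t \<ge> 0"
  shows "s t \<in> SS"
proof -
  have s0': "px s0 \<in> Omega G" "pn s0 \<in> {l. 0 \<le> l}" using s0 by (auto simp: SS_def)
  have "px (s t) \<in> Omega G"
  proof (rule caratheodory_component_invariant[OF sol bounded_linear_fst convex_closed_Omega s0'(1) _ t])
    show "px (dynamics G E \<gamma> x) \<in> tangent_cone (Omega G) (px x)" for x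
      using s0' unfolding dynamics_eq by (auto intro!: proj_dyn_in_tangent_cone)
  qed
  moreover have "pn (s t) \<in> {l. 0 \<le> l}"
  proof (rule caratheodory_component_invariant[where P = "\<lambda>s. pn s", OF sol _ orthant_convex_closed(3,4) s0'(2) _ t])
    show "bounded_linear (\<lambda>s :: ('i, 'n, 'p, 'm) state. pn s)"
      by (intro bounded_linear_compose[OF bounded_linear_snd] bounded_linear_ident)
    show "pn (dynamics G E \<gamma> x) \<in> tangent_cone {l. 0 \<le> l} (pn x)" for x
      using s0' unfolding dynamics_eq by (auto intro!: proj_dyn_in_tangent_cone)
  qed
  ultimately show ?thesis by (simp add: SS_def mem_Times_iff)
qed

lemma caratheodory_vi:
  assumes sol: "caratheodory_solution (dynamics G E \<gamma>) s0 s" and s0: "s0 \<in> SS" and T: "T \<ge> 0"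
  shows "vi_solution SS fld T s"
  unfolding vi_solution_def
proof (intro conjI ballI)
  show "abs_continuous_on_interval 0 T s"
  proof (rule ac_subinterval)
    show "abs_continuous_on_interval 0 (T + 1) s" using sol T by (auto simp: caratheodory_solution_def)
  qed auto
  show "s t \<in> SS" if "t \<in> {0..T}" for t using caratheodory_invariant[OF sol s0] that by auto
  have "AE t in lborel. 0 \<le> t \<longrightarrow> (s has_vector_derivative dynamics G E \<gamma> (s t)) (at t)"
    using sol unfolding caratheodory_solution_def by blast
  then show "AE t in lborel. 0 < t \<and> t < T \<longrightarrow>
        (\<exists>d. (s has_vector_derivative d) (at t) \<and> vi_velocity SS fld (s t) d)"
  proof eventually_elim
    case (elim t)
    show ?case
    proof
      assume t: "0 < t \<and> t < T"
      then have st: "s t \<in> SS" using caratheodory_invariant[OF sol s0] by simp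
      have "(fld (s t) - dynamics G E \<gamma> (s t)) \<bullet> (z - s t) \<le> 0" if z: "z \<in> SS" for z
      proof -
        have "(fx (s t) - proj_dyn (Omega G) (px (s t)) (fx (s t))) \<bullet> (px z - px (s t)) \<le> 0"
          by (rule proj_dyn_vi[OF convex_closed_Omega(1)]) (use st z in \<open>auto simp: SS_def\<close>)
        moreover have "(fn (s t) - proj_dyn {l. 0 \<le> l} (pn (s t)) (fn (s t))) \<bullet> (pn z - pn (s t)) \<le> 0"
          by (rule proj_dyn_vi[OF orthant_convex_closed(3)]) (use st z in \<open>auto simp: SS_def\<close>)
        ultimately show ?thesis by (simp add: fld_def dynamics_eq inner_prod_def)
      qed
      then show "\<exists>d. (s has_vector_derivative d) (at t) \<and> vi_velocity SS fld (s t) d"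
        using elim t by (intro exI[of _ "dynamics G E \<gamma> (s t)"]) simp
    qed
  qed
qed

text \<open>At a positive time the curve lies in \<open>SS\<close> on both sides, so its velocity is
  reversible and must be the projection of the field. Countably many integer horizons cover all
  times.\<close>

lemma vi_caratheodory:
  assumes sol: "\<And>T. T \<ge> 0 \<Longrightarrow> vi_solution SS fld T s"
  shows "caratheodory_solution (dynamics G E \<gamma>) (s 0) s"
  unfolding caratheodory_solution_def
proof (intro conjI allI impI refl)
  show "abs_continuous_on_interval 0 T s" if "T > 0" for T using sol[of T] that by (auto simp: vi_solution_def)
  have S: "s t \<in> SS" if "t \<ge> 0" for t using sol[OF that] that by (auto simp: vi_solution_def)
  have "AE t in lborel. \<forall>n::nat. 0 < t \<and> t < real n \<longrightarrow>
        (\<exists>d. (s has_vector_derivative d) (at t) \<and> vi_velocity SS fld (s t) d)"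
    unfolding AE_all_countable using sol unfolding vi_solution_def by simp
  \<comment> \<open>Time 0 is discarded: a two-sided derivative there would involve negative
    times.\<close>
  moreover have "AE t in lborel. t \<noteq> (0::real)" by (rule AE_lborel_singleton)
  ultimately show "AE t in lborel. 0 \<le> t \<longrightarrow> (s has_vector_derivative dynamics G E \<gamma> (s t)) (at t)"
  proof eventually_elim
    case (elim t)
    show ?case
    proof
      assume "0 \<le> t"
      then have t: "t > 0" using elim by simp
      obtain n where "t < real n" using reals_Archimedean2 by blast
      then obtain d where d: "(s has_vector_derivative d) (at t)" "\<And>z. z \<in> SS \<Longrightarrow> (fld (s t) - d) \<bullet> (z - s t) \<le> 0"
        using elim t by blast
      have st: "s t \<in> SS" using S t by simp
      note c = vi_components[OF st d(2)]
      have "proj_dyn (Omega G) (px (s t)) (fx (s t)) = px d"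
      proof (rule vector_derivative_eq_proj_dyn[OF convex_closed_Omega(1) _ t])
        show "((\<lambda>t. px (s t)) has_vector_derivative px d) (at t)"
          by (rule bounded_linear.has_vector_derivative[OF bounded_linear_fst d(1)])
      qed (use S c(1) in \<open>simp_all add: SS_def mem_Times_iff\<close>)
      moreover have "proj_dyn {l. 0 \<le> l} (pn (s t)) (fn (s t)) = pn d"
      proof (rule vector_derivative_eq_proj_dyn[OF orthant_convex_closed(3) _ t])
        have bl: "bounded_linear (\<lambda>s :: ('i, 'n, 'p, 'm) state. pn s)"
          by (intro bounded_linear_compose[OF bounded_linear_snd] bounded_linear_ident)
        show "((\<lambda>t. pn (s t)) has_vector_derivative pn d) (at t)"
          by (rule bounded_linear.has_vector_derivative[OF bl d(1)])
      qed (use S c(5) in \<open>simp_all add: SS_def mem_Times_iff\<close>)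
      ultimately have "dynamics G E \<gamma> (s t) = d"
        unfolding dynamics_eq using c(2-4) by (simp add: prod_eq_iff)
      then show "(s has_vector_derivative dynamics G E \<gamma> (s t)) (at t)" using d(1) by simp
    qed
  qed
qed

text \<open>Both velocities lie in the range of the Laplacian, so the averages are conserved. They
  are tested against a fixed \<open>v\<close>, and constancy comes from the zero rates of
  \<open>U\<close> and \<open>- U\<close>.\<close>

lemma vi_E_perp:
  assumes sol: "vi_solution SS fld T s" and s0: "s 0 \<in> state_set G" and t: "0 \<le> t" "t \<le> T"
  shows "s t \<in> state_set G"
proof -
  have S: "\<And>u. 0 \<le> u \<Longrightarrow> u \<le> T \<Longrightarrow> s u \<in> SS" using sol by (auto simp: vi_solution_def)
  have zero: "U (s t) = U (s 0)" if U: "linear U" and U0: "\<And>u d. 0 < u \<Longrightarrow> u < T \<Longrightarrow>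
      (\<And>y. y \<in> SS \<Longrightarrow> (fld (s u) - d) \<bullet> (y - s u) \<le> 0) \<Longrightarrow> U d = 0"
    for U :: "('i, 'n, 'p, 'm) state \<Rightarrow> real"
  proof -
    have "lipschitz_on_bounded U" using linear_lob[OF U lob_ident] .
    note 1 = vi_rate[OF sol order_refl t this linear_imp_has_derivative[OF U], of 0]
    have mU: "linear (\<lambda>x. - U x)" using U by (rule linear_compose_neg)
    have "lipschitz_on_bounded (\<lambda>x. - U x)" using linear_lob[OF mU lob_ident] .
    note 2 = vi_rate[OF sol order_refl t this linear_imp_has_derivative[OF mU], of 0]
    have "U (s t) - U (s 0) \<le> 0" using 1 U0 t by force
    moreover have "- U (s t) - - U (s 0) \<le> 0" using 2 U0 t by force
    ultimately show ?thesis by simp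
  qed
  have "avg (pt (s t)) \<bullet> v = 0" for v
  proof -
    have "avg (pt (s t)) \<bullet> v = avg (pt (s 0)) \<bullet> v"
    proof (rule zero)
      show "linear (\<lambda>s :: ('i, 'n, 'p, 'm) state. avg (pt s) \<bullet> v)"
        by (rule linearI) (simp_all add: linear_add[OF linear_avg] linear_scale[OF linear_avg] inner_add_left)
      fix u d assume u: "0 < u" "u < T" and vi: "\<And>y. y \<in> SS \<Longrightarrow> (fld (s u) - d) \<bullet> (y - s u) \<le> 0"
      have "pt d = - lap E (kr (s u))" by (rule vi_components(2)[OF S vi]) (use u in auto)
      then show "avg (pt d) \<bullet> v = 0"
        using lap_in_E_perp[OF sym_graph, of "kr (s u)"] by (simp add: linear_neg[OF linear_avg] avg_E_perp[symmetric])
    qed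
    also have "\<dots> = 0" using s0 avg_E_perp[of "pt (s 0)"] by (simp add: state_set_SS)
    finally show ?thesis .
  qed
  then have 1: "avg (pt (s t)) = 0" using inner_eq_zero_iff by blast
  have "avg (pz (s t)) \<bullet> v = 0" for v
  proof -
    have "avg (pz (s t)) \<bullet> v = avg (pz (s 0)) \<bullet> v"
    proof (rule zero)
      show "linear (\<lambda>s :: ('i, 'n, 'p, 'm) state. avg (pz s) \<bullet> v)"
        by (rule linearI) (simp_all add: linear_add[OF linear_avg] linear_scale[OF linear_avg] inner_add_left)
      fix u d assume u: "0 < u" "u < T" and vi: "\<And>y. y \<in> SS \<Longrightarrow> (fld (s u) - d) \<bullet> (y - s u) \<le> 0"
      have "pz d = lap E (pn (s u))" by (rule vi_components(4)[OF S vi]) (use u in auto)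
      then show "avg (pz d) \<bullet> v = 0"
        using lap_in_E_perp[OF sym_graph, of "pn (s u)"] by (simp add: avg_E_perp[symmetric])
    qed
    also have "\<dots> = 0" using s0 avg_E_perp[of "pz (s 0)"] by (simp add: state_set_SS)
    finally show ?thesis .
  qed
  then have "avg (pz (s t)) = 0" using inner_eq_zero_iff by blast
  then show ?thesis using 1 S t by (simp add: state_set_SS avg_E_perp)
qed

end

section \<open>Lyapunov function and convergence\<close>

lemma norm_proj_le: "norm (fst z) \<le> norm z" "norm (snd z) \<le> norm z"
  by (metis prod.collapse norm_fst_le, metis prod.collapse norm_snd_le)

context agg_setting
begin

text \<open>A KKT point with a splitting \<open>zb\<close> of the coupling constraint for which
  complementarity holds agent by agent, as an equilibrium of the dual dynamics requires.\<close>

definition crit :: "real^'n \<Rightarrow> real^'m \<Rightarrow> real^'m^'i \<Rightarrow> bool" where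
  "crit x l zb \<longleftrightarrow> KKT_vi x l \<and> zb \<in> E_perp \<and> (\<forall>i. gi i x - zb $ i \<le> 0 \<and> l \<bullet> (gi i x - zb $ i) = 0)"

text \<open>Dissipation rate of the Lyapunov function. For a critical \<open>x\<close>,
  \<open>zb\<close> and states in \<open>state_set\<close> all four terms are nonnegative; their
  vanishing means, in turn, the primal solution, exact estimates, dual consensus and
  complementarity.\<close>

definition W :: "real^'n \<Rightarrow> real^'m^'i \<Rightarrow> ('i, 'n, 'p, 'm) state \<Rightarrow> real" where
  "W x zb s = \<mu> / 2 * (norm (px s - x))\<^sup>2 + (norm (sg s - replicated (aggregate G (px s))))\<^sup>2
     + pn s \<bullet> lap E (pn s) - (\<Sum>i\<in>UNIV. pn s $ i \<bullet> (gi i x - zb $ i))"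

context
  fixes M :: "real^'m^'i \<Rightarrow> real^'m^'i" and cM c :: real
  assumes M: "linear M" "\<And>x y. x \<bullet> M y = M x \<bullet> y" "\<And>y. M (lap E y) = y - replicated (avg y)"
    and cM: "cM > 0" "\<And>z. z \<bullet> M z \<ge> cM * (norm z)\<^sup>2"
    and c: "c > 0" "\<And>y :: real^'p^'i. y \<in> E_perp \<Longrightarrow> c * norm y \<le> norm (lap E y)"
begin

text \<open>The gains enter the Lyapunov function through their distance to a level \<open>kst\<close> large enough to
  dominate the disagreement of the local estimates of the aggregate. The variable \<open>z\<close> is weighted by an
  inverse \<open>M\<close> of the Laplacian on \<open>E_perp\<close>, so that its derivative \<open>lap E \<nu>\<close> contributes \<open>(z - zb) \<bullet> \<nu>\<close>
  and cancels the cross term of the dual dynamics.\<close>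

definition kst :: real where "kst = (\<theta>\<^sup>2 / (2 * \<mu>) + 1) / c\<^sup>2"

text \<open>Metric of the Lyapunov function. Dividing by \<open>\<gamma>\<close> removes the
  adaptation rates from the gain dynamics; the constrained blocks keep the identity, on which
  \<open>V_rate\<close> relies.\<close>

definition Q :: "('i, 'n, 'p, 'm) state \<Rightarrow> ('i, 'n, 'p, 'm) state" where
  "Q s = (px s, pt s, (\<chi> i. pk s $ i / \<gamma> $ i), M (pz s), pn s)"

text \<open>The offset makes every local estimate equal to the true aggregate. The gain
  \<open>kst\<close> is artificial: the actual gains need not tend to it.\<close>

definition center :: "real^'n \<Rightarrow> real^'m \<Rightarrow> real^'m^'i \<Rightarrow> ('i, 'n, 'p, 'm) state" where
  "center x l zb = (x, replicated (aggregate G x) - agg_stack G x, (\<chi> i. kst), zb, replicated l)"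

definition V :: "('i, 'n, 'p, 'm) state \<Rightarrow> ('i, 'n, 'p, 'm) state \<Rightarrow> real" where
  "V a s = (s - a) \<bullet> Q (s - a) / 2"

lemma linear_Q: "linear Q"
  by (rule linearI) (simp_all add: Q_def linear_add[OF M(1)] linear_scale[OF M(1)] vec_eq_iff add_divide_distrib)

lemma Q_adjoint: "s \<bullet> Q r = Q s \<bullet> r"
  by (simp add: Q_def inner_prod_def M(2) inner_vec_def[of "pk s"] inner_vec_def[of "\<chi> i. pk s $ i / \<gamma> $ i"])

lemma Q_pos: assumes "s \<noteq> 0" shows "s \<bullet> Q s > 0"
proof -
  have eq: "s \<bullet> Q s = px s \<bullet> px s + pt s \<bullet> pt s + (\<Sum>i\<in>UNIV. (pk s $ i)\<^sup>2 / \<gamma> $ i) + pz s \<bullet> M (pz s) + pn s \<bullet> pn s"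
    by (simp add: Q_def inner_prod_def inner_vec_def[of "pk s"] power2_eq_square)
  have nnz: "pz s \<bullet> M (pz s) \<ge> 0" using cM(2)[of "pz s"] cM(1) by (smt (verit) mult_nonneg_nonneg zero_le_power2)
  have nnk: "(\<Sum>i\<in>UNIV. (pk s $ i)\<^sup>2 / \<gamma> $ i) \<ge> 0" by (intro sum_nonneg divide_nonneg_pos zero_le_power2 gamma_pos)
  have "s \<bullet> Q s \<noteq> 0"
  proof
    assume 0: "s \<bullet> Q s = 0"
    then have z: "px s \<bullet> px s = 0" "pt s \<bullet> pt s = 0" "(\<Sum>i\<in>UNIV. (pk s $ i)\<^sup>2 / \<gamma> $ i) = 0"
      "pz s \<bullet> M (pz s) = 0" "pn s \<bullet> pn s = 0"
      using eq nnz nnk inner_ge_zero[of "px s"] inner_ge_zero[of "pt s"] inner_ge_zero[of "pn s"] by linarith+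
    have "\<forall>i\<in>UNIV. (pk s $ i)\<^sup>2 / \<gamma> $ i = 0"
      using z(3) gamma_pos by (subst (asm) sum_nonneg_eq_0_iff) (auto intro: divide_nonneg_pos)
    then have "pk s = 0" using gamma_pos by (simp add: vec_eq_iff) (metis less_irrefl)
    moreover have "cM * (norm (pz s))\<^sup>2 \<le> 0" using cM(2)[of "pz s"] z(4) by simp
    then have "pz s = 0" using cM(1) by (simp add: mult_le_0_iff)
    ultimately have "s = 0" using z by (simp add: prod_eq_iff)
    then show False using assms by simp
  qed
  moreover have "s \<bullet> Q s \<ge> 0" using eq nnz nnk inner_ge_zero[of "px s"] inner_ge_zero[of "pt s"] inner_ge_zero[of "pn s"] by linarith
  ultimately show ?thesis by linarith
qed

lemma V_derivative: "(V a has_derivative (\<lambda>h. Q (s - a) \<bullet> h)) (at s)"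
  unfolding V_def[abs_def] by (rule quadratic_has_derivative[OF linear_Q Q_adjoint])

lemma V_lob: "lipschitz_on_bounded (V a)"
  unfolding V_def[abs_def] by (rule quadratic_lob[OF linear_Q])

lemma V_coercive: "\<exists>cQ>0. \<forall>a s. cQ * (norm (s - a))\<^sup>2 \<le> V a s"
proof -
  obtain q where q: "q > 0" "\<And>z. z \<bullet> Q z \<ge> q * (norm z)\<^sup>2"
    using posdef_lower_bound[OF linear_Q Q_pos] by blast
  show ?thesis
  proof (intro exI[of _ "q / 2"] conjI allI)
    fix a s show "q / 2 * (norm (s - a))\<^sup>2 \<le> V a s" using q(2)[of "s - a"] by (simp add: V_def)
  qed (use q(1) in simp)
qed

lemma avg_sg: "s \<in> state_set G \<Longrightarrow> avg (sg s) = aggregate G (px s)"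
  using avg_E_perp[of "pt s"] by (simp add: sg_def linear_add[OF linear_avg] avg_agg_stack state_set_SS)

text \<open>The coupling through the gains cancels against the adaptation law and leaves the damping
  \<open>- kst * (norm (rh s))^2\<close>. Convexity absorbs the constraint terms, strong
  monotonicity gives decay in \<open>x\<close>, and the damping pays for the error in the estimates
  of the aggregate.\<close>

lemma V_decay:
  assumes cr: "crit x l zb" and s: "s \<in> state_set G"
  shows "Q (s - center x l zb) \<bullet> fld s \<le> - W x zb s"
proof -
  let ?u = "px s - x" and ?w = "sg s - replicated (aggregate G (px s))" and ?\<nu> = "pn s" and ?X = "px s"
  let ?kr = "kr s" and ?\<rho> = "rh s"
  have K: "KKT_vi x l" and zb: "zb \<in> E_perp" and comp: "\<And>i. l \<bullet> (gi i x - zb $ i) = 0"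
    using cr by (auto simp: crit_def)
  have sS: "?X \<in> Omega G" "0 \<le> ?\<nu>" and perp: "pt s \<in> E_perp" "pz s \<in> E_perp"
    using s by (auto simp: state_set_SS SS_def)
  define P1 P2 PJ R1 R2 RJ Y where "P1 = (\<Sum>i\<in>UNIV. ?\<nu> $ i \<bullet> gi i ?X)" and "P2 = (\<Sum>i\<in>UNIV. ?\<nu> $ i \<bullet> gi i x)"
    and "PJ = (\<Sum>i\<in>UNIV. ?\<nu> $ i \<bullet> (J i ?X *v ?u))" and "R1 = (\<Sum>i\<in>UNIV. l \<bullet> gi i ?X)"
    and "R2 = (\<Sum>i\<in>UNIV. l \<bullet> gi i x)" and "RJ = (\<Sum>i\<in>UNIV. l \<bullet> (J i x *v ?u))"
    and "Y = (\<Sum>i\<in>UNIV. ?\<nu> $ i \<bullet> (gi i x - zb $ i))"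
  have total: "Q (s - center x l zb) \<bullet> fld s = ?u \<bullet> fx s
      + (pt s - (replicated (aggregate G x) - agg_stack G x)) \<bullet> (- lap E ?kr)
      + (\<Sum>i\<in>UNIV. (pk s $ i - kst) / \<gamma> $ i * (?\<rho> $ i \<bullet> (\<gamma> $ i *\<^sub>R ?\<rho> $ i)))
      + M (pz s - zb) \<bullet> lap E ?\<nu> + (?\<nu> - replicated l) \<bullet> fn s"
    by (simp add: Q_def center_def fld_def inner_prod_def D_transpose_def block_scale_def
        inner_vec_def[of "\<chi> i. (pk s - (\<chi> i. kst)) $ i / \<gamma> $ i"] inner_vec_def[of "\<chi> i. (pk s $ i - kst) / \<gamma> $ i"])
  have A1: "?u \<bullet> fx s = - (?u \<bullet> ext_pseudo_gradient G ?X (sg s)) - PJ - lap E ?kr \<bullet> agg_lin G ?u"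
    using constr_jac_transpose_inner[of ?X ?\<nu> ?u] agg_transpose_inner[of G "lap E ?kr" ?u]
    by (simp add: fx_def inner_diff_right PJ_def inner_commute)
  \<comment> \<open>Primal and offset errors add up to the error of the local estimates, so the two
    gain terms combine into one inner product with \<open>lap E ?kr\<close>.\<close>
  have A2: "agg_lin G ?u + (pt s - (replicated (aggregate G x) - agg_stack G x)) = sg s - replicated (aggregate G x)"
    unfolding agg_stack_diff[symmetric] sg_def by simp
  have A3: "(sg s - replicated (aggregate G x)) \<bullet> lap E ?kr = (\<Sum>i\<in>UNIV. pk s $ i * (?\<rho> $ i \<bullet> ?\<rho> $ i))"
  proof -
    have "(sg s - replicated (aggregate G x)) \<bullet> lap E ?kr = ?\<rho> \<bullet> ?kr"
      by (simp add: lap_self_adjoint[OF sym_graph] linear_diff[OF linear_kron_id] lap_replicated rh_def)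
    then show ?thesis by (simp add: kr_def block_scale_def inner_vec_def[of ?\<rho>])
  qed
  \<comment> \<open>The first sum also appears in \<open>A3\<close> and enters there with the
    opposite sign; this cancellation is the purpose of the adaptation law.\<close>
  have A4: "(\<Sum>i\<in>UNIV. (pk s $ i - kst) / \<gamma> $ i * (?\<rho> $ i \<bullet> (\<gamma> $ i *\<^sub>R ?\<rho> $ i)))
      = (\<Sum>i\<in>UNIV. pk s $ i * (?\<rho> $ i \<bullet> ?\<rho> $ i)) - kst * (norm ?\<rho>)\<^sup>2"
  proof -
    have "(\<Sum>i\<in>UNIV. (pk s $ i - kst) / \<gamma> $ i * (?\<rho> $ i \<bullet> (\<gamma> $ i *\<^sub>R ?\<rho> $ i)))
      = (\<Sum>i\<in>UNIV. pk s $ i * (?\<rho> $ i \<bullet> ?\<rho> $ i) - kst * (?\<rho> $ i \<bullet> ?\<rho> $ i))"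
    proof (rule sum.cong[OF refl])
      fix i show "(pk s $ i - kst) / \<gamma> $ i * (?\<rho> $ i \<bullet> (\<gamma> $ i *\<^sub>R ?\<rho> $ i)) = pk s $ i * (?\<rho> $ i \<bullet> ?\<rho> $ i) - kst * (?\<rho> $ i \<bullet> ?\<rho> $ i)"
        using gamma_pos[of i] by (simp add: left_diff_distrib[symmetric])
    qed
    also have "\<dots> = (\<Sum>i\<in>UNIV. pk s $ i * (?\<rho> $ i \<bullet> ?\<rho> $ i)) - kst * (norm ?\<rho>)\<^sup>2"
      by (simp add: sum_subtractf sum_distrib_left power2_norm_eq_inner inner_vec_def[of ?\<rho>])
    finally show ?thesis .
  qed
  \<comment> \<open>\<open>M\<close> turns the velocity of \<open>z\<close> into the coupling term
    that \<open>A6\<close> contributes with the opposite sign; zero averages remove the consensus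
    part.\<close>
  have A5: "M (pz s - zb) \<bullet> lap E ?\<nu> = (pz s - zb) \<bullet> ?\<nu>" "(pz s - zb) \<bullet> replicated l = 0"
  proof -
    have z: "avg (pz s - zb) = 0"
      using perp zb by (simp add: linear_diff[OF linear_avg] avg_E_perp[THEN iffD2])
    have "M (pz s - zb) \<bullet> lap E ?\<nu> = (pz s - zb) \<bullet> (?\<nu> - replicated (avg ?\<nu>))"
      by (simp only: M(2)[symmetric] M(3))
    then show "M (pz s - zb) \<bullet> lap E ?\<nu> = (pz s - zb) \<bullet> ?\<nu>"
      using inner_replicated[of "pz s - zb" "avg ?\<nu>"] z by (simp add: inner_diff_right)
    show "(pz s - zb) \<bullet> replicated l = 0" using inner_replicated[of "pz s - zb" l] z by simp
  qed
  have A6: "(?\<nu> - replicated l) \<bullet> fn s = (P1 - P2) - (R1 - R2) + Y - (pz s - zb) \<bullet> ?\<nu> - ?\<nu> \<bullet> lap E ?\<nu>"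
  proof -
    have rl: "replicated l \<bullet> lap E ?\<nu> = 0"
      using lap_self_adjoint[OF sym_graph, of "replicated l" ?\<nu>] by (simp add: lap_replicated)
    have cs: "y \<bullet> constr_stack G v = (\<Sum>i\<in>UNIV. y $ i \<bullet> gi i v)" for y :: "real^'m^'i" and v
      by (simp add: inner_vec_def[of y] constr_stack_def)
    have rep: "replicated l $ i = l" for i :: 'i by (simp add: replicated_def)
    have Y': "Y = P2 - ?\<nu> \<bullet> zb"
      by (simp add: Y_def P2_def inner_vec_def[of ?\<nu> zb] inner_diff_right sum_subtractf)
    have "(\<Sum>i\<in>UNIV. l \<bullet> (gi i x - zb $ i)) = 0" using comp by simp
    then have R2': "R2 = replicated l \<bullet> zb"
      by (simp add: R2_def inner_vec_def[of "replicated l" zb] rep inner_diff_right sum_subtractf)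
    have "(?\<nu> - replicated l) \<bullet> fn s = (P1 - R1) - (?\<nu> \<bullet> pz s - replicated l \<bullet> pz s) - ?\<nu> \<bullet> lap E ?\<nu>"
      using rl by (simp add: fn_def inner_diff_left inner_diff_right cs rep P1_def R1_def sum_subtractf)
    moreover have "replicated l \<bullet> pz s = replicated l \<bullet> zb" using A5(2) by (simp add: inner_diff_left inner_diff_right inner_commute[of _ "replicated l"])
    ultimately show ?thesis
      using Y' R2' inner_diff_left[of "pz s" zb ?\<nu>] inner_commute[of ?\<nu> "pz s"] inner_commute[of ?\<nu> zb]
      by linarith
  qed
  \<comment> \<open>Convexity at the current point, weighted by the current duals; \<open>C2\<close>
    uses it at \<open>x\<close> with weight \<open>l\<close>. Together with \<open>C3\<close> they
    leave only \<open>Y\<close> of the constraint terms.\<close>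
  have C1: "P1 - PJ \<le> P2"
  proof -
    have "(\<Sum>i\<in>UNIV. ?\<nu> $ i \<bullet> (gi i ?X + J i ?X *v (x - ?X))) \<le> (\<Sum>i\<in>UNIV. ?\<nu> $ i \<bullet> gi i x)"
      using sS(2) by (intro sum_mono gi_convex) (auto simp: less_eq_vec_def)
    moreover have "J i ?X *v (x - ?X) = - (J i ?X *v ?u)" for i
      by (simp add: matrix_vector_mult_diff_distrib)
    ultimately show ?thesis by (simp add: P1_def PJ_def P2_def inner_diff_right sum_subtractf)
  qed
  have C2: "R2 + RJ \<le> R1"
  proof -
    have "(\<Sum>i\<in>UNIV. l \<bullet> (gi i x + J i x *v ?u)) \<le> (\<Sum>i\<in>UNIV. l \<bullet> gi i ?X)"
      using K by (intro sum_mono gi_convex) (auto simp: KKT_vi_def)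
    then show ?thesis by (simp add: R1_def RJ_def R2_def inner_add_right sum.distrib)
  qed
  have C3: "F x \<bullet> ?u + RJ \<ge> 0" using K sS(1) by (simp add: KKT_vi_def RJ_def)
  have C4: "(F ?X - F x) \<bullet> ?u \<ge> \<mu> * (norm ?u)\<^sup>2" by (rule strongly_monotone)
  have C5: "(ext_pseudo_gradient G ?X (sg s) - F ?X) \<bullet> ?u \<ge> - (\<theta> * norm ?w * norm ?u)"
  proof -
    have "\<bar>(ext_pseudo_gradient G ?X (sg s) - F ?X) \<bullet> ?u\<bar> \<le> norm (ext_pseudo_gradient G ?X (sg s) - F ?X) * norm ?u"
      by (rule Cauchy_Schwarz_ineq2)
    also have "\<dots> \<le> (\<theta> * norm ?w) * norm ?u"
      using ext_lip[of ?X "sg s" "replicated (aggregate G ?X)"] by (intro mult_right_mono) (auto simp: F_eq_ext)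
    finally show ?thesis by (simp add: abs_le_iff)
  qed
  \<comment> \<open>Young's inequality spends half of the strong monotonicity, which explains
    \<open>\<mu> / 2\<close> in \<open>W\<close> and \<open>\<theta>\<^sup>2 / (2 * \<mu>)\<close>
    in \<open>kst\<close>.\<close>
  have C6: "\<theta> * norm ?w * norm ?u \<le> \<mu> / 2 * (norm ?u)\<^sup>2 + \<theta>\<^sup>2 / (2 * \<mu>) * (norm ?w)\<^sup>2"
  proof -
    have "0 \<le> (\<mu> * norm ?u - \<theta> * norm ?w)\<^sup>2 / (2 * \<mu>)" using mu_pos by simp
    also have "\<dots> = \<mu> / 2 * (norm ?u)\<^sup>2 + \<theta>\<^sup>2 / (2 * \<mu>) * (norm ?w)\<^sup>2 - \<theta> * norm ?w * norm ?u"
      using mu_pos by (simp add: power2_eq_square field_simps)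
    finally show ?thesis by simp
  qed
  \<comment> \<open>The factor \<open>1 / c\<^sup>2\<close> in \<open>kst\<close> converts
    disagreement into estimation error, and its summand 1 survives as the second term of
    \<open>W\<close>.\<close>
  have C7: "kst * (norm ?\<rho>)\<^sup>2 \<ge> (\<theta>\<^sup>2 / (2 * \<mu>) + 1) * (norm ?w)\<^sup>2"
  proof -
    have "?w \<in> E_perp"
      using avg_sg[OF s] by (simp add: avg_E_perp[symmetric] linear_diff[OF linear_avg])
    then have "c * norm ?w \<le> norm (lap E ?w)" by (rule c(2))
    also have "lap E ?w = ?\<rho>" by (simp add: linear_diff[OF linear_kron_id] lap_replicated rh_def)
    finally have "(c * norm ?w)\<^sup>2 \<le> (norm ?\<rho>)\<^sup>2" using c(1) by (intro power_mono) auto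
    then have "kst * (c * norm ?w)\<^sup>2 \<le> kst * (norm ?\<rho>)\<^sup>2"
      using mu_pos by (intro mult_left_mono) (auto simp: kst_def)
    moreover have "kst * (c * norm ?w)\<^sup>2 = (\<theta>\<^sup>2 / (2 * \<mu>) + 1) * (norm ?w)\<^sup>2"
      using c(1) by (simp add: kst_def power_mult_distrib)
    ultimately show ?thesis by simp
  qed
  have sum12: "?u \<bullet> fx s + (pt s - (replicated (aggregate G x) - agg_stack G x)) \<bullet> (- lap E ?kr)
      = - (?u \<bullet> ext_pseudo_gradient G ?X (sg s)) - PJ - (\<Sum>i\<in>UNIV. pk s $ i * (?\<rho> $ i \<bullet> ?\<rho> $ i))"
  proof -
    let ?b = "pt s - (replicated (aggregate G x) - agg_stack G x)"
    have "lap E ?kr \<bullet> agg_lin G ?u + ?b \<bullet> lap E ?kr = (\<Sum>i\<in>UNIV. pk s $ i * (?\<rho> $ i \<bullet> ?\<rho> $ i))"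
      unfolding A3[symmetric] A2[symmetric] inner_add_left by (simp only: inner_commute)
    then show ?thesis unfolding A1 inner_minus_right by linarith
  qed
  have ext: "?u \<bullet> ext_pseudo_gradient G ?X (sg s)
      = (ext_pseudo_gradient G ?X (sg s) - F ?X) \<bullet> ?u + (F ?X - F x) \<bullet> ?u + F x \<bullet> ?u"
    using inner_commute[of ?u "ext_pseudo_gradient G ?X (sg s)"] by (simp only: inner_diff_left)
  have "Q (s - center x l zb) \<bullet> fld s = - (?u \<bullet> ext_pseudo_gradient G ?X (sg s)) - PJ - kst * (norm ?\<rho>)\<^sup>2
      + (P1 - P2) - (R1 - R2) + Y - ?\<nu> \<bullet> lap E ?\<nu>"
    unfolding total sum12 A4 A5(1) A6 by simp
  also have "\<dots> \<le> - W x zb s"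
    unfolding W_def Y_def[symmetric] using C1 C2 C3 C4 C5 C6 C7 ext by (simp add: distrib_right)
  finally show ?thesis .
qed

lemma W_terms_nonneg:
  assumes cr: "crit x l zb" and s: "s \<in> state_set G"
  shows "\<mu> / 2 * (norm (px s - x))\<^sup>2 \<ge> 0" "(norm (sg s - replicated (aggregate G (px s))))\<^sup>2 \<ge> 0"
    "pn s \<bullet> lap E (pn s) \<ge> 0" "- (\<Sum>i\<in>UNIV. pn s $ i \<bullet> (gi i x - zb $ i)) \<ge> 0"
proof -
  show "\<mu> / 2 * (norm (px s - x))\<^sup>2 \<ge> 0" "(norm (sg s - replicated (aggregate G (px s))))\<^sup>2 \<ge> 0"
    using mu_pos by auto
  show "pn s \<bullet> lap E (pn s) \<ge> 0" by (rule lap_nonneg[OF sym_graph])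
  have "(\<Sum>i\<in>UNIV. pn s $ i \<bullet> (gi i x - zb $ i)) \<le> 0"
    using cr s by (intro sum_nonpos inner_nonpos) (auto simp: crit_def state_set_SS SS_def less_eq_vec_def)
  then show "- (\<Sum>i\<in>UNIV. pn s $ i \<bullet> (gi i x - zb $ i)) \<ge> 0" by simp
qed

text \<open>\<open>Q\<close> is the identity on the constrained blocks, so
  \<open>s - Q (s - center x l zb)\<close> has the primal and dual parts of the centre and is an
  admissible test point. The normal component can only help the decay.\<close>

lemma V_rate:
  assumes cr: "crit x l zb" and s: "s \<in> state_set G"
    and vi: "\<And>y. y \<in> SS \<Longrightarrow> (fld s - d) \<bullet> (y - s) \<le> 0"
  shows "Q (s - center x l zb) \<bullet> d \<le> - W x zb s"
proof -
  let ?q = "Q (s - center x l zb)"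
  have "s - ?q \<in> SS"
    using cr by (auto simp: SS_def Q_def center_def mem_Times_iff crit_def KKT_vi_def replicated_def less_eq_vec_def)
  then have "(fld s - d) \<bullet> (s - ?q - s) \<le> 0" by (rule vi)
  then have "?q \<bullet> d \<le> ?q \<bullet> fld s" by (simp add: inner_diff_left inner_commute)
  then show ?thesis using V_decay[OF cr s] by linarith
qed

lemma V_antimono:
  assumes cr: "crit x l zb" and sol: "vi_solution SS fld T s" and s0: "s 0 \<in> state_set G"
    and ab: "0 \<le> a" "a \<le> b" "b \<le> T"
  shows "V (center x l zb) (s b) \<le> V (center x l zb) (s a)"
proof -
  have "V (center x l zb) (s b) - V (center x l zb) (s a) \<le> 0 * (b - a)"
  proof (rule vi_rate[OF sol ab V_lob V_derivative])
    fix t d assume t: "a < t" "t < b" and vi: "\<And>y. y \<in> SS \<Longrightarrow> (fld (s t) - d) \<bullet> (y - s t) \<le> 0"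
    have st: "s t \<in> state_set G" by (rule vi_E_perp[OF sol s0]) (use t ab in auto)
    show "Q (s t - center x l zb) \<bullet> d \<le> 0"
      using V_rate[OF cr st vi] W_terms_nonneg[OF cr st] unfolding W_def by linarith
  qed
  then show ?thesis by simp
qed

text \<open>Giving every agent the same share of the total constraint value makes \<open>zb\<close>
  sum to zero. With equal shares the last term of \<open>W\<close> depends, at dual consensus, only
  on the total constraint, and this yields complementarity of a limiting multiplier.\<close>

lemma crit_exists: "\<exists>x l zb. crit x l zb \<and> (\<forall>i. gi i x - zb $ i = (1 / real CARD('i)) *\<^sub>R constr G x)"
proof -
  obtain x l where K: "KKT_vi x l" using KKT_vi_exists by blast
  define zb :: "real^'m^'i" where "zb = (\<chi> i. gi i x - (1 / real CARD('i)) *\<^sub>R constr G x)"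
  have "zb \<in> E_perp"
    by (simp add: E_perp_def zb_def sum_subtractf constr_def sum_constant_scaleR del: sum_constant)
  moreover have "(1 / real CARD('i)) *\<^sub>R constr G x \<le> 0"
    using K by (auto simp: KKT_vi_def less_eq_vec_def divide_le_0_iff)
  ultimately have "crit x l zb" using K by (auto simp: crit_def zb_def KKT_vi_def)
  then show ?thesis by (intro exI[of _ x] exI[of _ l] exI[of _ zb]) (simp add: zb_def)
qed

section \<open>Global existence and convergence of the solution\<close>

lemma global_solution:
  assumes s0: "s0 \<in> state_set G"
  shows "\<exists>s R. s 0 = s0 \<and> (\<forall>T\<ge>0. vi_solution SS fld T s \<and> norm (s T) < R)"
proof -
  obtain x l zb where cr: "crit x l zb" using crit_exists by blast
  let ?a = "center x l zb"
  obtain q where q: "q > 0" "\<And>a s. q * (norm (s - a))\<^sup>2 \<le> V a s" using V_coercive by blast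
  \<comment> \<open>Coercivity bounds the Lyapunov sublevel set of the initial state by this radius;
    the 1 makes the bound strict.\<close>
  define R where "R = norm ?a + sqrt (V ?a s0 / q) + 1"
  have "\<exists>s. s 0 = s0 \<and> (\<forall>T\<ge>0. vi_solution SS fld T s \<and> norm (s T) < R)"
  proof (rule vi_global_existence[OF convex_closed_SS _ lob_continuous[OF lob_fld]])
    show "s0 \<in> SS" using s0 by (simp add: state_set_SS)
    fix T s assume T: "T \<ge> 0" and sol: "vi_solution SS fld T s" and init: "s 0 = s0"
    have "V ?a (s T) \<le> V ?a (s 0)" by (rule V_antimono[OF cr sol]) (use s0 init T in auto)
    then have "q * (norm (s T - ?a))\<^sup>2 \<le> V ?a s0" using q(2)[of "s T" ?a] init by simp
    then have "(norm (s T - ?a))\<^sup>2 \<le> V ?a s0 / q" using q(1) by (simp add: pos_le_divide_eq mult.commute)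
    then have "norm (s T - ?a) \<le> sqrt (V ?a s0 / q)" by (rule real_le_rsqrt)
    then show "norm (s T) < R" using norm_triangle_ineq2[of "s T" ?a] by (simp add: R_def)
  qed
  then show ?thesis by blast
qed

lemma closed_state_set: "closed (state_set G)"
proof -
  have eq: "state_set G = SS \<inter> {s. avg (pt s) = 0} \<inter> {s. avg (pz s) = 0}"
    by (rule set_eqI) (simp add: state_set_SS avg_E_perp)
  have 1: "continuous_on UNIV (\<lambda>s :: ('i, 'n, 'p, 'm) state. avg (pt s))"
    by (intro lob_continuous linear_lob[OF linear_avg] lob_intros)
  have 2: "continuous_on UNIV (\<lambda>s :: ('i, 'n, 'p, 'm) state. avg (pz s))"
    by (intro lob_continuous linear_lob[OF linear_avg] lob_intros)
  show ?thesis unfolding eq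
    by (intro closed_Int convex_closed_SS closed_Collect_eq 1 2 continuous_on_const)
qed

lemma solution_converges:
  assumes s0: "s 0 \<in> state_set G" and sol: "\<And>T. T \<ge> 0 \<Longrightarrow> vi_solution SS fld T s"
    and bnd: "\<And>T. T \<ge> 0 \<Longrightarrow> norm (s T) < R"
  shows "\<exists>x l zb k. crit x l zb \<and>
    (s \<longlongrightarrow> (x, replicated (aggregate G x) - agg_stack G x, k, zb, replicated l)) at_top"
proof -
  interpret B: bounded_vi_solution SS fld s R
    by unfold_locales (use sol bnd lob_fld in auto)
  have st: "s t \<in> state_set G" if "t \<ge> 0" for t
    by (rule vi_E_perp[OF sol s0]) (use that in auto)
  have V_conv: "\<exists>v. ((\<lambda>t. V (center x l zb) (s t)) \<longlongrightarrow> v) at_top" if cr: "crit x l zb" for x l zb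
  proof (rule antimono_tendsto)
    show "V (center x l zb) (s b) \<le> V (center x l zb) (s a)" if "0 \<le> a" "a \<le> b" for a b
      using V_antimono[OF cr sol[of b] s0 that order_refl] that by simp
    obtain q where q: "q > 0" "\<And>a s. q * (norm (s - a))\<^sup>2 \<le> V a s" using V_coercive by blast
    show "0 \<le> V (center x l zb) (s t)" for t
      using q(2)[of "s t" "center x l zb"] q(1) by (smt (verit) mult_nonneg_nonneg zero_le_power2)
  qed
  obtain x l0 z0 where cr0: "crit x l0 z0" and u0: "\<And>i. gi i x - z0 $ i = (1 / real CARD('i)) *\<^sub>R constr G x"
    using crit_exists by blast
  have lim_st: "p \<in> state_set G" if lp: "B.limit_point p" for p
  proof -
    obtain \<tau> where "\<And>n. \<tau> n \<ge> 0" "(\<lambda>n. s (\<tau> n)) \<longlonglongrightarrow> p" using lp by (auto simp: B.limit_point_def)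
    then show ?thesis using closed_sequentially[OF closed_state_set _ \<open>(\<lambda>n. s (\<tau> n)) \<longlonglongrightarrow> p\<close>] st by blast
  qed
  have contW: "continuous_on UNIV (W x z0)"
  proof -
    have eq: "W x z0 = (\<lambda>s. \<mu> / 2 * ((px s - x) \<bullet> (px s - x))
       + (sg s - replicated (avg (agg_stack G (px s)))) \<bullet> (sg s - replicated (avg (agg_stack G (px s))))
       + pn s \<bullet> lap E (pn s) - (\<Sum>i\<in>UNIV. pn s $ i \<bullet> (gi i x - z0 $ i)))"
      by (simp add: W_def fun_eq_iff power2_norm_eq_inner avg_agg_stack)
    show ?thesis unfolding eq agg_stack_eq[of G "px _"]
      by (intro lob_continuous lob_intros lob_sg linear_lob[OF linear_kron_id] linear_lob[OF linear_replicated]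
          linear_lob[OF linear_avg] linear_lob[OF linear_agg_lin])
  qed
  have W0: "W x z0 p \<le> 0" if p: "B.limit_point p" for p
  proof -
    obtain v where v: "((\<lambda>t. V (center x l0 z0) (s t)) \<longlongrightarrow> v) at_top" using V_conv[OF cr0] by blast
    show ?thesis
    proof (rule B.limit_point_rate[OF p V_lob V_derivative contW v])
      fix t d assume t: "t > 0" and vi: "\<And>z. z \<in> SS \<Longrightarrow> (fld (s t) - d) \<bullet> (z - s t) \<le> 0"
      show "Q (s t - center x l0 z0) \<bullet> d \<le> - W x z0 (s t)"
        by (rule V_rate[OF cr0 st vi]) (use t in auto)
    qed
  qed
  have lim: "px p = x" "pt p = replicated (aggregate G x) - agg_stack G x"
    "lap E (pn p) = 0" "pn p = replicated (avg (pn p))" "avg (pn p) \<bullet> constr G x = 0"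
    if p: "B.limit_point p" for p
  proof -
    note nn = W_terms_nonneg[OF cr0 lim_st[OF p]]
    have z: "\<mu> / 2 * (norm (px p - x))\<^sup>2 = 0" "(norm (sg p - replicated (aggregate G (px p))))\<^sup>2 = 0"
      "pn p \<bullet> lap E (pn p) = 0" "(\<Sum>i\<in>UNIV. pn p $ i \<bullet> (gi i x - z0 $ i)) = 0"
      using W0[OF p] nn unfolding W_def by linarith+
    show x: "px p = x" using z(1) mu_pos by simp
    show "pt p = replicated (aggregate G x) - agg_stack G x" using z(2) x by (simp add: sg_def algebra_simps)
    obtain v where v: "pn p = replicated v"
    proof
      show "pn p = replicated (pn p $ undefined)"
        using lap_quadratic_zero[OF graph z(3)] by (simp add: vec_eq_iff replicated_def)
    qed
    show "lap E (pn p) = 0" using v lap_replicated by simp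
    show 4: "pn p = replicated (avg (pn p))" using v by simp
    have "(\<Sum>i::'i\<in>UNIV. (1 / real CARD('i)) * (v \<bullet> constr G x)) = 0"
      using z(4) unfolding u0 v by (simp add: replicated_def)
    then show "avg (pn p) \<bullet> constr G x = 0" using v by simp
  qed
  have xlim: "((\<lambda>t. px (s t)) \<longlongrightarrow> x) at_top"
    by (rule B.tendsto_of_limit_points) (use lim in \<open>auto intro!: continuous_intros\<close>)
  have llim: "((\<lambda>t. lap E (pn (s t))) \<longlongrightarrow> 0) at_top"
    by (rule B.tendsto_of_limit_points[of "\<lambda>s. lap E (pn s)"])
      (use lim in \<open>auto intro!: lob_continuous linear_lob[OF linear_kron_id] lob_intros\<close>)
  obtain p where p: "B.limit_point p"
    by (rule B.limit_point_exists[of real, OF order_refl])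
  obtain \<tau> where \<tau>: "filterlim \<tau> at_top sequentially" "\<And>n. \<tau> n \<ge> 0" "(\<lambda>n. s (\<tau> n)) \<longlonglongrightarrow> p"
    using p by (auto simp: B.limit_point_def)
  define l1 where "l1 = avg (pn p)"
  define z1 where "z1 = pz p"
  have pst: "p \<in> state_set G" by (rule lim_st[OF p])
  have l1: "0 \<le> l1"
  proof -
    have "0 \<le> pn p" using pst by (simp add: state_set_SS SS_def mem_Times_iff)
    then have "0 \<le> (replicated l1 :: real^'m^'i)" unfolding l1_def lim(4)[OF p, symmetric] .
    then show ?thesis by (simp add: replicated_def less_eq_vec_def)
  qed
  have K0: "KKT_vi x l0" using cr0 by (simp add: crit_def)
  have statio: "F x \<bullet> (y - x) + (\<Sum>i\<in>UNIV. l1 \<bullet> (J i x *v (y - x))) \<ge> 0" if y: "y \<in> Omega G" for y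
  proof -
    \<comment> \<open>Half the squared distance of the primal variable to \<open>y\<close>. It
      converges because the primal variable does, so \<open>limit_point_rate\<close> yields the
      primal inequality at \<open>p\<close>, although velocities need not converge.\<close>
    define U where "U = (\<lambda>s :: ('i, 'n, 'p, 'm) state. (px s - y) \<bullet> (px s - y) / 2)"
    have lobU: "lipschitz_on_bounded U"
    proof -
      have "lipschitz_on_bounded (\<lambda>s :: ('i, 'n, 'p, 'm) state. 1 / 2 * ((px s - y) \<bullet> (px s - y)))" by (intro lob_intros)
      then show ?thesis by (simp add: U_def)
    qed
    have dU: "(U has_derivative (\<lambda>h. (px s - y) \<bullet> px h)) (at s)" for s
    proof -
      have "((\<lambda>x. (x - y) \<bullet> (x - y) / 2) has_derivative (\<lambda>h. (px s - y) \<bullet> h)) (at (px s))"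
        by (rule quadratic_has_derivative[of "\<lambda>x. x"]) (auto simp: linear_ident)
      then show ?thesis unfolding U_def
        by (rule has_derivative_compose[OF bounded_linear_imp_has_derivative[OF bounded_linear_fst]])
    qed
    have limU: "((\<lambda>t. U (s t)) \<longlongrightarrow> (x - y) \<bullet> (x - y) / 2) at_top"
      unfolding U_def by (intro tendsto_intros xlim) simp
    have "- (fx p \<bullet> (px p - y)) \<le> 0"
    proof (rule B.limit_point_rate[OF p lobU dU _ limU])
      show "continuous_on UNIV (\<lambda>s. - (fx s \<bullet> (px s - y)))" by (intro lob_continuous lob_intros lob_fx)
      fix t d assume t: "t > 0" and vi: "\<And>z. z \<in> SS \<Longrightarrow> (fld (s t) - d) \<bullet> (z - s t) \<le> 0"
      have "s t \<in> SS" using st[of t] t by (simp add: state_set_SS)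
      from vi_components(1)[OF this vi y]
      have "(fx (s t) - px d) \<bullet> (y - px (s t)) \<le> 0" by simp
      then show "(px (s t) - y) \<bullet> px d \<le> - (- (fx (s t) \<bullet> (px (s t) - y)))"
        by (simp add: inner_diff_left inner_diff_right inner_commute)
    qed
    moreover have "fx p \<bullet> (px p - y) = F x \<bullet> (y - x) + (\<Sum>i\<in>UNIV. l1 \<bullet> (J i x *v (y - x)))"
    proof -
      have sgp: "sg p = replicated (aggregate G x)" using lim(1,2)[OF p] by (simp add: sg_def)
      have "kr p = 0" by (simp add: kr_def rh_def sgp lap_replicated block_scale_def vec_eq_iff)
      then have "fx p = - F x - constr_jac_transpose G x (replicated l1)"
        using lim(1,4)[OF p] sgp
        by (simp add: fx_def F_eq_ext l1_def linear_0[OF linear_kron_id] linear_0[OF linear_agg_transpose])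
      then have "fx p \<bullet> (px p - y) = (F x + constr_jac_transpose G x (replicated l1)) \<bullet> (y - x)"
        using lim(1)[OF p] by (simp add: inner_diff_left inner_diff_right inner_add_left)
      then show ?thesis by (simp add: inner_add_left constr_jac_transpose_inner replicated_def)
    qed
    ultimately show ?thesis by simp
  qed
  have K1: "KKT_vi x l1"
    using K0 l1 statio lim(5)[OF p] by (simp add: KKT_vi_def l1_def)
  txt \<open>Since \<open>lap E \<nu>\<close> vanishes in the limit, \<open>z\<close> is almost constant on windows of any fixed length;
    a positive component of \<open>gi i x - z1 $ i\<close> would push \<open>\<nu>\<close> beyond its bound on a long window.\<close>
  have zbound: "gi i x $ j - z1 $ i $ j \<le> 0" for i j
  proof (rule ccontr)
    define u where "u = gi i x $ j - z1 $ i $ j"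
    assume "\<not> ?thesis"
    then have u: "u > 0" by (simp add: u_def)
    have R: "R > 0" using bnd[of 0] norm_ge_zero[of "s 0"] by linarith
    \<comment> \<open>Long enough for growth at rate \<open>u / 2\<close> to exceed
      \<open>R\<close>; \<open>\<eta>\<close> then limits the drift of \<open>z\<close> over that
      window to \<open>u / 8\<close>.\<close>
    define T where "T = 2 * (R + 1) / u"
    have T: "T > 0" "T * (u / 2) = R + 1" using u R by (auto simp: T_def)
    define \<eta> where "\<eta> = u / (8 * T)"
    have \<eta>: "\<eta> > 0" "\<eta> * T = u / 8" using u T by (auto simp: \<eta>_def)
    have "isCont (gi i) x" using lob_continuous[OF lob_gi] by (simp add: continuous_on_eq_continuous_at)
    then have "((\<lambda>t. gi i (px (s t))) \<longlongrightarrow> gi i x) at_top" using xlim by (rule isCont_tendsto_compose)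
    then have "((\<lambda>t. gi i (px (s t)) $ j - lap E (pn (s t)) $ i $ j) \<longlongrightarrow> gi i x $ j - (0::real^'m^'i) $ i $ j) at_top"
      by (intro tendsto_intros llim)
    then have e1: "\<forall>\<^sub>F t in at_top. gi i (px (s t)) $ j - lap E (pn (s t)) $ i $ j > gi i x $ j - u / 8"
      using u by (intro order_tendstoD(1)) auto
    have "((\<lambda>t. lap E (pn (s t)) $ i $ j) \<longlongrightarrow> (0::real^'m^'i) $ i $ j) at_top" by (intro tendsto_intros llim)
    then have e2: "\<forall>\<^sub>F t in at_top. lap E (pn (s t)) $ i $ j < \<eta>"
      using \<eta> by (intro order_tendstoD(2)) auto
    obtain t0 where t0: "\<And>t. t \<ge> t0 \<Longrightarrow> gi i (px (s t)) $ j - lap E (pn (s t)) $ i $ j > gi i x $ j - u / 8"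
      "\<And>t. t \<ge> t0 \<Longrightarrow> lap E (pn (s t)) $ i $ j < \<eta>"
      using eventually_conj[OF e1 e2] unfolding eventually_at_top_linorder by blast
    have "(\<lambda>n. pz (s (\<tau> n)) $ i $ j) \<longlonglongrightarrow> z1 $ i $ j"
      unfolding z1_def by (intro tendsto_intros \<tau>(3))
    then have "\<forall>\<^sub>F n in sequentially. pz (s (\<tau> n)) $ i $ j < z1 $ i $ j + u / 8"
      using u by (intro order_tendstoD(2)) auto
    moreover have "\<forall>\<^sub>F n in sequentially. \<tau> n \<ge> t0" using \<tau>(1) by (simp add: filterlim_at_top)
    ultimately have "\<forall>\<^sub>F n in sequentially. pz (s (\<tau> n)) $ i $ j < z1 $ i $ j + u / 8 \<and> \<tau> n \<ge> t0"
      by (rule eventually_conj)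
    then obtain n where n: "pz (s (\<tau> n)) $ i $ j < z1 $ i $ j + u / 8" "\<tau> n \<ge> t0"
      using eventually_happens by fastforce
    let ?t = "\<tau> n"
    have lz: "linear (\<lambda>s :: ('i, 'n, 'p, 'm) state. pz s $ i $ j)" by (rule linearI) auto
    have ln: "linear (\<lambda>s :: ('i, 'n, 'p, 'm) state. - pn s $ i $ j)" by (rule linearI) auto
    have zt: "pz (s t) $ i $ j < z1 $ i $ j + u / 4" if t: "?t \<le> t" "t \<le> ?t + T" for t
    proof -
      have "pz (s t) $ i $ j - pz (s ?t) $ i $ j \<le> \<eta> * (t - ?t)"
      proof (rule vi_rate[OF sol \<tau>(2) t(1) order_refl linear_lob[OF lz lob_ident] linear_imp_has_derivative[OF lz]])
        show "0 \<le> t" using \<tau>(2)[of n] t by simp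
        fix r d assume r: "?t < r" "r < t" and vi: "\<And>z. z \<in> SS \<Longrightarrow> (fld (s r) - d) \<bullet> (z - s r) \<le> 0"
        have "s r \<in> SS" using st[of r] \<tau>(2)[of n] r by (simp add: state_set_SS)
        from vi_components(4)[OF this vi] show "pz d $ i $ j \<le> \<eta>"
          using t0(2)[of r] n(2) r by simp
      qed
      also have "\<dots> \<le> \<eta> * T" using t \<eta> by (intro mult_left_mono) auto
      finally show ?thesis using n(1) \<eta>(2) by simp
    qed
    have "- pn (s (?t + T)) $ i $ j - (- pn (s ?t) $ i $ j) \<le> - (u / 2) * (?t + T - ?t)"
    proof (rule vi_rate[OF sol \<tau>(2) _ order_refl linear_lob[OF ln lob_ident] linear_imp_has_derivative[OF ln]])
      show "0 \<le> ?t + T" "?t \<le> ?t + T" using \<tau>(2)[of n] T by auto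
      fix r d assume r: "?t < r" "r < ?t + T" and vi: "\<And>z. z \<in> SS \<Longrightarrow> (fld (s r) - d) \<bullet> (z - s r) \<le> 0"
      have sr: "s r \<in> SS" using st[of r] \<tau>(2)[of n] r by (simp add: state_set_SS)
      \<comment> \<open>Raising one dual component never leaves the orthant, so in that component
        the velocity is at least the field.\<close>
      have "0 \<le> pn (s r) + axis i (axis j 1)"
        using sr by (auto simp: SS_def mem_Times_iff less_eq_vec_def axis_def)
      from vi_components(5)[OF sr vi this]
      have "fn (s r) $ i $ j \<le> pn d $ i $ j" by (simp add: inner_axis inner_diff_left)
      moreover have "fn (s r) $ i $ j = gi i (px (s r)) $ j - lap E (pn (s r)) $ i $ j - pz (s r) $ i $ j"
        by (simp add: fn_def constr_stack_def)
      moreover have "gi i (px (s r)) $ j - lap E (pn (s r)) $ i $ j > gi i x $ j - u / 8"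
        by (rule t0(1)) (use n(2) r in linarith)
      moreover have "pz (s r) $ i $ j < z1 $ i $ j + u / 4" by (rule zt) (use r in linarith)+
      moreover have "gi i x $ j = u + z1 $ i $ j" by (simp add: u_def)
      \<comment> \<open>Of the margin \<open>u\<close>, the constraint and consensus terms have used
        \<open>u / 8\<close> and \<open>z\<close> has used \<open>u / 4\<close>.\<close>
      ultimately have "pn d $ i $ j \<ge> u / 2" using u by linarith
      then show "- pn d $ i $ j \<le> - (u / 2)" by simp
    qed
    moreover have "- (u / 2) * (?t + T - ?t) = - (T * (u / 2))" by simp
    ultimately have "pn (s (?t + T)) $ i $ j \<ge> pn (s ?t) $ i $ j + (R + 1)" unfolding T(2) by linarith
    moreover have "pn (s ?t) $ i $ j \<ge> 0"
      using st[OF \<tau>(2), of n] by (auto simp: state_set_SS SS_def mem_Times_iff less_eq_vec_def)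
    moreover have "pn (s (?t + T)) $ i $ j < R"
    proof -
      have "\<bar>pn (s (?t + T)) $ i $ j\<bar> \<le> norm (pn (s (?t + T)) $ i)" by (rule component_le_norm_cart)
      also have "\<dots> \<le> norm (pn (s (?t + T)))" by (rule Finite_Cartesian_Product.norm_nth_le)
      also have "\<dots> \<le> norm (s (?t + T))"
        using norm_proj_le(2)[of "snd (snd (snd (s (?t + T))))"] norm_proj_le(2)[of "snd (snd (s (?t + T)))"]
          norm_proj_le(2)[of "snd (s (?t + T))"] norm_proj_le(2)[of "s (?t + T)"] by linarith
      also have "\<dots> < R" using bnd[of "?t + T"] \<tau>(2)[of n] T by simp
      finally show ?thesis by simp
    qed
    ultimately show False using R by linarith
  qed
  have cr1: "crit x l1 z1"
  proof -
    have zE: "z1 \<in> E_perp" using pst by (simp add: z1_def state_set_SS)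
    have le: "gi i x - z1 $ i \<le> 0" for i using zbound by (simp add: less_eq_vec_def)
    \<comment> \<open>Summation removes \<open>z1\<close>, whose average is zero, and leaves global
      complementarity; terms of one sign then vanish separately.\<close>
    have "(\<Sum>i\<in>UNIV. l1 \<bullet> (gi i x - z1 $ i)) = l1 \<bullet> (constr G x - (\<Sum>i\<in>UNIV. z1 $ i))"
      by (simp add: inner_sum_right[symmetric] sum_subtractf constr_def)
    also have "\<dots> = 0" using zE lim(5)[OF p] by (simp add: E_perp_def l1_def)
    finally have "(\<Sum>i\<in>UNIV. - (l1 \<bullet> (gi i x - z1 $ i))) = 0" by (simp add: sum_negf)
    moreover have "- (l1 \<bullet> (gi i x - z1 $ i)) \<ge> 0" for i using inner_nonpos[OF l1 le] by simp
    ultimately have "\<forall>i\<in>UNIV. - (l1 \<bullet> (gi i x - z1 $ i)) = 0" by (subst (asm) sum_nonneg_eq_0_iff) auto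
    then have "l1 \<bullet> (gi i x - z1 $ i) = 0" for i by simp
    then show ?thesis using K1 zE le by (simp add: crit_def)
  qed
  have comps: "px p = x" "pt p = replicated (aggregate G x) - agg_stack G x" "pz p = z1" "pn p = replicated l1"
    using lim(1,2,4)[OF p] by (simp_all add: z1_def l1_def)
  have p_eq: "p = (x, replicated (aggregate G x) - agg_stack G x, pk p, z1, replicated l1)"
    using comps by (simp add: prod_eq_iff)
  have klim: "((\<lambda>t. pk (s t) $ i) \<longlongrightarrow> pk p $ i) at_top" for i
  proof -
    have lk: "linear (\<lambda>s :: ('i, 'n, 'p, 'm) state. - pk s $ i)" by (rule linearI) auto
    have "\<exists>v. ((\<lambda>t. - pk (s t) $ i) \<longlongrightarrow> v) at_top"
    proof (rule antimono_tendsto)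
      fix a b :: real assume ab: "0 \<le> a" "a \<le> b"
      have "- pk (s b) $ i - (- pk (s a) $ i) \<le> 0 * (b - a)"
      proof (rule vi_rate[OF sol ab order_refl linear_lob[OF lk lob_ident] linear_imp_has_derivative[OF lk]])
        show "0 \<le> b" using ab by simp
        fix r d assume r: "a < r" "r < b" and vi: "\<And>z. z \<in> SS \<Longrightarrow> (fld (s r) - d) \<bullet> (z - s r) \<le> 0"
        have "s r \<in> SS" using st[of r] ab r by (simp add: state_set_SS)
        from vi_components(3)[OF this vi] show "- pk d $ i \<le> 0"
          using gamma_pos[of i] by (simp add: D_transpose_def block_scale_def)
      qed
      then show "- pk (s b) $ i \<le> - pk (s a) $ i" by simp
    next
      fix t :: real assume t: "t \<ge> 0"
      have "\<bar>pk (s t) $ i\<bar> \<le> norm (pk (s t))" by (rule component_le_norm_cart)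
      also have "\<dots> \<le> norm (s t)" using norm_proj_le(1)[of "snd (snd (s t))"] norm_proj_le(2)[of "snd (s t)"] norm_proj_le(2)[of "s t"] by linarith
      finally show "- R \<le> - pk (s t) $ i" using bnd[OF t] by simp
    qed
    then obtain v where v: "((\<lambda>t. - pk (s t) $ i) \<longlongrightarrow> v) at_top" by blast
    have "(\<lambda>n. - pk (s (\<tau> n)) $ i) \<longlonglongrightarrow> - pk p $ i" by (intro tendsto_intros \<tau>(3))
    then have "v = - pk p $ i" using filterlim_compose[OF v \<tau>(1)] LIMSEQ_unique by blast
    then show ?thesis using tendsto_minus[OF v] by simp
  qed
  \<comment> \<open>\<open>p\<close> and the centre differ only in the gains, and \<open>H\<close>
    is the resulting difference of the two functions. Its limit exists by \<open>klim\<close>, so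
    \<open>V p\<close> converges although it need not decrease.\<close>
  define H where "H = (\<lambda>s :: ('i, 'n, 'p, 'm) state. \<Sum>i\<in>UNIV. ((pk s $ i - kst)\<^sup>2 - (pk s $ i - pk p $ i)\<^sup>2) / (2 * \<gamma> $ i))"
  have split: "V p r = V (center x l1 z1) r - H r" for r
  proof -
    have "V (center x l1 z1) r - V p r = (\<Sum>i\<in>UNIV. (pk r $ i - kst) * ((pk r $ i - kst) / \<gamma> $ i)) / 2
        - (\<Sum>i\<in>UNIV. (pk r $ i - pk p $ i) * ((pk r $ i - pk p $ i) / \<gamma> $ i)) / 2"
      by (simp add: comps V_def Q_def center_def inner_prod_def
          inner_vec_def[of "pk r - (\<chi> i. kst)"] inner_vec_def[of "pk r - pk p"] add_divide_distrib)
    also have "\<dots> = H r"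
    proof -
      have e: "a * (a / g) / 2 - b * (b / g) / 2 = (a\<^sup>2 - b\<^sup>2) / (2 * g)" for a b g :: real
        by (simp add: power2_eq_square diff_divide_distrib mult.commute)
      show ?thesis unfolding H_def sum_divide_distrib sum_subtractf[symmetric] e ..
    qed
    finally show ?thesis by simp
  qed
  obtain v where v: "((\<lambda>t. V (center x l1 z1) (s t)) \<longlongrightarrow> v) at_top" using V_conv[OF cr1] by blast
  have "((\<lambda>t. H (s t)) \<longlongrightarrow> (\<Sum>i\<in>UNIV. ((pk p $ i - kst)\<^sup>2 - (pk p $ i - pk p $ i)\<^sup>2) / (2 * \<gamma> $ i))) at_top"
    unfolding H_def by (intro tendsto_intros klim) (use gamma_pos in \<open>auto simp: less_imp_neq[symmetric]\<close>)
  then have "\<exists>w. ((\<lambda>t. V p (s t)) \<longlongrightarrow> w) at_top" unfolding split using v tendsto_diff by blast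
  then obtain w where w: "((\<lambda>t. V p (s t)) \<longlongrightarrow> w) at_top" by blast
  have "isCont (V p) p" by (rule lob_continuous[OF V_lob, unfolded continuous_on_eq_continuous_at[OF open_UNIV], rule_format]) simp
  then have "(\<lambda>n. V p (s (\<tau> n))) \<longlonglongrightarrow> V p p" using \<tau>(3) by (rule isCont_tendsto_compose)
  \<comment> \<open>Along \<open>\<tau>\<close> the values tend to \<open>V p p\<close>, which is
    zero; coercivity then gives convergence of the whole solution.\<close>
  then have "w = V p p" using filterlim_compose[OF w \<tau>(1)] LIMSEQ_unique by blast
  then have w0: "((\<lambda>t. V p (s t)) \<longlongrightarrow> 0) at_top" using w by (simp add: V_def)
  obtain q where q: "q > 0" "\<And>a s. q * (norm (s - a))\<^sup>2 \<le> V a s" using V_coercive by blast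
  have "((\<lambda>t. sqrt (V p (s t) / q)) \<longlongrightarrow> sqrt (0 / q)) at_top"
    using q(1) by (intro tendsto_intros w0) auto
  then have sq0: "((\<lambda>t. sqrt (V p (s t) / q)) \<longlongrightarrow> 0) at_top" by simp
  have "norm (s t - p) \<le> sqrt (V p (s t) / q)" for t
  proof (rule real_le_rsqrt)
    show "(norm (s t - p))\<^sup>2 \<le> V p (s t) / q"
      using q(1) q(2)[of "s t" p] by (simp only: pos_le_divide_eq mult.commute[of q])
  qed
  then have "\<forall>\<^sub>F t in at_top. norm (s t - p) \<le> sqrt (V p (s t) / q)" by (rule always_eventually[OF allI])
  then have "((\<lambda>t. s t - p) \<longlongrightarrow> 0) at_top" using sq0 by (rule Lim_null_comparison)
  then have "(s \<longlongrightarrow> p) at_top" by (rule LIM_zero_cancel)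
  then show ?thesis using cr1 p_eq by metis
qed

end

lemma solution_exists_unique_converges:
  assumes s0: "s0 \<in> state_set G"
  shows "\<exists>s. caratheodory_solution (dynamics G E \<gamma>) s0 s \<and>
           (\<forall>s'. caratheodory_solution (dynamics G E \<gamma>) s0 s' \<longrightarrow> (\<forall>t\<ge>0. s' t = s t)) \<and>
           (\<forall>t\<ge>0. s t \<in> state_set G) \<and>
           (\<exists>x \<tau> k z \<nu> \<nu>opt.
              (s \<longlongrightarrow> (x, \<tau>, k, z, \<nu>)) at_top \<and>
              dynamics G E \<gamma> (x, \<tau>, k, z, \<nu>) = 0 \<and>
              agg_stack G x + \<tau> = replicated (aggregate G x) \<and>
              \<nu> = replicated \<nu>opt \<and>
              KKT G x \<nu>opt \<and>
              is_vGNE G x \<and>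
              (\<forall>y. is_vGNE G y \<longrightarrow> y = x))"
proof -
  obtain M :: "real^'m^'i \<Rightarrow> real^'m^'i" and cM where M: "linear M" "\<And>x y. x \<bullet> M y = M x \<bullet> y"
    "\<And>y. M (lap E y) = y - replicated (avg y)" "cM > 0" "\<And>z. z \<bullet> M z \<ge> cM * (norm z)\<^sup>2"
    using reg_lap_inverse[OF graph] by blast
  obtain c where c: "c > 0" "\<And>y :: real^'p^'i. y \<in> E_perp \<Longrightarrow> c * norm y \<le> norm (lap E y)"
    using lap_bounded_below[OF graph] by blast
  note ctx = M c
  obtain s R where s: "s 0 = s0" "\<And>T. T \<ge> 0 \<Longrightarrow> vi_solution SS fld T s" "\<And>T. T \<ge> 0 \<Longrightarrow> norm (s T) < R"
    using global_solution[OF ctx s0] by blast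
  have st: "s t \<in> state_set G" if "t \<ge> 0" for t
    by (rule vi_E_perp[OF s(2)]) (use that s(1) s0 in auto)
  have car: "caratheodory_solution (dynamics G E \<gamma>) s0 s" using vi_caratheodory[OF s(2)] s(1) by simp
  have uniq: "s' t = s t" if s': "caratheodory_solution (dynamics G E \<gamma>) s0 s'" and t: "t \<ge> 0" for s' t
  proof (rule vi_solution_unique[OF lob_fld t _ s(2)[OF t]])
    show "vi_solution SS fld t s'" by (rule caratheodory_vi[OF s' _ t]) (use s0 in \<open>simp add: state_set_SS\<close>)
    show "s' 0 = s 0" using s' s(1) by (simp add: caratheodory_solution_def)
  qed
  have "s 0 \<in> state_set G" using s(1) s0 by simp
  from solution_converges[OF ctx this s(2,3)]
  obtain x l zb k where cr: "crit x l zb"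
    and lim: "(s \<longlongrightarrow> (x, replicated (aggregate G x) - agg_stack G x, k, zb, replicated l)) at_top"
    by blast
  have K: "KKT_vi x l" and comp: "\<And>i. gi i x - zb $ i \<le> 0" "\<And>i. l \<bullet> (gi i x - zb $ i) = 0"
    using cr by (auto simp: crit_def)
  define p :: "('i, 'n, 'p, 'm) state" where "p = (x, replicated (aggregate G x) - agg_stack G x, k, zb, replicated l)"
  have sgp: "sg p = replicated (aggregate G x)" by (simp add: sg_def p_def)
  have rhp: "rh p = 0" by (simp add: rh_def sgp lap_replicated)
  have krp: "kr p = 0" by (simp add: kr_def rhp block_scale_def vec_eq_iff)
  \<comment> \<open>At \<open>p\<close> the estimates agree, so \<open>rh\<close> and
    \<open>kr\<close> vanish, and the two projected blocks reduce to the conditions collected in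
    \<open>crit\<close>.\<close>
  have eq: "dynamics G E \<gamma> p = 0"
  proof -
    have fxp: "fx p = - F x - constr_jac_transpose G x (replicated l)"
      by (simp add: fx_def sgp krp F_eq_ext linear_0[OF linear_kron_id] linear_0[OF linear_agg_transpose]) (simp add: p_def F_eq_ext)
    have "proj_dyn (Omega G) x (fx p) = 0"
    proof (rule proj_dyn_zero[OF convex_closed_Omega(1)])
      show "x \<in> Omega G" using K by (simp add: KKT_vi_def)
      fix y assume "y \<in> Omega G"
      then have "F x \<bullet> (y - x) + (\<Sum>i\<in>UNIV. l \<bullet> (J i x *v (y - x))) \<ge> 0" using K by (simp add: KKT_vi_def)
      then show "fx p \<bullet> (y - x) \<le> 0"
        by (simp add: fxp inner_diff_left[of "- F x"] constr_jac_transpose_inner replicated_def)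
    qed
    moreover have "proj_dyn {l. 0 \<le> l} (replicated l) (fn p) = 0"
    proof (rule proj_dyn_zero[OF orthant_convex_closed(3)])
      show "replicated l \<in> {l :: real^'m^'i. 0 \<le> l}" using K by (simp add: KKT_vi_def replicated_def less_eq_vec_def)
      fix n :: "real^'m^'i" assume "n \<in> {l. 0 \<le> l}"
      then have n: "0 \<le> n $ i" for i by (simp add: less_eq_vec_def)
      have "fn p $ i = gi i x - zb $ i" for i by (simp add: fn_def p_def constr_stack_def lap_replicated)
      then have "fn p $ i \<bullet> (n - replicated l) $ i = n $ i \<bullet> (gi i x - zb $ i)" for i
        using comp(2)[of i] by (simp add: replicated_def inner_diff_right inner_diff_left inner_commute)
      then have "fn p \<bullet> (n - replicated l) = (\<Sum>i\<in>UNIV. n $ i \<bullet> (gi i x - zb $ i))"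
        by (simp only: inner_vec_def[of "fn p"])
      also have "\<dots> \<le> 0" by (intro sum_nonpos inner_nonpos n comp(1))
      finally show "fn p \<bullet> (n - replicated l) \<le> 0" .
    qed
    ultimately show ?thesis
      unfolding dynamics_eq rhp krp
      by (simp add: p_def linear_0[OF linear_kron_id] lap_replicated zero_prod_def D_transpose_def vec_eq_iff)
  qed
  have kkt: "KKT G x l" using K KKT_iff by simp
  have vgne: "is_vGNE G x" using kkt KKT_vi_GNE[OF K] by (auto simp: is_vGNE_def)
  have vu: "y = x" if "is_vGNE G y" for y
    using that KKT_vi_unique K by (auto simp: is_vGNE_def KKT_iff)
  have "agg_stack G x + (replicated (aggregate G x) - agg_stack G x) = replicated (aggregate G x)" by simp
  then have "\<exists>x \<tau> k z \<nu> \<nu>opt. (s \<longlongrightarrow> (x, \<tau>, k, z, \<nu>)) at_top \<and> dynamics G E \<gamma> (x, \<tau>, k, z, \<nu>) = 0 \<and>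
      agg_stack G x + \<tau> = replicated (aggregate G x) \<and> \<nu> = replicated \<nu>opt \<and> KKT G x \<nu>opt \<and>
      is_vGNE G x \<and> (\<forall>y. is_vGNE G y \<longrightarrow> y = x)"
    using lim eq[unfolded p_def] kkt vgne vu by blast
  then show ?thesis using car uniq st by blast
qed

end

theorem theorem3:
  fixes G :: "('i::finite, 'n::finite, 'p::finite, 'm::finite) agg_game"
    and E :: "('i \<times> 'i) set"
    and \<gamma> :: "real^'i"
    and \<mu> \<theta> :: real
  assumes strategies_in: "\<And>i. strategies G i \<subseteq> agent_space G i"
    and strategies_closed: "\<And>i. closed (strategies G i)"
    and strategies_convex: "\<And>i. convex (strategies G i)"
    and constr_convex: "\<And>i j. convex_on UNIV (\<lambda>y. loc_constr G i (blk G i y) $ j)"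
    and constr_C2: "\<And>i. C2_map (\<lambda>y. loc_constr G i (blk G i y))"
    and slater_cq: "slater G"
    and loc_cost_differentiable:
      "\<And>i. (\<lambda>(y, w). loc_cost G i (blk G i y) w) differentiable_on UNIV"
    and cost_C1: "\<And>i. C1_map (cost G i)"
    and cost_convex: "\<And>i x. convex_on UNIV (\<lambda>y. cost G i (deviate G i y x))"
    and mu_pos: "\<mu> > 0"
    and strongly_monotone:
      "\<And>x y. (pseudo_gradient G x - pseudo_gradient G y) \<bullet> (x - y) \<ge> \<mu> * (norm (x - y))\<^sup>2"
    and graph: "undirected_connected E"
    and theta_pos: "\<theta> > 0"
    and ext_lipschitz: "\<theta>-lipschitz_on UNIV (\<lambda>(x, \<sigma>). ext_pseudo_gradient G x \<sigma>)"
    and gamma_pos: "\<And>i. \<gamma> $ i > 0"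
  shows "\<forall>s0 \<in> state_set G. \<exists>s.
           caratheodory_solution (dynamics G E \<gamma>) s0 s \<and>
           (\<forall>s'. caratheodory_solution (dynamics G E \<gamma>) s0 s' \<longrightarrow> (\<forall>t\<ge>0. s' t = s t)) \<and>
           (\<forall>t\<ge>0. s t \<in> state_set G) \<and>
           (\<exists>x \<tau> k z \<nu> \<nu>opt.
              (s \<longlongrightarrow> (x, \<tau>, k, z, \<nu>)) at_top \<and>
              dynamics G E \<gamma> (x, \<tau>, k, z, \<nu>) = 0 \<and>
              agg_stack G x + \<tau> = replicated (aggregate G x) \<and>
              \<nu> = replicated \<nu>opt \<and>
              KKT G x \<nu>opt \<and>
              is_vGNE G x \<and>
              (\<forall>y. is_vGNE G y \<longrightarrow> y = x))"
proof -
  interpret agg_setting G E \<gamma> \<mu> \<theta>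
    by (unfold_locales; fact assms)
  show ?thesis by (rule ballI) (rule solution_exists_unique_converges)
qed

end
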